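(* Let $R$ be an associative ring with identity (not necessarily commutative) with Jacobson radical $J(R)$, such that $R$ is complete with respect to the $J(R)$-adic topology. Let $\sigma$ be a ring automorphism of $R$ with $\sigma(J(R))\subseteq J(R)$, and let $\delta$ be a $\sigma$-nilpotent $\sigma$-derivation of $R$ with $\delta(R)\subseteq J(R)$ and $\delta(J(R))\subseteq J(R)^2$. Suppose that $R$ is left Noetherian and left regular, and that $R$ is PSF, i.e. every finitely generated projective left $R$-module is stably free. Then the skew power series ring $S=R[[x;\sigma,\delta]]$ is PSF, i.e. every finitely generated projective left $S$-module is stably free.
   Context: A $\sigma$-derivation of $R$ is a map $\delta:R\to R$ with $\delta(a+b)=\delta(a)+\delta(b)$ and $\delta(ab)=\sigma(a)\delta(b)+\delta(a)b$ for all $a,b\in R$. For integers $k,l\ge 0$, $M_{k,l}(Y,Z)$ denotes the sum of all noncommutative monomials in two variables $Y,Z$ with exactly $k$ factors $Y$ and $l$ factors $Z$; $M_{k,l}(\delta,\sigma)$ is the additive map $R\to R$ obtained by substituting $Y=\delta$, $Z=\sigma$ (products being compositions). The $\sigma$-derivation $\delta$ is called $\sigma$-nilpotent (with respect to the ideal $J(R)$) if for every $n\ge 1$ there is $m\ge 1$ such that $M(\delta,\sigma)(R)\subseteq J(R)^n$ for every noncommutative monomial $M$ in $Y,Z$ having at least $m$ factors $Y$. Skew power series ring: $S=R[[x;\sigma,\delta]]$ is the left $R$-module of all formal power series $\sum_{i\ge 0}a_i x^i$ with $a_i\in R$, with multiplication extending by continuity the rule $xr=\sigma(r)x+\delta(r)$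 ($r\in R$), explicitly $$\Big(\sum_{j\ge 0}a_jx^j\Big)\Big(\sum_{l\ge 0}b_lx^l\Big)=\sum_{m\ge 0}\Big(\sum_{n=0}^{m}\sum_{j\ge n}a_j\,M_{j-n,n}(\delta,\sigma)(b_{m-n})\Big)x^m,$$ where the infinite sums of coefficients converge in the $J(R)$-adic topology of $R$. "Complete" means that the natural map $R\to\varprojlim_k R/J(R)^k$ is an isomorphism. A ring $R$ is left regular if every finitely generated left $R$-module $M$ admits a finite resolution $0\to P_n\to\cdots\to P_0\to M\to 0$ with all $P_i$ finitely generated projective left $R$-modules ($n$ may depend on $M$). A left $R$-module $M$ is stably free if there are integers $r,s\ge 0$ with $R^r\cong R^s\oplus M$. *)

theory Defs
  imports "HOL-Algebra.Algebra"
begin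

section \<open>Left ideals, the Jacobson radical and adic completeness\<close>

locale left_ideal = additive_subgroup I R + ring R for I and R (structure) +
  assumes left_mult_closed: "\<lbrakk> r \<in> carrier R; a \<in> I \<rbrakk> \<Longrightarrow> r \<otimes> a \<in> I"

definition maximal_left_ideal :: "'a set \<Rightarrow> ('a, 'b) ring_scheme \<Rightarrow> bool" where
  "maximal_left_ideal I R \<longleftrightarrow> left_ideal I R \<and> I \<noteq> carrier R \<and>
     (\<forall>K. left_ideal K R \<and> I \<subseteq> K \<longrightarrow> K = I \<or> K = carrier R)"

text \<open>The intersection is taken inside \<^term>\<open>carrier R\<close>, so that the radical of the zero ring
  is the whole ring.\<close>

definition jacobson_radical :: "('a, 'b) ring_scheme \<Rightarrow> 'a set" where
  "jacobson_radical R = {a \<in> carrier R. \<forall>I. maximal_left_ideal I R \<longrightarrow> a \<in> I}"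

primrec ideal_power :: "('a, 'b) ring_scheme \<Rightarrow> 'a set \<Rightarrow> nat \<Rightarrow> 'a set" where
  "ideal_power R I 0 = carrier R"
| "ideal_power R I (Suc k) = ideal_prod R (ideal_power R I k) I"

text \<open>The inverse limit of the rings \<open>R/I\<^sup>k\<close>. The transition map \<open>R/I\<^sup>k\<^sup>+\<^sup>1 \<rightarrow> R/I\<^sup>k\<close> sends a
  coset \<open>A\<close> to \<open>I\<^sup>k + A\<close>.\<close>

definition adic_inverse_limit :: "('a, 'b) ring_scheme \<Rightarrow> 'a set \<Rightarrow> (nat \<Rightarrow> 'a set) ring" where
  "adic_inverse_limit R I =
    \<lparr> carrier = {A. \<forall>k. A k \<in> carrier (R Quot ideal_power R I k) \<and>
                        A k = ideal_power R I k <+>\<^bsub>R\<^esub> A (Suc k)},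
      monoid.mult = (\<lambda>A B k. A k \<otimes>\<^bsub>R Quot ideal_power R I k\<^esub> B k),
      one = (\<lambda>k. \<one>\<^bsub>R Quot ideal_power R I k\<^esub>),
      ring.zero = (\<lambda>k. \<zero>\<^bsub>R Quot ideal_power R I k\<^esub>),
      ring.add = (\<lambda>A B k. A k \<oplus>\<^bsub>R Quot ideal_power R I k\<^esub> B k) \<rparr>"

definition adically_complete :: "('a, 'b) ring_scheme \<Rightarrow> 'a set \<Rightarrow> bool" where
  "adically_complete R I \<longleftrightarrow>
     (\<lambda>r k. ideal_power R I k +>\<^bsub>R\<^esub> r) \<in> ring_iso R (adic_inverse_limit R I)"

text \<open>The sum of a series in the \<open>I\<close>-adic topology; the limit is unique as soon as the powers
  of \<open>I\<close> intersect in zero.\<close>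

definition adic_sums :: "('a, 'b) ring_scheme \<Rightarrow> 'a set \<Rightarrow> (nat \<Rightarrow> 'a) \<Rightarrow> 'a \<Rightarrow> bool" where
  "adic_sums R I f s \<longleftrightarrow> s \<in> carrier R \<and>
     (\<forall>k. \<exists>N. \<forall>n\<ge>N. (\<Oplus>\<^bsub>R\<^esub>i\<in>{..n}. f i) \<ominus>\<^bsub>R\<^esub> s \<in> ideal_power R I k)"

definition adic_suminf :: "('a, 'b) ring_scheme \<Rightarrow> 'a set \<Rightarrow> (nat \<Rightarrow> 'a) \<Rightarrow> 'a" where
  "adic_suminf R I f = (THE s. adic_sums R I f s)"


section \<open>Skew derivations and skew power series rings\<close>

definition sigma_derivation ::
    "('a, 'b) ring_scheme \<Rightarrow> ('a \<Rightarrow> 'a) \<Rightarrow> ('a \<Rightarrow> 'a) \<Rightarrow> bool" where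
  "sigma_derivation R \<sigma> \<delta> \<longleftrightarrow> \<delta> \<in> carrier R \<rightarrow> carrier R \<and>
     (\<forall>a\<in>carrier R. \<forall>b\<in>carrier R.
        \<delta> (a \<oplus>\<^bsub>R\<^esub> b) = \<delta> a \<oplus>\<^bsub>R\<^esub> \<delta> b \<and>
        \<delta> (a \<otimes>\<^bsub>R\<^esub> b) = (\<sigma> a \<otimes>\<^bsub>R\<^esub> \<delta> b) \<oplus>\<^bsub>R\<^esub> (\<delta> a \<otimes>\<^bsub>R\<^esub> b))"

text \<open>Noncommutative monomials in \<open>Y\<close>, \<open>Z\<close> are words, and
  \<open>monomial_map \<delta> \<sigma> w\<close> is the composition obtained from \<open>w\<close> by \<open>Y = \<delta>\<close>, \<open>Z = \<sigma>\<close>.\<close>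

datatype var = VarY | VarZ

primrec monomial_map :: "('a \<Rightarrow> 'a) \<Rightarrow> ('a \<Rightarrow> 'a) \<Rightarrow> var list \<Rightarrow> 'a \<Rightarrow> 'a" where
  "monomial_map \<delta> \<sigma> [] = id"
| "monomial_map \<delta> \<sigma> (v # w) = (case v of VarY \<Rightarrow> \<delta> | VarZ \<Rightarrow> \<sigma>) \<circ> monomial_map \<delta> \<sigma> w"

definition M_sum ::
    "('a, 'b) ring_scheme \<Rightarrow> ('a \<Rightarrow> 'a) \<Rightarrow> ('a \<Rightarrow> 'a) \<Rightarrow> nat \<Rightarrow> nat \<Rightarrow> 'a \<Rightarrow> 'a" where
  "M_sum R \<delta> \<sigma> k l r =
     (\<Oplus>\<^bsub>R\<^esub>w\<in>{w. count_list w VarY = k \<and> count_list w VarZ = l}. monomial_map \<delta> \<sigma> w r)"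

definition sigma_nilpotent ::
    "('a, 'b) ring_scheme \<Rightarrow> 'a set \<Rightarrow> ('a \<Rightarrow> 'a) \<Rightarrow> ('a \<Rightarrow> 'a) \<Rightarrow> bool" where
  "sigma_nilpotent R I \<sigma> \<delta> \<longleftrightarrow>
     (\<forall>n\<ge>1. \<exists>m\<ge>1. \<forall>w. count_list w VarY \<ge> m \<longrightarrow>
        monomial_map \<delta> \<sigma> w ` carrier R \<subseteq> ideal_power R I n)"

text \<open>A power series \<open>\<Sum> a\<^sub>i x\<^sup>i\<close> is its coefficient sequence. In the product the inner sum over
  \<open>j \<ge> n\<close> is reindexed by \<open>j = n + i\<close>.\<close>

definition skew_power_series ::
    "('a, 'b) ring_scheme \<Rightarrow> ('a \<Rightarrow> 'a) \<Rightarrow> ('a \<Rightarrow> 'a) \<Rightarrow> (nat \<Rightarrow> 'a) ring" where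
  "skew_power_series R \<sigma> \<delta> =
    \<lparr> carrier = UNIV \<rightarrow> carrier R,
      monoid.mult = (\<lambda>a b m. \<Oplus>\<^bsub>R\<^esub>n\<in>{..m}. adic_suminf R (jacobson_radical R)
                (\<lambda>i. a (n + i) \<otimes>\<^bsub>R\<^esub> M_sum R \<delta> \<sigma> i n (b (m - n)))),
      one = (\<lambda>m. if m = 0 then \<one>\<^bsub>R\<^esub> else \<zero>\<^bsub>R\<^esub>),
      ring.zero = (\<lambda>m. \<zero>\<^bsub>R\<^esub>),
      ring.add = (\<lambda>a b m. a m \<oplus>\<^bsub>R\<^esub> b m) \<rparr>"


section \<open>Left modules over a noncommutative ring\<close>

text \<open>The locale \<^locale>\<open>module\<close> of the library asks for a commutative ring of scalars; only its
  record type is used here. The fields \<^const>\<open>monoid.mult\<close> and \<^const>\<open>monoid.one\<close> of a module carry no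
  information.\<close>

locale left_module = R?: ring R + M?: abelian_group M
  for R :: "('a, 'c) ring_scheme" (structure)
    and M :: "('a, 'm, 'd) module_scheme" (structure) +
  assumes smult_closed [simp, intro]:
      "\<lbrakk> a \<in> carrier R; x \<in> carrier M \<rbrakk> \<Longrightarrow> a \<odot>\<^bsub>M\<^esub> x \<in> carrier M"
    and smult_l_distr:
      "\<lbrakk> a \<in> carrier R; b \<in> carrier R; x \<in> carrier M \<rbrakk> \<Longrightarrow>
         (a \<oplus>\<^bsub>R\<^esub> b) \<odot>\<^bsub>M\<^esub> x = (a \<odot>\<^bsub>M\<^esub> x) \<oplus>\<^bsub>M\<^esub> (b \<odot>\<^bsub>M\<^esub> x)"
    and smult_r_distr:
      "\<lbrakk> a \<in> carrier R; x \<in> carrier M; y \<in> carrier M \<rbrakk> \<Longrightarrow>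
         a \<odot>\<^bsub>M\<^esub> (x \<oplus>\<^bsub>M\<^esub> y) = (a \<odot>\<^bsub>M\<^esub> x) \<oplus>\<^bsub>M\<^esub> (a \<odot>\<^bsub>M\<^esub> y)"
    and smult_assoc1:
      "\<lbrakk> a \<in> carrier R; b \<in> carrier R; x \<in> carrier M \<rbrakk> \<Longrightarrow>
         (a \<otimes>\<^bsub>R\<^esub> b) \<odot>\<^bsub>M\<^esub> x = a \<odot>\<^bsub>M\<^esub> (b \<odot>\<^bsub>M\<^esub> x)"
    and smult_one [simp]: "x \<in> carrier M \<Longrightarrow> \<one>\<^bsub>R\<^esub> \<odot>\<^bsub>M\<^esub> x = x"

definition lmod_hom ::
    "('a, 'c) ring_scheme \<Rightarrow> ('a, 'm) module \<Rightarrow> ('a, 'n) module \<Rightarrow> ('m \<Rightarrow> 'n) set" where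
  "lmod_hom R M N = {h. h \<in> carrier M \<rightarrow> carrier N \<and>
     (\<forall>x\<in>carrier M. \<forall>y\<in>carrier M. h (x \<oplus>\<^bsub>M\<^esub> y) = h x \<oplus>\<^bsub>N\<^esub> h y) \<and>
     (\<forall>a\<in>carrier R. \<forall>x\<in>carrier M. h (a \<odot>\<^bsub>M\<^esub> x) = a \<odot>\<^bsub>N\<^esub> h x)}"

definition lmod_isomorphic ::
    "('a, 'c) ring_scheme \<Rightarrow> ('a, 'm) module \<Rightarrow> ('a, 'n) module \<Rightarrow> bool" where
  "lmod_isomorphic R M N \<longleftrightarrow> (\<exists>h\<in>lmod_hom R M N. bij_betw h (carrier M) (carrier N))"

definition lmod_dsum :: "('a, 'm) module \<Rightarrow> ('a, 'n) module \<Rightarrow> ('a, 'm \<times> 'n) module" where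
  "lmod_dsum M N =
    \<lparr> carrier = carrier M \<times> carrier N,
      monoid.mult = undefined, one = undefined,
      ring.zero = (\<zero>\<^bsub>M\<^esub>, \<zero>\<^bsub>N\<^esub>),
      ring.add = (\<lambda>(x, y) (x', y'). (x \<oplus>\<^bsub>M\<^esub> x', y \<oplus>\<^bsub>N\<^esub> y')),
      smult = (\<lambda>a (x, y). (a \<odot>\<^bsub>M\<^esub> x, a \<odot>\<^bsub>N\<^esub> y)) \<rparr>"

definition free_lmod :: "('a, 'c) ring_scheme \<Rightarrow> 'i set \<Rightarrow> ('a, 'i \<Rightarrow> 'a) module" where
  "free_lmod R I =
    \<lparr> carrier = {u \<in> I \<rightarrow>\<^sub>E carrier R. finite {i \<in> I. u i \<noteq> \<zero>\<^bsub>R\<^esub>}},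
      monoid.mult = undefined, one = undefined,
      ring.zero = (\<lambda>i\<in>I. \<zero>\<^bsub>R\<^esub>),
      ring.add = (\<lambda>u v. \<lambda>i\<in>I. u i \<oplus>\<^bsub>R\<^esub> v i),
      smult = (\<lambda>a u. \<lambda>i\<in>I. a \<otimes>\<^bsub>R\<^esub> u i) \<rparr>"

abbreviation free_lmod_rank :: "('a, 'c) ring_scheme \<Rightarrow> nat \<Rightarrow> ('a, nat \<Rightarrow> 'a) module" where
  "free_lmod_rank R n \<equiv> free_lmod R {..<n}"

definition fin_gen_lmod :: "('a, 'c) ring_scheme \<Rightarrow> ('a, 'm) module \<Rightarrow> bool" where
  "fin_gen_lmod R M \<longleftrightarrow> left_module R M \<and>
     (\<exists>A. finite A \<and> A \<subseteq> carrier M \<and>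
        (\<forall>x\<in>carrier M. \<exists>c\<in>A \<rightarrow> carrier R. x = (\<Oplus>\<^bsub>M\<^esub>a\<in>A. c a \<odot>\<^bsub>M\<^esub> a)))"

text \<open>Projectivity is the lifting property against surjections \<open>N \<rightarrow> N'\<close>. A definition can only
  quantify over modules with elements in fixed types; the types chosen here contain the canonical
  free cover of \<open>P\<close>, and lemma \<open>projective_lmod_lift\<close> below shows that the lifting
  property then holds against surjections of modules over arbitrary types.\<close>

definition projective_lmod :: "('a, 'c) ring_scheme \<Rightarrow> ('a, 'm) module \<Rightarrow> bool" where
  "projective_lmod R P \<longleftrightarrow> left_module R P \<and>
     (\<forall>(N :: ('a, 'm \<Rightarrow> 'a) module) (N' :: ('a, 'm) module).
        left_module R N \<and> left_module R N' \<longrightarrow>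
        (\<forall>g\<in>lmod_hom R N N'. \<forall>f\<in>lmod_hom R P N'. g ` carrier N = carrier N' \<longrightarrow>
           (\<exists>h\<in>lmod_hom R P N. \<forall>x\<in>carrier P. g (h x) = f x)))"

definition stably_free_lmod :: "('a, 'c) ring_scheme \<Rightarrow> ('a, 'm) module \<Rightarrow> bool" where
  "stably_free_lmod R M \<longleftrightarrow> left_module R M \<and>
     (\<exists>r s. lmod_isomorphic R (free_lmod_rank R r) (lmod_dsum (free_lmod_rank R s) M))"


section \<open>Noetherian, regular and PSF rings\<close>

definition left_noetherian :: "('a, 'b) ring_scheme \<Rightarrow> bool" where
  "left_noetherian R \<longleftrightarrow> ring R \<and>
     (\<forall>I :: nat \<Rightarrow> 'a set. (\<forall>n. left_ideal (I n) R \<and> I n \<subseteq> I (Suc n)) \<longrightarrow>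
        (\<exists>N. \<forall>n\<ge>N. I n = I N))"

text \<open>\<open>fg_projective_resolution R M n P \<epsilon> d\<close> is a resolution
  \<open>0 \<rightarrow> P n \<rightarrow> \<dots> \<rightarrow> P 0 \<rightarrow> M \<rightarrow> 0\<close>, with augmentation \<open>\<epsilon> : P 0 \<rightarrow> M\<close> and
  differentials \<open>d i : P (i + 1) \<rightarrow> P i\<close> for \<open>i < n\<close>.\<close>

definition fg_projective_resolution ::
    "('a, 'c) ring_scheme \<Rightarrow> ('a, 'm) module \<Rightarrow> nat \<Rightarrow> (nat \<Rightarrow> ('a, 'p) module) \<Rightarrow>
     ('p \<Rightarrow> 'm) \<Rightarrow> (nat \<Rightarrow> 'p \<Rightarrow> 'p) \<Rightarrow> bool" where
  "fg_projective_resolution R M n P \<epsilon> d \<longleftrightarrow>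
     (\<forall>i\<le>n. fin_gen_lmod R (P i) \<and> projective_lmod R (P i)) \<and>
     \<epsilon> \<in> lmod_hom R (P 0) M \<and> (\<forall>i<n. d i \<in> lmod_hom R (P (Suc i)) (P i)) \<and>
     \<epsilon> ` carrier (P 0) = carrier M \<and>
     (\<forall>i<n. d i ` carrier (P (Suc i)) =
        (if i = 0 then {x \<in> carrier (P 0). \<epsilon> x = \<zero>\<^bsub>M\<^esub>}
         else {x \<in> carrier (P i). d (i - 1) x = \<zero>\<^bsub>P (i - 1)\<^esub>})) \<and>
     (if n = 0 then inj_on \<epsilon> (carrier (P 0)) else inj_on (d (n - 1)) (carrier (P n)))"

text \<open>The type argument of \<open>left_regular\<close> and \<open>psf\<close> is the type of elements of the modules
  considered. For \<open>R\<close> over \<open>'a\<close> the type \<open>(nat \<Rightarrow> 'a) set\<close> exhausts all cases up to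
  isomorphism: a finitely generated module is isomorphic to some \<open>R\<^sup>n/K\<close>, whose elements
  are sets of elements of \<open>R\<^sup>n\<close>.\<close>

definition left_regular :: "'m itself \<Rightarrow> ('a, 'b) ring_scheme \<Rightarrow> bool" where
  "left_regular (T :: 'm itself) R \<longleftrightarrow> ring R \<and>
     (\<forall>M :: ('a, 'm) module. fin_gen_lmod R M \<longrightarrow>
        (\<exists>n (P :: nat \<Rightarrow> ('a, 'm) module) \<epsilon> d. fg_projective_resolution R M n P \<epsilon> d))"

definition psf :: "'m itself \<Rightarrow> ('a, 'b) ring_scheme \<Rightarrow> bool" where
  "psf (T :: 'm itself) R \<longleftrightarrow> ring R \<and>
     (\<forall>M :: ('a, 'm) module. fin_gen_lmod R M \<and> projective_lmod R M \<longrightarrow> stably_free_lmod R M)"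


section \<open>Projectivity does not depend on the choice of types\<close>

lemma (in left_module) smult_l_null: "x \<in> carrier M \<Longrightarrow> \<zero> \<odot>\<^bsub>M\<^esub> x = \<zero>\<^bsub>M\<^esub>"
  using smult_l_distr[of "\<zero>" "\<zero>" x] M.add.l_cancel_one[of "\<zero> \<odot>\<^bsub>M\<^esub> x" "\<zero> \<odot>\<^bsub>M\<^esub> x"]
  by simp

lemma (in left_module) smult_r_null: "a \<in> carrier R \<Longrightarrow> a \<odot>\<^bsub>M\<^esub> \<zero>\<^bsub>M\<^esub> = \<zero>\<^bsub>M\<^esub>"
  using smult_r_distr[of a "\<zero>\<^bsub>M\<^esub>" "\<zero>\<^bsub>M\<^esub>"]
    M.add.l_cancel_one[of "a \<odot>\<^bsub>M\<^esub> \<zero>\<^bsub>M\<^esub>" "a \<odot>\<^bsub>M\<^esub> \<zero>\<^bsub>M\<^esub>"]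
  by simp

lemma (in left_module) finsum_smult:
  assumes "finite A" "a \<in> carrier R" "f \<in> A \<rightarrow> carrier M"
  shows "a \<odot>\<^bsub>M\<^esub> (\<Oplus>\<^bsub>M\<^esub>i\<in>A. f i) = (\<Oplus>\<^bsub>M\<^esub>i\<in>A. a \<odot>\<^bsub>M\<^esub> f i)"
  using assms(1,3)
proof (induction A rule: finite_induct)
  case empty
  then show ?case using assms(2) by (simp add: smult_r_null)
next
  case (insert i A)
  then have f: "f \<in> A \<rightarrow> carrier M" "f i \<in> carrier M" by auto
  then have "(\<lambda>i. a \<odot>\<^bsub>M\<^esub> f i) \<in> A \<rightarrow> carrier M" using assms(2) by auto
  then show ?case using insert f assms(2)
    by (simp add: M.finsum_insert smult_r_distr M.finsum_closed)
qed

lemma lmod_hom_zero: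
  assumes "left_module R M" "left_module R N" "h \<in> lmod_hom R M N"
  shows "h \<zero>\<^bsub>M\<^esub> = \<zero>\<^bsub>N\<^esub>"
proof -
  interpret M: left_module R M by fact
  interpret N: left_module R N by fact
  have c: "h \<zero>\<^bsub>M\<^esub> \<in> carrier N" using assms(3) by (auto simp: lmod_hom_def)
  have "h (\<zero>\<^bsub>M\<^esub> \<oplus>\<^bsub>M\<^esub> \<zero>\<^bsub>M\<^esub>) = h \<zero>\<^bsub>M\<^esub> \<oplus>\<^bsub>N\<^esub> h \<zero>\<^bsub>M\<^esub>"
    using assms(3) M.M.zero_closed unfolding lmod_hom_def by blast
  then show ?thesis using c N.M.add.l_cancel_one[of "h \<zero>\<^bsub>M\<^esub>" "h \<zero>\<^bsub>M\<^esub>"] by simp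
qed

lemma lmod_hom_finsum:
  assumes "left_module R M" "left_module R N" "h \<in> lmod_hom R M N" "finite A"
    "f \<in> A \<rightarrow> carrier M"
  shows "h (\<Oplus>\<^bsub>M\<^esub>i\<in>A. f i) = (\<Oplus>\<^bsub>N\<^esub>i\<in>A. h (f i))"
  using assms(4,5)
proof (induction A rule: finite_induct)
  case empty
  interpret M: left_module R M by fact
  interpret N: left_module R N by fact
  show ?case using lmod_hom_zero[OF assms(1-3)] by simp
next
  case (insert i A)
  interpret M: left_module R M by fact
  interpret N: left_module R N by fact
  have f: "f \<in> A \<rightarrow> carrier M" "f i \<in> carrier M" using insert by auto
  have s: "(\<Oplus>\<^bsub>M\<^esub>i\<in>A. f i) \<in> carrier M" using f by (simp add: M.M.finsum_closed)
  have hf: "(\<lambda>i. h (f i)) \<in> A \<rightarrow> carrier N" "h (f i) \<in> carrier N"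
    using f assms(3) by (auto simp: lmod_hom_def)
  have "h (f i \<oplus>\<^bsub>M\<^esub> (\<Oplus>\<^bsub>M\<^esub>i\<in>A. f i)) = h (f i) \<oplus>\<^bsub>N\<^esub> h (\<Oplus>\<^bsub>M\<^esub>i\<in>A. f i)"
    using f s assms(3) unfolding lmod_hom_def by blast
  then show ?case using insert f hf
    by (simp add: M.M.finsum_insert N.M.finsum_insert)
qed

lemma free_lmod_left_module:
  assumes "ring R"
  shows "left_module R (free_lmod R I)"
proof -
  interpret ring R by fact
  let ?F = "free_lmod R I"
  have add_closed: "u \<oplus>\<^bsub>?F\<^esub> v \<in> carrier ?F" if "u \<in> carrier ?F" "v \<in> carrier ?F" for u v
  proof -
    have "finite ({i \<in> I. u i \<noteq> \<zero>\<^bsub>R\<^esub>} \<union> {i \<in> I. v i \<noteq> \<zero>\<^bsub>R\<^esub>})"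
      using that by (auto simp: free_lmod_def)
    then have "finite {i \<in> I. u i \<oplus>\<^bsub>R\<^esub> v i \<noteq> \<zero>\<^bsub>R\<^esub>}"
      by (rule rev_finite_subset) auto
    then have "finite {i \<in> I. (\<lambda>i\<in>I. u i \<oplus>\<^bsub>R\<^esub> v i) i \<noteq> \<zero>\<^bsub>R\<^esub>}"
      by (rule rev_finite_subset) auto
    then show ?thesis using that by (auto simp: free_lmod_def PiE_iff)
  qed
  have smult_cl: "a \<odot>\<^bsub>?F\<^esub> u \<in> carrier ?F" if "a \<in> carrier R" "u \<in> carrier ?F" for a u
  proof -
    have "finite {i \<in> I. u i \<noteq> \<zero>\<^bsub>R\<^esub>}"
      using that by (auto simp: free_lmod_def)
    then have "finite {i \<in> I. (\<lambda>i\<in>I. a \<otimes>\<^bsub>R\<^esub> u i) i \<noteq> \<zero>\<^bsub>R\<^esub>}"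
      by (rule rev_finite_subset) (use that in auto)
    then show ?thesis using that by (auto simp: free_lmod_def PiE_iff)
  qed
  have mem: "u i \<in> carrier R" if "u \<in> carrier ?F" "i \<in> I" for u i
    using that by (auto simp: free_lmod_def)
  have eq: "u = v" if "u \<in> carrier ?F" "v \<in> carrier ?F" "\<And>i. i \<in> I \<Longrightarrow> u i = v i" for u v
    using that by (auto simp: free_lmod_def intro: PiE_ext)
  have add_app: "(u \<oplus>\<^bsub>?F\<^esub> v) i = u i \<oplus>\<^bsub>R\<^esub> v i" if "i \<in> I" for u v i
    using that by (simp add: free_lmod_def)
  have smult_app: "(a \<odot>\<^bsub>?F\<^esub> v) i = a \<otimes>\<^bsub>R\<^esub> v i" if "i \<in> I" for a v i
    using that by (simp add: free_lmod_def)
  have zero_app: "\<zero>\<^bsub>?F\<^esub> i = \<zero>\<^bsub>R\<^esub>" if "i \<in> I" for i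
    using that by (simp add: free_lmod_def)
  have zero_cl: "\<zero>\<^bsub>?F\<^esub> \<in> carrier ?F"
    by (auto simp: free_lmod_def)
  have ag: "abelian_group ?F"
  proof (rule abelian_groupI)
    fix u assume u: "u \<in> carrier ?F"
    have "(\<ominus>\<^bsub>R\<^esub> \<one>\<^bsub>R\<^esub>) \<odot>\<^bsub>?F\<^esub> u \<oplus>\<^bsub>?F\<^esub> u = \<zero>\<^bsub>?F\<^esub>"
      by (rule eq) (use u in \<open>auto simp: add_closed smult_cl zero_cl add_app smult_app zero_app mem
            l_minus l_neg\<close>)
    then show "\<exists>y\<in>carrier ?F. y \<oplus>\<^bsub>?F\<^esub> u = \<zero>\<^bsub>?F\<^esub>"
      using smult_cl[OF _ u, of "\<ominus>\<^bsub>R\<^esub> \<one>\<^bsub>R\<^esub>"] by auto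
  qed (auto intro!: eq simp: add_closed zero_cl add_app zero_app mem a_ac)
  show ?thesis
    by (intro left_module.intro left_module_axioms.intro assms ag)
       (auto intro!: eq simp: add_closed smult_cl add_app smult_app mem l_distr r_distr m_assoc)
qed

text \<open>The homomorphism out of a free module that sends the \<open>i\<close>-th basis vector to \<open>c i\<close>.\<close>

definition free_lmod_map :: "('a, 'c) ring_scheme \<Rightarrow> 'i set \<Rightarrow> ('a, 'n) module \<Rightarrow> ('i \<Rightarrow> 'n) \<Rightarrow>
    ('i \<Rightarrow> 'a) \<Rightarrow> 'n" where
  "free_lmod_map R I N c u = (\<Oplus>\<^bsub>N\<^esub>i\<in>{i \<in> I. u i \<noteq> \<zero>\<^bsub>R\<^esub>}. u i \<odot>\<^bsub>N\<^esub> c i)"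

lemma free_lmod_map_superset:
  assumes "left_module R N" "c \<in> I \<rightarrow> carrier N" "u \<in> I \<rightarrow> carrier R"
    "finite B" "{i \<in> I. u i \<noteq> \<zero>\<^bsub>R\<^esub>} \<subseteq> B" "B \<subseteq> I"
  shows "free_lmod_map R I N c u = (\<Oplus>\<^bsub>N\<^esub>i\<in>B. u i \<odot>\<^bsub>N\<^esub> c i)"
proof -
  interpret N: left_module R N by fact
  have cl: "(\<lambda>i. u i \<odot>\<^bsub>N\<^esub> c i) \<in> B \<rightarrow> carrier N"
    by (intro Pi_I N.smult_closed funcset_mem[OF assms(3)] funcset_mem[OF assms(2)]
          subsetD[OF assms(6)])
  have "u i \<odot>\<^bsub>N\<^esub> c i = \<zero>\<^bsub>N\<^esub>" if "i \<in> B - {i \<in> I. u i \<noteq> \<zero>\<^bsub>R\<^esub>}" for i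
  proof -
    have "i \<in> I" "u i = \<zero>\<^bsub>R\<^esub>" using that assms(6) by auto
    then show ?thesis using N.smult_l_null[OF funcset_mem[OF assms(2)]] by simp
  qed
  then show ?thesis unfolding free_lmod_map_def
    using assms(4,5) cl by (intro N.M.add.finprod_mono_neutral_cong_left) auto
qed

lemma free_lmod_map_hom:
  assumes "left_module R N" "c \<in> I \<rightarrow> carrier N"
  shows "free_lmod_map R I N c \<in> lmod_hom R (free_lmod R I) N"
proof -
  interpret N: left_module R N by fact
  let ?F = "free_lmod R I" and ?h = "free_lmod_map R I N c"
  interpret F: left_module R ?F by (rule free_lmod_left_module) (rule N.R.ring_axioms)
  have memF: "u \<in> I \<rightarrow> carrier R" "finite {i \<in> I. u i \<noteq> \<zero>\<^bsub>R\<^esub>}" if "u \<in> carrier ?F" for u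
    using that by (auto simp: free_lmod_def)
  have cl: "(\<lambda>i. u i \<odot>\<^bsub>N\<^esub> c i) \<in> B \<rightarrow> carrier N" if "u \<in> carrier ?F" "B \<subseteq> I" for u B
    by (intro Pi_I N.smult_closed funcset_mem[OF memF(1)[OF that(1)]] funcset_mem[OF assms(2)]
          subsetD[OF that(2)])
  have 1: "?h u \<in> carrier N" if "u \<in> carrier ?F" for u
    unfolding free_lmod_map_def by (intro N.M.finsum_closed cl[OF that]) auto
  have 2: "?h (u \<oplus>\<^bsub>?F\<^esub> v) = ?h u \<oplus>\<^bsub>N\<^esub> ?h v" if uv: "u \<in> carrier ?F" "v \<in> carrier ?F" for u v
  proof -
    let ?B = "{i \<in> I. u i \<noteq> \<zero>\<^bsub>R\<^esub>} \<union> {i \<in> I. v i \<noteq> \<zero>\<^bsub>R\<^esub>}"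
    have B: "finite ?B" "?B \<subseteq> I" using memF uv by auto
    have w: "u \<oplus>\<^bsub>?F\<^esub> v \<in> carrier ?F" using uv by simp
    have app: "(u \<oplus>\<^bsub>?F\<^esub> v) i = u i \<oplus>\<^bsub>R\<^esub> v i" if "i \<in> I" for i
      using that by (simp add: free_lmod_def)
    have sub: "{i \<in> I. (u \<oplus>\<^bsub>?F\<^esub> v) i \<noteq> \<zero>\<^bsub>R\<^esub>} \<subseteq> ?B" by (auto simp: app)
    have "?h (u \<oplus>\<^bsub>?F\<^esub> v) = (\<Oplus>\<^bsub>N\<^esub>i\<in>?B. (u \<oplus>\<^bsub>?F\<^esub> v) i \<odot>\<^bsub>N\<^esub> c i)"
      by (rule free_lmod_map_superset[OF assms memF(1)[OF w] B(1) sub B(2)])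
    also have "\<dots> = (\<Oplus>\<^bsub>N\<^esub>i\<in>?B. (u i \<odot>\<^bsub>N\<^esub> c i) \<oplus>\<^bsub>N\<^esub> (v i \<odot>\<^bsub>N\<^esub> c i))"
    proof (rule N.M.add.finprod_cong')
      show "(\<lambda>i. (u i \<odot>\<^bsub>N\<^esub> c i) \<oplus>\<^bsub>N\<^esub> (v i \<odot>\<^bsub>N\<^esub> c i)) \<in> ?B \<rightarrow> carrier N"
        using cl[OF uv(1) B(2)] cl[OF uv(2) B(2)] by blast
      fix i assume "i \<in> ?B"
      then have i: "i \<in> I" by auto
      then have "u i \<in> carrier R" "v i \<in> carrier R" "c i \<in> carrier N"
        using memF(1)[OF uv(1)] memF(1)[OF uv(2)] assms(2) by auto
      then show "(u \<oplus>\<^bsub>?F\<^esub> v) i \<odot>\<^bsub>N\<^esub> c i = (u i \<odot>\<^bsub>N\<^esub> c i) \<oplus>\<^bsub>N\<^esub> (v i \<odot>\<^bsub>N\<^esub> c i)"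
        using N.smult_l_distr app[OF i] by simp
    qed simp
    also have "\<dots> = (\<Oplus>\<^bsub>N\<^esub>i\<in>?B. u i \<odot>\<^bsub>N\<^esub> c i) \<oplus>\<^bsub>N\<^esub> (\<Oplus>\<^bsub>N\<^esub>i\<in>?B. v i \<odot>\<^bsub>N\<^esub> c i)"
      by (rule N.M.finsum_addf[OF cl[OF uv(1) B(2)] cl[OF uv(2) B(2)]])
    also have "\<dots> = ?h u \<oplus>\<^bsub>N\<^esub> ?h v"
      using free_lmod_map_superset[OF assms memF(1)[OF uv(1)] B(1) _ B(2)]
        free_lmod_map_superset[OF assms memF(1)[OF uv(2)] B(1) _ B(2)] by simp
    finally show ?thesis .
  qed
  have 3: "?h (a \<odot>\<^bsub>?F\<^esub> u) = a \<odot>\<^bsub>N\<^esub> ?h u" if u: "u \<in> carrier ?F" and a: "a \<in> carrier R" for a u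
  proof -
    let ?B = "{i \<in> I. u i \<noteq> \<zero>\<^bsub>R\<^esub>}"
    have B: "finite ?B" "?B \<subseteq> I" using memF u by auto
    have w: "a \<odot>\<^bsub>?F\<^esub> u \<in> carrier ?F" using u a by simp
    have app: "(a \<odot>\<^bsub>?F\<^esub> u) i = a \<otimes>\<^bsub>R\<^esub> u i" if "i \<in> I" for i
      using that by (simp add: free_lmod_def)
    have sub: "{i \<in> I. (a \<odot>\<^bsub>?F\<^esub> u) i \<noteq> \<zero>\<^bsub>R\<^esub>} \<subseteq> ?B" using a by (auto simp: app)
    have "?h (a \<odot>\<^bsub>?F\<^esub> u) = (\<Oplus>\<^bsub>N\<^esub>i\<in>?B. (a \<odot>\<^bsub>?F\<^esub> u) i \<odot>\<^bsub>N\<^esub> c i)"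
      by (rule free_lmod_map_superset[OF assms memF(1)[OF w] B(1) sub B(2)])
    also have "\<dots> = (\<Oplus>\<^bsub>N\<^esub>i\<in>?B. a \<odot>\<^bsub>N\<^esub> (u i \<odot>\<^bsub>N\<^esub> c i))"
    proof (rule N.M.add.finprod_cong')
      show "(\<lambda>i. a \<odot>\<^bsub>N\<^esub> (u i \<odot>\<^bsub>N\<^esub> c i)) \<in> ?B \<rightarrow> carrier N"
        using cl[OF u B(2)] a by blast
      fix i assume "i \<in> ?B"
      then have i: "i \<in> I" by auto
      then have "u i \<in> carrier R" "c i \<in> carrier N"
        using memF(1)[OF u] assms(2) by auto
      then show "(a \<odot>\<^bsub>?F\<^esub> u) i \<odot>\<^bsub>N\<^esub> c i = a \<odot>\<^bsub>N\<^esub> (u i \<odot>\<^bsub>N\<^esub> c i)"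
        using N.smult_assoc1 a app[OF i] by simp
    qed simp
    also have "\<dots> = a \<odot>\<^bsub>N\<^esub> ?h u"
      unfolding free_lmod_map_def by (rule N.finsum_smult[OF B(1) a cl[OF u B(2)], symmetric])
    finally show ?thesis .
  qed
  show ?thesis
    unfolding lmod_hom_def by (intro CollectI conjI ballI funcsetI) (simp_all only: 1 2 3)
qed

lemma projective_lmod_lift:
  fixes P :: "('a, 'm) module" and N :: "('a, 'n) module" and N' :: "('a, 'k) module"
  assumes "projective_lmod R P" "left_module R N" "left_module R N'"
    "g \<in> lmod_hom R N N'" "f \<in> lmod_hom R P N'" "g ` carrier N = carrier N'"
  shows "\<exists>h\<in>lmod_hom R P N. \<forall>x\<in>carrier P. g (h x) = f x"
proof -
  have P: "left_module R P" using assms(1) by (simp add: projective_lmod_def)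
  interpret P: left_module R P by fact
  interpret N: left_module R N by fact
  interpret N': left_module R N' by fact
  let ?I = "carrier P"
  let ?F = "free_lmod R ?I"
  have F: "left_module R ?F" by (rule free_lmod_left_module) (rule P.R.ring_axioms)
  let ?p = "free_lmod_map R ?I P (\<lambda>x. x)"
  have p: "?p \<in> lmod_hom R ?F P" by (rule free_lmod_map_hom[OF P]) auto
  have surj: "?p ` carrier ?F = carrier P"
  proof
    show "?p ` carrier ?F \<subseteq> carrier P" using p by (auto simp: lmod_hom_def)
    show "carrier P \<subseteq> ?p ` carrier ?F"
    proof
      fix x assume x: "x \<in> carrier P"
      let ?u = "\<lambda>y\<in>?I. if y = x then \<one>\<^bsub>R\<^esub> else \<zero>\<^bsub>R\<^esub>"
      have "finite {i \<in> ?I. ?u i \<noteq> \<zero>\<^bsub>R\<^esub>}" by (rule finite_subset[of _ "{x}"]) auto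
      then have u: "?u \<in> carrier ?F" by (auto simp: free_lmod_def)
      have "?p ?u = (\<Oplus>\<^bsub>P\<^esub>i\<in>{x}. ?u i \<odot>\<^bsub>P\<^esub> i)"
        by (rule free_lmod_map_superset[OF P]) (use x in auto)
      also have "\<dots> = x" using x by simp
      finally show "x \<in> ?p ` carrier ?F" using u by force
    qed
  qed
  have idh: "(\<lambda>x. x) \<in> lmod_hom R P P" by (auto simp: lmod_hom_def)
  obtain s where s: "s \<in> lmod_hom R P ?F" "\<And>x. x \<in> carrier P \<Longrightarrow> ?p (s x) = x"
    using assms(1) F P p idh surj unfolding projective_lmod_def by meson
  have "\<forall>x\<in>carrier P. \<exists>y\<in>carrier N. g y = f x"
  proof
    fix x assume "x \<in> carrier P"
    then have "f x \<in> carrier N'" using assms(5) by (auto simp: lmod_hom_def)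
    then show "\<exists>y\<in>carrier N. g y = f x" using assms(6) by (metis imageE)
  qed
  then obtain c where c: "\<And>x. x \<in> carrier P \<Longrightarrow> c x \<in> carrier N \<and> g (c x) = f x" by metis
  then have cN: "c \<in> ?I \<rightarrow> carrier N" by auto
  let ?q = "free_lmod_map R ?I N c"
  have q: "?q \<in> lmod_hom R ?F N" by (rule free_lmod_map_hom[OF assms(2) cN])
  have "(\<lambda>x. ?q (s x)) \<in> lmod_hom R P N"
    using s(1) q by (auto simp: lmod_hom_def Pi_iff)
  moreover have "g (?q (s x)) = f x" if x: "x \<in> carrier P" for x
  proof -
    let ?A = "{i \<in> ?I. s x i \<noteq> \<zero>\<^bsub>R\<^esub>}"
    have "s x \<in> carrier ?F" using s(1) x by (auto simp: lmod_hom_def)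
    then have A: "finite ?A" and sx: "\<And>i. i \<in> ?I \<Longrightarrow> s x i \<in> carrier R"
      by (auto simp: free_lmod_def)
    have "g (?q (s x)) = (\<Oplus>\<^bsub>N'\<^esub>i\<in>?A. g (s x i \<odot>\<^bsub>N\<^esub> c i))"
      unfolding free_lmod_map_def
      by (rule lmod_hom_finsum[OF assms(2,3,4) A]) (use sx c in auto)
    also have "\<dots> = (\<Oplus>\<^bsub>N'\<^esub>i\<in>?A. f (s x i \<odot>\<^bsub>P\<^esub> i))"
    proof (rule N'.M.add.finprod_cong')
      show "(\<lambda>i. f (s x i \<odot>\<^bsub>P\<^esub> i)) \<in> ?A \<rightarrow> carrier N'"
        using sx assms(5) by (auto simp: lmod_hom_def)
      fix i assume "i \<in> ?A"
      then have i: "i \<in> ?I" by auto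
      have "g (s x i \<odot>\<^bsub>N\<^esub> c i) = s x i \<odot>\<^bsub>N'\<^esub> g (c i)"
        using assms(4) sx[OF i] c[OF i] by (auto simp: lmod_hom_def)
      also have "\<dots> = f (s x i \<odot>\<^bsub>P\<^esub> i)"
        using assms(5) sx[OF i] c[OF i] i by (auto simp: lmod_hom_def)
      finally show "g (s x i \<odot>\<^bsub>N\<^esub> c i) = f (s x i \<odot>\<^bsub>P\<^esub> i)" .
    qed simp
    also have "\<dots> = f (?p (s x))"
      unfolding free_lmod_map_def
      by (rule lmod_hom_finsum[OF P assms(3,5) A, symmetric]) (use sx in auto)
    also have "\<dots> = f x" using s(2)[OF x] by simp
    finally show ?thesis .
  qed
  ultimately show ?thesis by (intro bexI[of _ "\<lambda>x. ?q (s x)"] ballI)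
qed

end

theory Submission
  imports Defs
begin

text \<open>Write \<open>S = R[[x;\<sigma>,\<delta>]]\<close> and \<open>J\<close> for the Jacobson radical of \<open>R\<close>. Every finitely generated
projective \<open>S\<close>-module turns out to be extended from \<open>R\<close>, so that stable freeness passes from \<open>R\<close> to \<open>S\<close>
by extension of scalars.

The ring \<open>R\<close> is complete for the filtration \<open>J\<^sup>k\<close>, and \<open>\<delta>(R) \<subseteq> J\<close> with \<open>\<delta>(J) \<subseteq> J\<^sup>2\<close> gives
\<open>\<delta>(J\<^sup>k) \<subseteq> J\<^sup>k\<^sup>+\<^sup>1\<close>. Hence left multiplication by \<open>x\<close>, which is \<open>b \<mapsto> x b = \<Sum> (\<sigma>(b\<^sub>m\<^sub>-\<^sub>1) + \<delta>(b\<^sub>m)) x\<^sup>m\<close>,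
maps each term of the filtration of \<open>S\<close> by the sets \<open>{b. \<forall>m. b\<^sub>m \<in> J\<^sup>k\<^sup>-\<^sup>m}\<close> into the next one; here
\<open>J\<^sup>i = R\<close> for \<open>i \<le> 0\<close>, and \<open>x\<close> has degree one. Modulo the \<open>N\<close>-th term the
product \<open>a b\<close> is the finite sum of the \<open>a\<^sub>j x\<^sup>j b\<close> with \<open>j < N\<close> (\<open>mult_approx\<close>). Identities in \<open>S\<close> therefore become identities between finite sums modulo
each term of the filtration, and associativity reduces to \<open>x (a b) = (x a) b\<close> (\<open>x_mult_mult\<close>).
So \<open>S\<close> is a ring, again complete for its filtration (\<open>S_complete_filtered\<close>), and its quotient by the
first term of the filtration is \<open>R/J\<close>. The same holds for matrix rings, filtered entrywise.

A finitely generated projective \<open>S\<close>-module \<open>P\<close> is the row space \<open>S\<^sup>n e\<close> of an idempotent matrix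
\<open>e\<close>. The constant coefficients of \<open>e\<close> form a matrix over \<open>R\<close> that is idempotent modulo \<open>J\<close>, and
completeness of the matrix ring over \<open>R\<close> lifts it to an idempotent \<open>f\<close> over \<open>R\<close>
(\<open>idempotent_lift\<close>). Over \<open>S\<close> the idempotents \<open>e\<close> and \<open>f\<close> agree modulo the first term of the
filtration, and in a complete filtered ring this makes them conjugate
(\<open>idempotents_conjugate\<close>), so that \<open>S\<^sup>n e \<cong> S\<^sup>n f\<close>. The row space \<open>R\<^sup>n f\<close> is projective, hence
stably free. An isomorphism \<open>R\<^sup>r \<cong> R\<^sup>s \<oplus> R\<^sup>n f\<close> amounts to four matrices over \<open>R\<close>
subject to polynomial identities (\<open>stably_free_mat\<close>). Such identities survive the ring homomorphism
\<open>R \<rightarrow> S\<close> and conjugation, and over \<open>S\<close> they give an isomorphism \<open>S\<^sup>r \<cong> S\<^sup>s \<oplus> P\<close>.\<close>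

section \<open>Finite sums in abelian groups and rings\<close>

lemma (in abelian_monoid) finsum_swap:
  assumes "finite A" "finite B" "\<And>i j. \<lbrakk> i \<in> A; j \<in> B \<rbrakk> \<Longrightarrow> f i j \<in> carrier G"
  shows "(\<Oplus>i\<in>A. \<Oplus>j\<in>B. f i j) = (\<Oplus>j\<in>B. \<Oplus>i\<in>A. f i j)"
  using assms(1,3)
proof (induction A rule: finite_induct)
  case (insert a A)
  have "(\<Oplus>i\<in>insert a A. \<Oplus>j\<in>B. f i j) = (\<Oplus>j\<in>B. f a j) \<oplus> (\<Oplus>i\<in>A. \<Oplus>j\<in>B. f i j)"
    using insert by (intro finsum_insert) (auto intro!: finsum_closed)
  also have "\<dots> = (\<Oplus>j\<in>B. f a j) \<oplus> (\<Oplus>j\<in>B. \<Oplus>i\<in>A. f i j)" using insert by simp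
  also have "\<dots> = (\<Oplus>j\<in>B. f a j \<oplus> (\<Oplus>i\<in>A. f i j))"
    using insert by (intro finsum_addf[symmetric]) (auto intro!: finsum_closed)
  also have "\<dots> = (\<Oplus>j\<in>B. \<Oplus>i\<in>insert a A. f i j)"
    using insert by (intro finsum_cong' refl finsum_insert[symmetric]) (auto intro!: finsum_closed)
  finally show ?case .
qed simp

lemma (in abelian_monoid) finsum_delta:
  assumes "finite I" "i \<in> I" "f i \<in> carrier G" "\<And>j. \<lbrakk> j \<in> I; j \<noteq> i \<rbrakk> \<Longrightarrow> f j = \<zero>"
  shows "(\<Oplus>j\<in>I. f j) = f i"
proof -
  have "(\<Oplus>j\<in>I. f j) = (\<Oplus>j\<in>{i}. f j)"
  proof (rule add.finprod_mono_neutral_cong_right)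
    show "f \<in> I \<rightarrow> carrier G"
    proof
      fix j assume "j \<in> I"
      then show "f j \<in> carrier G" using assms(3) assms(4)[of j] by (cases "j = i") auto
    qed
  qed (use assms in auto)
  then show ?thesis using assms by simp
qed

lemma (in abelian_monoid) finsum_lessThan_Suc:
  assumes "\<And>i. i \<le> n \<Longrightarrow> f i \<in> carrier G"
  shows "(\<Oplus>i\<in>{..<Suc n}. f i) = f n \<oplus> (\<Oplus>i\<in>{..<n}. f i)"
  unfolding lessThan_Suc using assms by (intro finsum_insert) auto

lemma (in abelian_monoid) finsum_addI:
  assumes "\<And>i. i \<in> I \<Longrightarrow> f i \<in> carrier G" "\<And>i. i \<in> I \<Longrightarrow> g i \<in> carrier G"
    "\<And>i. i \<in> I \<Longrightarrow> h i = f i \<oplus> g i"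
  shows "(\<Oplus>i\<in>I. h i) = (\<Oplus>i\<in>I. f i) \<oplus> (\<Oplus>i\<in>I. g i)"
proof -
  have "(\<Oplus>i\<in>I. h i) = (\<Oplus>i\<in>I. f i \<oplus> g i)"
    by (rule finsum_cong') (use assms in auto)
  also have "\<dots> = (\<Oplus>i\<in>I. f i) \<oplus> (\<Oplus>i\<in>I. g i)"
    by (rule finsum_addf) (use assms in auto)
  finally show ?thesis .
qed

lemma (in abelian_group) additive_finsum:
  assumes "finite I" "\<And>i. i \<in> I \<Longrightarrow> f i \<in> carrier G"
    and "\<And>a. a \<in> carrier G \<Longrightarrow> \<phi> a \<in> carrier G"
    and add: "\<And>a b. \<lbrakk> a \<in> carrier G; b \<in> carrier G \<rbrakk> \<Longrightarrow> \<phi> (a \<oplus> b) = \<phi> a \<oplus> \<phi> b"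
  shows "\<phi> (\<Oplus>i\<in>I. f i) = (\<Oplus>i\<in>I. \<phi> (f i))"
  using assms(1,2)
proof (induction I rule: finite_induct)
  case empty
  have "\<phi> \<zero> = \<zero>" using add[of \<zero> \<zero>] assms(3)[of \<zero>] by simp
  then show ?case by simp
next
  case (insert i I)
  then have "f \<in> I \<rightarrow> carrier G" "f i \<in> carrier G" "(\<lambda>i. \<phi> (f i)) \<in> I \<rightarrow> carrier G"
    using assms(3) by auto
  then show ?case using insert add assms(3) by (simp add: finsum_insert)
qed

lemma (in semiring) finsum_assoc:
  assumes [simp]: "\<And>l. a l \<in> carrier R" "\<And>l k. b l k \<in> carrier R" "\<And>k. c k \<in> carrier R"
  shows "(\<Oplus>k\<in>{..<q::nat}. (\<Oplus>l\<in>{..<p::nat}. a l \<otimes> b l k) \<otimes> c k) =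
    (\<Oplus>l\<in>{..<p}. a l \<otimes> (\<Oplus>k\<in>{..<q}. b l k \<otimes> c k))"
proof -
  have "(\<Oplus>k\<in>{..<q}. (\<Oplus>l\<in>{..<p}. a l \<otimes> b l k) \<otimes> c k) =
      (\<Oplus>k\<in>{..<q}. \<Oplus>l\<in>{..<p}. a l \<otimes> (b l k \<otimes> c k))"
    by (intro finsum_cong') (auto simp: finsum_ldistr m_assoc intro!: finsum_cong')
  also have "\<dots> = (\<Oplus>l\<in>{..<p}. \<Oplus>k\<in>{..<q}. a l \<otimes> (b l k \<otimes> c k))"
    by (rule finsum_swap) auto
  also have "\<dots> = (\<Oplus>l\<in>{..<p}. a l \<otimes> (\<Oplus>k\<in>{..<q}. b l k \<otimes> c k))"
    by (intro finsum_cong') (auto simp: finsum_rdistr intro!: finsum_cong')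
  finally show ?thesis .
qed

section \<open>Complete filtered rings\<close>

text \<open>Completeness is stated for sequences whose \<open>k\<close>-th increment lies in the \<open>k\<close>-th term of the
filtration. This is the form in which the inverse limit of the quotients presents them, and the
limit then approximates the \<open>k\<close>-th member modulo the \<open>k\<close>-th term.\<close>

locale complete_filtered_ring = ring A for A (structure) +
  fixes F :: "nat \<Rightarrow> 'a set"
  assumes F_0: "F 0 = carrier A"
    and F_zero: "\<zero> \<in> F k"
    and F_diff: "\<lbrakk> a \<in> F k; b \<in> F k \<rbrakk> \<Longrightarrow> a \<ominus> b \<in> F k"
    and F_Suc: "F (Suc k) \<subseteq> F k"
    and F_mult: "\<lbrakk> a \<in> F i; b \<in> F j \<rbrakk> \<Longrightarrow> a \<otimes> b \<in> F (i + j)"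
    and F_separated: "(\<And>k. a \<in> F k) \<Longrightarrow> a = \<zero>"
    and F_complete: "\<lbrakk> \<And>k. f k \<in> carrier A; \<And>k. f (Suc k) \<ominus> f k \<in> F k \<rbrakk> \<Longrightarrow>
      \<exists>s\<in>carrier A. \<forall>k. s \<ominus> f k \<in> F k"
begin

lemma F_antimono: "i \<le> j \<Longrightarrow> F j \<subseteq> F i"
  using F_Suc by (rule lift_Suc_antimono_le)

lemma F_weaken: "\<lbrakk> a \<in> F j; i \<le> j \<rbrakk> \<Longrightarrow> a \<in> F i"
  using F_antimono by blast

lemma F_carrier: "a \<in> F k \<Longrightarrow> a \<in> carrier A"
  using F_antimono[of 0 k] F_0 by auto

lemma F_uminus: "a \<in> F k \<Longrightarrow> \<ominus> a \<in> F k"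
  using F_diff[OF F_zero, of a k] F_carrier[of a k] by (simp add: minus_eq)

lemma F_add: "\<lbrakk> a \<in> F k; b \<in> F k \<rbrakk> \<Longrightarrow> a \<oplus> b \<in> F k"
  using F_diff[OF _ F_uminus, of a k b] F_carrier[of a k] F_carrier[of b k] by (simp add: minus_eq)

lemma F_mult_left: "\<lbrakk> a \<in> carrier A; b \<in> F k \<rbrakk> \<Longrightarrow> a \<otimes> b \<in> F k"
  using F_mult[of a 0 b k] F_0 by simp

lemma F_mult_right: "\<lbrakk> a \<in> F k; b \<in> carrier A \<rbrakk> \<Longrightarrow> a \<otimes> b \<in> F k"
  using F_mult[of a k b 0] F_0 by simp

lemma F_finsum: "\<lbrakk> finite I; \<And>i. i \<in> I \<Longrightarrow> f i \<in> F k \<rbrakk> \<Longrightarrow> (\<Oplus>i\<in>I. f i) \<in> F k"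
proof (induction I rule: finite_induct)
  case (insert i I)
  then have "f \<in> I \<rightarrow> carrier A" "f i \<in> carrier A" by (auto intro: F_carrier)
  then show ?case using insert by (simp add: F_add)
qed (simp add: F_zero)

lemma diff_trans: "\<lbrakk> a \<in> carrier A; b \<in> carrier A; c \<in> carrier A \<rbrakk> \<Longrightarrow> a \<ominus> c = (a \<ominus> b) \<oplus> (b \<ominus> c)"
  by (simp add: minus_eq a_ac r_neg2 r_neg1)

lemma F_diff_self: "a \<in> carrier A \<Longrightarrow> a \<ominus> a \<in> F k"
  by (simp add: minus_eq r_neg F_zero)

lemma F_diff_trans:
  assumes "a \<ominus> b \<in> F k" "b \<ominus> c \<in> F k" "a \<in> carrier A" "b \<in> carrier A" "c \<in> carrier A"
  shows "a \<ominus> c \<in> F k"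
  using F_add[OF assms(1,2)] diff_trans[OF assms(3-5)] by simp

lemma F_diff_sym: "\<lbrakk> a \<ominus> b \<in> F k; a \<in> carrier A; b \<in> carrier A \<rbrakk> \<Longrightarrow> b \<ominus> a \<in> F k"
  using F_uminus[of "a \<ominus> b" k] by (simp add: minus_eq minus_add a_comm)

lemma F_eqI: "\<lbrakk> a \<in> carrier A; b \<in> carrier A; \<And>k. a \<ominus> b \<in> F k \<rbrakk> \<Longrightarrow> a = b"
  using F_separated[of "a \<ominus> b"] by simp

lemma F_mult_diff:
  assumes "a \<ominus> a' \<in> F k" "b \<ominus> b' \<in> F k"
    and [simp]: "a \<in> carrier A" "b \<in> carrier A" "a' \<in> carrier A" "b' \<in> carrier A"
  shows "(a \<otimes> b) \<ominus> (a' \<otimes> b') \<in> F k"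
proof -
  have "(a \<otimes> b) \<ominus> (a' \<otimes> b) = (a \<ominus> a') \<otimes> b" "(a' \<otimes> b) \<ominus> (a' \<otimes> b') = a' \<otimes> (b \<ominus> b')"
    by (simp_all add: minus_eq l_distr r_distr l_minus r_minus)
  then have "a \<otimes> b \<ominus> a' \<otimes> b \<in> F k" "a' \<otimes> b \<ominus> a' \<otimes> b' \<in> F k"
    using F_mult_right[OF assms(1), of b] F_mult_left[OF _ assms(2), of a'] by simp_all
  then show ?thesis by (rule F_diff_trans) simp_all
qed

lemma F_add_diff:
  assumes "a \<ominus> a' \<in> F k" "b \<ominus> b' \<in> F k"
    and [simp]: "a \<in> carrier A" "b \<in> carrier A" "a' \<in> carrier A" "b' \<in> carrier A"
  shows "(a \<oplus> b) \<ominus> (a' \<oplus> b') \<in> F k"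
proof -
  have "(a \<oplus> b) \<ominus> (a' \<oplus> b') = (a \<ominus> a') \<oplus> (b \<ominus> b')"
    by (simp add: minus_eq minus_add a_ac)
  then show ?thesis using F_add[OF assms(1,2)] by simp
qed

lemma F_finsum_diff:
  assumes "finite I" "\<And>i. i \<in> I \<Longrightarrow> f i \<ominus> g i \<in> F k"
    "\<And>i. i \<in> I \<Longrightarrow> f i \<in> carrier A" "\<And>i. i \<in> I \<Longrightarrow> g i \<in> carrier A"
  shows "(\<Oplus>i\<in>I. f i) \<ominus> (\<Oplus>i\<in>I. g i) \<in> F k"
  using assms
proof (induction I rule: finite_induct)
  case (insert i I)
  then have "f \<in> I \<rightarrow> carrier A" "g \<in> I \<rightarrow> carrier A" by auto
  then show ?case using insert F_add_diff[of "f i" "g i" k "finsum A f I" "finsum A g I"]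
    by (simp add: finsum_insert)
qed (simp add: F_diff_self)

text \<open>The geometric series converges to the inverse.\<close>

lemma one_minus_unit:
  assumes a: "a \<in> F 1"
  shows "\<one> \<ominus> a \<in> Units A"
proof -
  have aA [simp]: "a \<in> carrier A" using F_carrier a by blast
  have pow: "a [^] k \<in> F k" for k :: nat
    using F_mult[OF _ a, of "a [^] k" k for k] by (induction k) (simp_all add: F_0)
  define s where "s = (\<lambda>k::nat. \<Oplus>i\<in>{..<k}. a [^] i)"
  have sA [simp]: "s k \<in> carrier A" for k unfolding s_def by (simp add: Pi_def)
  have s_Suc: "s (Suc k) = a [^] k \<oplus> s k" for k
    unfolding s_def lessThan_Suc by (subst finsum_insert) (simp_all add: Pi_def)
  have s_0: "s 0 = \<zero>" by (simp add: s_def)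
  have comm: "a \<otimes> a [^] k = a [^] k \<otimes> a" for k :: nat
    using nat_pow_comm[of a 1 k] by simp
  have left: "(\<one> \<ominus> a) \<otimes> s k = \<one> \<ominus> a [^] k" for k
  proof (induction k)
    case (Suc k)
    have "(\<one> \<ominus> a) \<otimes> s (Suc k) = (\<one> \<ominus> a) \<otimes> a [^] k \<oplus> (\<one> \<ominus> a [^] k)"
      unfolding s_Suc Suc.IH[symmetric] by (simp add: r_distr)
    then show ?case
      by (simp add: minus_eq l_distr l_minus comm a_ac r_neg2 r_neg1)
  qed (simp add: s_0 minus_eq r_neg)
  have right: "s k \<otimes> (\<one> \<ominus> a) = \<one> \<ominus> a [^] k" for k
  proof (induction k)
    case (Suc k)
    have "s (Suc k) \<otimes> (\<one> \<ominus> a) = a [^] k \<otimes> (\<one> \<ominus> a) \<oplus> (\<one> \<ominus> a [^] k)"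
      unfolding s_Suc Suc.IH[symmetric] by (simp add: l_distr)
    then show ?case
      by (simp add: minus_eq r_distr r_minus a_ac r_neg2 r_neg1)
  qed (simp add: s_0 minus_eq r_neg)
  have "s (Suc k) \<ominus> s k \<in> F k" for k
    using pow[of k] by (simp add: s_Suc minus_eq a_assoc r_neg)
  then obtain t where t [simp]: "t \<in> carrier A" and ts: "\<And>k. t \<ominus> s k \<in> F k"
    using F_complete[of s] by auto
  have pow': "(\<one> \<ominus> a [^] k) \<ominus> \<one> \<in> F k" for k :: nat
    using F_uminus[OF pow[of k]] by (simp add: minus_eq a_ac r_neg2 r_neg1)
  have "(\<one> \<ominus> a) \<otimes> t \<ominus> \<one> \<in> F k" for k
  proof (rule F_diff_trans[of _ "(\<one> \<ominus> a) \<otimes> s k"])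
    show "(\<one> \<ominus> a) \<otimes> t \<ominus> (\<one> \<ominus> a) \<otimes> s k \<in> F k"
      using ts[of k] by (intro F_mult_diff) (simp_all add: F_diff_self)
  qed (simp_all add: left pow')
  then have l: "(\<one> \<ominus> a) \<otimes> t = \<one>" by (intro F_eqI) simp_all
  have "t \<otimes> (\<one> \<ominus> a) \<ominus> \<one> \<in> F k" for k
  proof (rule F_diff_trans[of _ "s k \<otimes> (\<one> \<ominus> a)"])
    show "t \<otimes> (\<one> \<ominus> a) \<ominus> s k \<otimes> (\<one> \<ominus> a) \<in> F k"
      using ts[of k] by (intro F_mult_diff) (simp_all add: F_diff_self)
  qed (simp_all add: right pow')
  then have r: "t \<otimes> (\<one> \<ominus> a) = \<one>" by (intro F_eqI) simp_all
  have "\<one> \<ominus> a \<in> carrier A" by simp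
  with t l r show ?thesis unfolding Units_def by blast
qed

text \<open>The element \<open>u = e f + (1 - e)(1 - f)\<close> intertwines \<open>e\<close> and \<open>f\<close>. If \<open>e = f\<close> it would be \<open>1\<close>, so in
general it is \<open>1\<close> modulo the first term of the filtration, hence a unit.\<close>

lemma idempotents_conjugate:
  assumes e [simp]: "e \<in> carrier A" and f [simp]: "f \<in> carrier A"
    and ee: "e \<otimes> e = e" and ff: "f \<otimes> f = f" and ef: "e \<ominus> f \<in> F 1"
  shows "\<exists>u\<in>Units A. e \<otimes> u = u \<otimes> f"
proof
  \<comment> \<open>For idempotents this is \<open>a = 1 - u\<close> with \<open>u = e f + (1 - e)(1 - f)\<close>, in a form that shows its degree.\<close>
  define a where "a = e \<otimes> (e \<ominus> f) \<oplus> (f \<ominus> e) \<otimes> f"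
  have "a \<in> F 1" unfolding a_def
    using F_mult_left[OF e ef] F_mult_right[OF F_diff_sym[OF ef e f] f] by (rule F_add)
  then show "\<one> \<ominus> a \<in> Units A" by (rule one_minus_unit)
  have eex: "e \<otimes> (e \<otimes> x) = e \<otimes> x" if "x \<in> carrier A" for x
    using that ee by (simp add: m_assoc[symmetric])
  have a: "a = (e \<oplus> f) \<ominus> (e \<otimes> f \<oplus> e \<otimes> f)"
    unfolding a_def
    by (simp add: minus_eq l_distr r_distr l_minus r_minus ee ff minus_add a_ac)
  have "e \<otimes> (\<one> \<ominus> a) = e \<otimes> f"
    unfolding a
    by (simp add: minus_eq l_distr r_distr l_minus r_minus ee ff eex minus_add a_ac r_neg2 r_neg1 r_neg)
  moreover have "(\<one> \<ominus> a) \<otimes> f = e \<otimes> f"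
    unfolding a
    by (simp add: minus_eq l_distr r_distr l_minus r_minus ee ff m_assoc minus_add a_ac r_neg2 r_neg1 r_neg)
  ultimately show "e \<otimes> (\<one> \<ominus> a) = (\<one> \<ominus> a) \<otimes> f" by simp
qed

text \<open>One Newton step for the equation \<open>e\<^sup>2 = e\<close>: with the defect \<open>d = e\<^sup>2 - e\<close>, the element
\<open>e + (1 - 2 e) d\<close>, which is \<open>3 e\<^sup>2 - 2 e\<^sup>3\<close>, has a defect of order two in \<open>d\<close>. Everything in sight
commutes with \<open>e\<close>, so the commutative computation applies.\<close>

lemma newton_step:
  assumes e [simp]: "e \<in> carrier A" and d: "e \<otimes> e \<ominus> e \<in> F (Suc k)"
  shows "\<exists>e'\<in>carrier A. e' \<otimes> e' \<ominus> e' \<in> F (Suc (Suc k)) \<and> e' \<ominus> e \<in> F (Suc k)"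
proof
  define d where "d = e \<otimes> e \<ominus> e"
  define t where "t = \<one> \<ominus> (e \<oplus> e)"
  define c where "c = t \<otimes> d"
  have dF: "d \<in> F (Suc k)" using d by (simp add: d_def)
  have [simp]: "d \<in> carrier A" "t \<in> carrier A" "c \<in> carrier A"
    by (simp_all add: d_def t_def c_def)
  have cF: "c \<in> F (Suc k)" unfolding c_def by (intro F_mult_left dF) simp
  have ed: "e \<otimes> d = d \<otimes> e"
    by (simp add: d_def minus_eq l_distr r_distr l_minus r_minus m_assoc)
  have et: "e \<otimes> t = t \<otimes> e"
    by (simp add: t_def minus_eq l_distr r_distr l_minus r_minus m_assoc)
  have ec: "e \<otimes> c = c \<otimes> e"
  proof -
    have "e \<otimes> c = (e \<otimes> t) \<otimes> d" by (simp add: c_def m_assoc)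
    also have "\<dots> = t \<otimes> (e \<otimes> d)" by (simp add: et m_assoc)
    also have "\<dots> = c \<otimes> e" by (simp add: ed c_def m_assoc)
    finally show ?thesis .
  qed
  have tt: "t \<otimes> t = \<one> \<oplus> ((d \<oplus> d) \<oplus> (d \<oplus> d))"
    by (simp add: t_def d_def minus_eq l_distr r_distr l_minus r_minus minus_add a_ac
        r_neg2 r_neg1 r_neg)
  have ee: "e \<otimes> e = e \<oplus> d"
    by (simp add: d_def minus_eq a_ac r_neg2 r_neg1 r_neg)
  have tc: "t \<otimes> c = c \<ominus> (e \<otimes> c \<oplus> e \<otimes> c)"
    by (simp add: t_def minus_eq l_distr l_minus)
  have tc': "t \<otimes> c = d \<oplus> ((d \<otimes> d \<oplus> d \<otimes> d) \<oplus> (d \<otimes> d \<oplus> d \<otimes> d))"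
    by (simp add: c_def m_assoc[symmetric] tt l_distr)
  have cancel: "x \<oplus> (y \<oplus> (\<ominus> x \<oplus> z)) = y \<oplus> z"
    if "x \<in> carrier A" "y \<in> carrier A" "z \<in> carrier A" for x y z
    using that a_lcomm[of y "\<ominus> x" z] by (simp add: r_neg2)
  have "(e \<oplus> c) \<otimes> (e \<oplus> c) \<ominus> (e \<oplus> c) = (d \<oplus> c \<otimes> c) \<ominus> t \<otimes> c"
    by (simp add: cancel tc minus_eq l_distr r_distr ec[symmetric] ee minus_add a_ac r_neg2 r_neg1 r_neg)
  also have "\<dots> = c \<otimes> c \<ominus> ((d \<otimes> d \<oplus> d \<otimes> d) \<oplus> (d \<otimes> d \<oplus> d \<otimes> d))"
    unfolding tc' by (simp add: minus_eq minus_add a_ac r_neg2 r_neg1 r_neg)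
  also have "\<dots> \<in> F (Suc k + Suc k)"
    by (intro F_diff F_add F_mult cF dF)
  also have "\<dots> \<subseteq> F (Suc (Suc k))" by (rule F_antimono) simp
  finally have "(e \<oplus> c) \<otimes> (e \<oplus> c) \<ominus> (e \<oplus> c) \<in> F (Suc (Suc k))" .
  moreover have "(e \<oplus> c) \<ominus> e \<in> F (Suc k)"
    using cF by (simp add: minus_eq a_ac r_neg2 r_neg1 r_neg)
  ultimately show "(e \<oplus> c) \<otimes> (e \<oplus> c) \<ominus> (e \<oplus> c) \<in> F (Suc (Suc k)) \<and> (e \<oplus> c) \<ominus> e \<in> F (Suc k)" ..
qed simp

lemma idempotent_lift:
  assumes e [simp]: "e \<in> carrier A" and d: "e \<otimes> e \<ominus> e \<in> F 1"
  shows "\<exists>f\<in>carrier A. f \<otimes> f = f \<and> f \<ominus> e \<in> F 1"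
proof -
  have "\<exists>g. \<forall>k. (g k \<in> carrier A \<and> g k \<otimes> g k \<ominus> g k \<in> F (Suc k) \<and> (k = 0 \<longrightarrow> g k = e)) \<and>
      g (Suc k) \<ominus> g k \<in> F (Suc k)"
    by (rule dependent_nat_choice) (use newton_step d in auto)
  then obtain g where g: "\<And>k. (g k \<in> carrier A \<and> g k \<otimes> g k \<ominus> g k \<in> F (Suc k) \<and>
      (k = 0 \<longrightarrow> g k = e)) \<and> g (Suc k) \<ominus> g k \<in> F (Suc k)"
    by blast
  have gA [simp]: "\<And>k. g k \<in> carrier A" and gg: "\<And>k. g k \<otimes> g k \<ominus> g k \<in> F (Suc k)"
    and g_Suc: "\<And>k. g (Suc k) \<ominus> g k \<in> F (Suc k)"
    using g by blast+
  have g_0: "g 0 = e" using g[of 0] by blast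
  obtain f where f [simp]: "f \<in> carrier A" and fg: "\<And>k. f \<ominus> g k \<in> F k"
    using F_complete[OF gA subsetD[OF F_Suc g_Suc]] by blast
  have "f \<otimes> f \<ominus> f \<in> F k" for k
  proof (rule F_diff_trans[of _ "g k \<otimes> g k"])
    show "f \<otimes> f \<ominus> g k \<otimes> g k \<in> F k" by (intro F_mult_diff fg) simp_all
    show "g k \<otimes> g k \<ominus> f \<in> F k"
    proof (rule F_diff_trans[of _ "g k"])
      show "g k \<otimes> g k \<ominus> g k \<in> F k" using gg F_Suc by blast
      show "g k \<ominus> f \<in> F k" by (rule F_diff_sym[OF fg]) simp_all
    qed simp_all
  qed simp_all
  then have "f \<otimes> f = f" by (intro F_eqI) simp_all
  moreover have "f \<ominus> e \<in> F 1"
    using F_diff_trans[OF fg[of 1], of e] g_Suc[of 0] by (simp add: g_0)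
  ultimately show ?thesis by auto
qed

end

section \<open>The Jacobson radical and its powers\<close>

text \<open>Closure under negation is a special case of closure under left multiplication by \<open>-1\<close>.\<close>

lemma (in ring) left_idealI:
  assumes "I \<subseteq> carrier R" "\<zero> \<in> I" "\<And>a b. \<lbrakk> a \<in> I; b \<in> I \<rbrakk> \<Longrightarrow> a \<oplus> b \<in> I"
    and l: "\<And>r a. \<lbrakk> r \<in> carrier R; a \<in> I \<rbrakk> \<Longrightarrow> r \<otimes> a \<in> I"
  shows "left_ideal I R"
proof (intro left_ideal.intro additive_subgroup.intro left_ideal_axioms.intro ring_axioms)
  have "\<ominus> a \<in> I" if "a \<in> I" for a
    using l[OF a_inv_closed[OF one_closed] that] assms(1) that by (auto simp: l_minus)
  then show "subgroup I (add_monoid R)"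
    using assms(1-3) by (intro add.subgroupI) (auto simp: a_inv_def[symmetric])
qed (rule l)

text \<open>The two-sidedness of the radical. The left ideal \<open>{s. s r \<in> I}\<close> is the annihilator of the class
of \<open>r\<close> in the simple module \<open>R/I\<close>; it is the whole ring or again maximal, and in both cases it
contains \<open>a\<close>.\<close>

lemma maximal_left_ideal_mult_right:
  assumes I: "maximal_left_ideal I R" and a: "a \<in> jacobson_radical R" and r: "r \<in> carrier R"
  shows "a \<otimes>\<^bsub>R\<^esub> r \<in> I"
proof -
  interpret I: left_ideal I R using I by (simp add: maximal_left_ideal_def)
  note I_zero = additive_subgroup.zero_closed[OF I.additive_subgroup_axioms]
    and I_add = additive_subgroup.a_closed[OF I.additive_subgroup_axioms]
  let ?K = "{s \<in> carrier R. s \<otimes>\<^bsub>R\<^esub> r \<in> I}"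
  have K: "left_ideal ?K R"
    by (rule I.left_idealI) (use r I.left_mult_closed in \<open>auto simp: I.l_distr I.m_assoc\<close>)
  have aR: "a \<in> carrier R" using a by (simp add: jacobson_radical_def)
  show ?thesis
  proof (cases "?K = carrier R")
    case True
    then show ?thesis using aR by blast
  next
    case False
    have "L = ?K \<or> L = carrier R" if L: "left_ideal L R" and KL: "?K \<subseteq> L" for L
    proof -
      interpret L: left_ideal L R by (rule L)
      \<comment> \<open>The left ideal \<open>L r + I\<close> is compared with the maximal ideal \<open>I\<close>.\<close>
      let ?M = "{l \<otimes>\<^bsub>R\<^esub> r \<oplus>\<^bsub>R\<^esub> i | l i. l \<in> L \<and> i \<in> I}"
      have MI: "l \<otimes>\<^bsub>R\<^esub> r \<oplus>\<^bsub>R\<^esub> i \<in> ?M" if "l \<in> L" "i \<in> I" for l i using that by blast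
      have M: "left_ideal ?M R"
      proof (rule I.left_idealI)
        show "?M \<subseteq> carrier R" using r by auto
        show "\<zero>\<^bsub>R\<^esub> \<in> ?M" using MI[OF L.zero_closed I_zero] r
          by (simp only: I.l_null I.l_zero I.zero_closed)
      next
        fix x y assume "x \<in> ?M" "y \<in> ?M"
        then obtain l i l' i' where *: "l \<in> L" "i \<in> I" "l' \<in> L" "i' \<in> I"
          and "x = l \<otimes>\<^bsub>R\<^esub> r \<oplus>\<^bsub>R\<^esub> i" "y = l' \<otimes>\<^bsub>R\<^esub> r \<oplus>\<^bsub>R\<^esub> i'" by blast
        then have "x \<oplus>\<^bsub>R\<^esub> y = (l \<oplus>\<^bsub>R\<^esub> l') \<otimes>\<^bsub>R\<^esub> r \<oplus>\<^bsub>R\<^esub> (i \<oplus>\<^bsub>R\<^esub> i')"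
          using r by (simp add: I.l_distr I.a_ac)
        then show "x \<oplus>\<^bsub>R\<^esub> y \<in> ?M"
          using MI[OF L.a_closed[OF *(1,3)] I_add[OF *(2,4)]] by (simp only:)
      next
        fix s x assume s: "s \<in> carrier R" and "x \<in> ?M"
        then obtain l i where *: "l \<in> L" "i \<in> I" and "x = l \<otimes>\<^bsub>R\<^esub> r \<oplus>\<^bsub>R\<^esub> i" by blast
        then have "s \<otimes>\<^bsub>R\<^esub> x = (s \<otimes>\<^bsub>R\<^esub> l) \<otimes>\<^bsub>R\<^esub> r \<oplus>\<^bsub>R\<^esub> (s \<otimes>\<^bsub>R\<^esub> i)"
          using r s by (simp add: I.r_distr I.m_assoc)
        then show "s \<otimes>\<^bsub>R\<^esub> x \<in> ?M"
          using MI[OF L.left_mult_closed[OF s *(1)] I.left_mult_closed[OF s *(2)]] by (simp only:)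
      qed
      have "I \<subseteq> ?M"
      proof
        fix i assume i: "i \<in> I"
        then have "i = \<zero>\<^bsub>R\<^esub> \<otimes>\<^bsub>R\<^esub> r \<oplus>\<^bsub>R\<^esub> i" using r by simp
        then show "i \<in> ?M" using MI[OF L.zero_closed i] by (simp only:)
      qed
      then have "?M = I \<or> ?M = carrier R"
        using I M unfolding maximal_left_ideal_def by blast
      then show ?thesis
      proof
        assume M: "?M = I"
        have "L \<subseteq> ?K"
        proof
          fix l assume l: "l \<in> L"
          then have "l \<otimes>\<^bsub>R\<^esub> r \<oplus>\<^bsub>R\<^esub> \<zero>\<^bsub>R\<^esub> \<in> I" using MI[OF l I_zero] by (simp only: M)
          then show "l \<in> ?K" using l r by simp
        qed
        with KL show ?thesis by blast
      next
        assume "?M = carrier R"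
        then obtain l i where l: "l \<in> L" and i: "i \<in> I" and eq: "r = l \<otimes>\<^bsub>R\<^esub> r \<oplus>\<^bsub>R\<^esub> i"
          using r by blast
        have [simp]: "l \<in> carrier R" "i \<in> carrier R" using l i by auto
        have "(\<one>\<^bsub>R\<^esub> \<ominus>\<^bsub>R\<^esub> l) \<otimes>\<^bsub>R\<^esub> r = r \<ominus>\<^bsub>R\<^esub> l \<otimes>\<^bsub>R\<^esub> r"
          using r by (simp add: I.minus_eq I.l_distr I.l_minus)
        also have "\<dots> = (l \<otimes>\<^bsub>R\<^esub> r \<oplus>\<^bsub>R\<^esub> i) \<ominus>\<^bsub>R\<^esub> l \<otimes>\<^bsub>R\<^esub> r"
          using eq by simp
        also have "\<dots> = i" using r by (simp add: I.minus_eq I.a_ac I.r_neg1 I.r_neg2 I.r_neg)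
        finally have "\<one>\<^bsub>R\<^esub> \<ominus>\<^bsub>R\<^esub> l \<in> ?K" using i by simp
        then have "(\<one>\<^bsub>R\<^esub> \<ominus>\<^bsub>R\<^esub> l) \<oplus>\<^bsub>R\<^esub> l \<in> L" using KL l by blast
        then have one: "\<one>\<^bsub>R\<^esub> \<in> L"
          by (simp add: I.minus_eq I.a_assoc I.l_neg)
        have "s \<in> L" if "s \<in> carrier R" for s
          using L.left_mult_closed[OF that one] that by simp
        then show ?thesis using L.a_subset by blast
      qed
    qed
    then have "maximal_left_ideal ?K R"
      using K False unfolding maximal_left_ideal_def by blast
    then show ?thesis using a unfolding jacobson_radical_def by blast
  qed
qed

lemma (in ring) jacobson_radical_ideal: "ideal (jacobson_radical R) R"
proof (rule idealI)
  show "ring R" by (rule ring_axioms)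
  let ?J = "jacobson_radical R"
  have li: "left_ideal I R" if "maximal_left_ideal I R" for I
    using that by (simp add: maximal_left_ideal_def)
  have JR: "?J \<subseteq> carrier R" by (auto simp: jacobson_radical_def)
  have J: "left_ideal ?J R"
  proof (rule left_idealI[OF JR])
    show "\<zero> \<in> ?J" using li unfolding jacobson_radical_def
      by (blast intro: additive_subgroup.zero_closed left_ideal.axioms)
  next
    fix a b assume "a \<in> ?J" "b \<in> ?J"
    then show "a \<oplus> b \<in> ?J" using li unfolding jacobson_radical_def
      by (blast intro: a_closed additive_subgroup.a_closed left_ideal.axioms)
  next
    fix r a assume "r \<in> carrier R" "a \<in> ?J"
    then show "r \<otimes> a \<in> ?J" using li unfolding jacobson_radical_def
      by (blast intro: m_closed left_ideal.left_mult_closed)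
  qed
  then show "subgroup ?J (add_monoid R)"
    using additive_subgroup.a_subgroup left_ideal.axioms(1) by blast
  fix a r assume a: "a \<in> ?J" and r: "r \<in> carrier R"
  show "r \<otimes> a \<in> ?J" using left_ideal.left_mult_closed[OF J] a r by blast
  show "a \<otimes> r \<in> ?J"
    using maximal_left_ideal_mult_right[OF _ a r] m_closed[OF subsetD[OF JR a] r]
    unfolding jacobson_radical_def by blast
qed

context ring
begin

lemma ideal_power_ideal:
  assumes "ideal I R"
  shows "ideal (ideal_power R I k) R"
  by (induction k) (simp_all add: oneideal ideal_prod_is_ideal assms)

lemma ideal_power_1:
  assumes "ideal I R"
  shows "ideal_power R I (Suc 0) = I"
proof
  show "ideal_power R I (Suc 0) \<subseteq> I"
    using ideal_prod_inter[OF oneideal assms] by simp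
  show "I \<subseteq> ideal_power R I (Suc 0)"
  proof
    fix a assume a: "a \<in> I"
    have "\<one> \<otimes> a \<in> ideal_prod R (carrier R) I" using a by (intro ideal_prod.prod) auto
    then show "a \<in> ideal_power R I (Suc 0)" using ideal.Icarr[OF assms a] by simp
  qed
qed

lemma ideal_power_mult:
  assumes I: "ideal I R" and a: "a \<in> ideal_power R I i" and b: "b \<in> ideal_power R I j"
  shows "a \<otimes> b \<in> ideal_power R I (i + j)"
  using b
proof (induction j arbitrary: b)
  case 0
  then show ?case using ideal.I_r_closed[OF ideal_power_ideal[OF I] a] by simp
next
  case (Suc j)
  have aR: "a \<in> carrier R" using ideal.Icarr[OF ideal_power_ideal[OF I] a] .
  from Suc.prems have "b \<in> ideal_prod R (ideal_power R I j) I" by simp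
  then have "b \<in> carrier R \<and> a \<otimes> b \<in> ideal_power R I (i + Suc j)"
  proof (induction b rule: ideal_prod.induct)
    case (prod x y)
    then have xy: "x \<in> carrier R" "y \<in> carrier R"
      using ideal.Icarr[OF ideal_power_ideal[OF I]] ideal.Icarr[OF I] by blast+
    have "(a \<otimes> x) \<otimes> y \<in> ideal_prod R (ideal_power R I (i + j)) I"
      using Suc.IH[OF prod(1)] prod(2) by (rule ideal_prod.prod)
    then show ?case using xy aR by (simp add: m_assoc)
  next
    case (sum x y)
    then show ?case using aR
      by (auto simp: r_distr intro: ideal_prod.sum)
  qed
  then show ?case ..
qed

text \<open>A sequence with increments in \<open>I\<^sup>k\<close> defines a point of the inverse limit, so surjectivity of
the map from \<open>R\<close> provides limits and injectivity provides separatedness.\<close>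

lemma ideal_power_complete_filtered:
  assumes I: "ideal I R" and complete: "adically_complete R I"
  shows "complete_filtered_ring R (ideal_power R I)"
proof -
  let ?P = "ideal_power R I" and ?L = "adic_inverse_limit R I"
  have P: "ideal (?P k) R" for k by (rule ideal_power_ideal[OF I])
  have bij: "bij_betw (\<lambda>r k. ?P k +> r) (carrier R) (carrier ?L)"
    using complete by (simp add: adically_complete_def ring_iso_def)
  have zero: "\<zero> \<in> ?P k" for k
    using P by (simp add: additive_subgroup.zero_closed ideal.axioms(1))
  have diff: "a \<ominus> b \<in> ?P k" if "a \<in> ?P k" "b \<in> ?P k" for a b k
    using P that unfolding minus_eq
    by (intro additive_subgroup.a_closed additive_subgroup.a_inv_closed ideal.axioms(1))
  have abs: "abelian_subgroup (?P k) R" for k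
    using P by (intro abelian_subgroupI3 is_abelian_group ideal.axioms(1))
  have coset: "(?P k +> a = ?P k +> b) \<longleftrightarrow> a \<ominus> b \<in> ?P k" if "a \<in> carrier R" "b \<in> carrier R" for a b k
    using quotient_eq_iff_same_a_r_cos[OF P that, of k] by blast
  show ?thesis
  proof (unfold_locales)
    show "?P 0 = carrier R" by simp
    show "?P (Suc k) \<subseteq> ?P k" for k
      using ideal_prod_inter[OF P I, of k] by simp
    show "a \<otimes> b \<in> ?P (i + j)" if "a \<in> ?P i" "b \<in> ?P j" for a b i j
      by (rule ideal_power_mult[OF I that])
    show "a = \<zero>" if a: "\<And>k. a \<in> ?P k" for a
    proof -
      have aR: "a \<in> carrier R" using a[of 0] by simp
      then have "?P k +> a = ?P k +> \<zero>" for k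
        using coset[of a \<zero> k] a[of k] by (simp add: minus_eq)
      then show ?thesis using inj_onD[OF bij_betw_imp_inj_on[OF bij], of a \<zero>] aR by simp
    qed
    fix f assume f: "\<And>k. f k \<in> carrier R" and ff: "\<And>k. f (Suc k) \<ominus> f k \<in> ?P k"
    have "(\<lambda>k. ?P k +> f k) \<in> carrier ?L"
    proof -
      have "?P k +> f k \<in> carrier (R Quot ?P k)" for k
        using f by (auto simp: FactRing_def A_RCOSETS_def')
      moreover have "?P k +> f k = ?P k <+> (?P (Suc k) +> f (Suc k))" for k
      proof -
        have "?P k <+> (?P (Suc k) +> f (Suc k)) = (?P k <+> ?P (Suc k)) +> f (Suc k)"
          using P f by (intro a_setmult_rcos_assoc additive_subgroup.a_subset ideal.axioms(1))
        also have "?P k <+> ?P (Suc k) = ?P k"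
        proof
          show "?P k <+> ?P (Suc k) \<subseteq> ?P k"
            using ideal_prod_inter[OF P I, of k] additive_subgroup.a_closed[OF ideal.axioms(1)[OF P[of k]]]
            by (auto simp: set_add_def')
          show "?P k \<subseteq> ?P k <+> ?P (Suc k)"
          proof
            fix x assume x: "x \<in> ?P k"
            then have "x = x \<oplus> \<zero>" using ideal.Icarr[OF P x] by simp
            then show "x \<in> ?P k <+> ?P (Suc k)"
              unfolding set_add_def' using x zero[of "Suc k"] by blast
          qed
        qed
        also have "?P k +> f (Suc k) = ?P k +> f k" using coset[of "f (Suc k)" "f k" k] f ff by simp
        finally show ?thesis by simp
      qed
      ultimately show ?thesis unfolding adic_inverse_limit_def partial_object.simps by blast
    qed
    then have "(\<lambda>k. ?P k +> f k) \<in> (\<lambda>r k. ?P k +> r) ` carrier R"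
      by (simp only: bij_betw_imp_surj_on[OF bij])
    then obtain s where s: "s \<in> carrier R" "(\<lambda>k. ?P k +> s) = (\<lambda>k. ?P k +> f k)"
      by (elim imageE) simp
    then have "s \<ominus> f k \<in> ?P k" for k
      using coset[of s "f k" k] f[of k] fun_cong[OF s(2), of k] by simp
    then show "\<exists>s\<in>carrier R. \<forall>k. s \<ominus> f k \<in> ?P k" using s(1) by blast
  qed (use zero diff in auto)
qed

end

section \<open>Matrix rings\<close>

text \<open>Matrices of every size share one type: the entries outside the \<open>m \<times> n\<close> block are zero, so
that equality of matrices is equality of functions.\<close>

definition mats :: "('a, 'b) ring_scheme \<Rightarrow> nat \<Rightarrow> nat \<Rightarrow> (nat \<Rightarrow> nat \<Rightarrow> 'a) set" where
  "mats R m n =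
    {A. (\<forall>i j. A i j \<in> carrier R) \<and> (\<forall>i j. i \<ge> m \<or> j \<ge> n \<longrightarrow> A i j = \<zero>\<^bsub>R\<^esub>)}"

definition mat_mult ::
    "('a, 'b) ring_scheme \<Rightarrow> nat \<Rightarrow> (nat \<Rightarrow> nat \<Rightarrow> 'a) \<Rightarrow> (nat \<Rightarrow> nat \<Rightarrow> 'a) \<Rightarrow> nat \<Rightarrow> nat \<Rightarrow> 'a" where
  "mat_mult R k A B = (\<lambda>i j. \<Oplus>\<^bsub>R\<^esub>l\<in>{..<k}. A i l \<otimes>\<^bsub>R\<^esub> B l j)"

definition mat_one :: "('a, 'b) ring_scheme \<Rightarrow> nat \<Rightarrow> nat \<Rightarrow> nat \<Rightarrow> 'a" where
  "mat_one R n = (\<lambda>i j. if i = j \<and> i < n then \<one>\<^bsub>R\<^esub> else \<zero>\<^bsub>R\<^esub>)"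

definition mat_zero :: "('a, 'b) ring_scheme \<Rightarrow> nat \<Rightarrow> nat \<Rightarrow> 'a" where
  "mat_zero R = (\<lambda>i j. \<zero>\<^bsub>R\<^esub>)"

definition mat_add ::
    "('a, 'b) ring_scheme \<Rightarrow> (nat \<Rightarrow> nat \<Rightarrow> 'a) \<Rightarrow> (nat \<Rightarrow> nat \<Rightarrow> 'a) \<Rightarrow> nat \<Rightarrow> nat \<Rightarrow> 'a" where
  "mat_add R A B = (\<lambda>i j. A i j \<oplus>\<^bsub>R\<^esub> B i j)"

definition mat_ring :: "('a, 'b) ring_scheme \<Rightarrow> nat \<Rightarrow> (nat \<Rightarrow> nat \<Rightarrow> 'a) ring" where
  "mat_ring R n =
    \<lparr> carrier = mats R n n, monoid.mult = mat_mult R n, one = mat_one R n,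
      ring.zero = mat_zero R, ring.add = mat_add R \<rparr>"

lemma mat_ring_simps [simp]:
  "carrier (mat_ring R n) = mats R n n" "monoid.mult (mat_ring R n) = mat_mult R n"
  "monoid.one (mat_ring R n) = mat_one R n" "ring.zero (mat_ring R n) = mat_zero R"
  "ring.add (mat_ring R n) = mat_add R"
  by (simp_all add: mat_ring_def)

lemma matsI:
  "\<lbrakk> \<And>i j. A i j \<in> carrier R; \<And>i j. i \<ge> m \<or> j \<ge> n \<Longrightarrow> A i j = \<zero>\<^bsub>R\<^esub> \<rbrakk> \<Longrightarrow> A \<in> mats R m n"
  by (simp add: mats_def)

lemma mats_closed: "A \<in> mats R m n \<Longrightarrow> A i j \<in> carrier R"
  by (simp add: mats_def)

lemma mats_outside: "\<lbrakk> A \<in> mats R m n; i \<ge> m \<or> j \<ge> n \<rbrakk> \<Longrightarrow> A i j = \<zero>\<^bsub>R\<^esub>"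
  by (auto simp: mats_def)

context ring
begin

lemma mat_mult_closed [simp]:
  assumes "A \<in> mats R m k'" "B \<in> mats R k'' n"
  shows "mat_mult R k A B \<in> mats R m n"
proof (rule matsI)
  note [simp] = mats_closed[OF assms(1)] mats_closed[OF assms(2)]
  show "mat_mult R k A B i j \<in> carrier R" for i j
    by (auto simp: mat_mult_def intro!: finsum_closed)
  fix i j assume "i \<ge> m \<or> j \<ge> n"
  then have "A i l \<otimes> B l j = \<zero>" for l
    using mats_outside[OF assms(1), of i l] mats_outside[OF assms(2), of l j] by auto
  then show "mat_mult R k A B i j = \<zero>" by (simp add: mat_mult_def)
qed

lemma mat_one_closed [simp]: "mat_one R n \<in> mats R n n"
  by (rule matsI) (auto simp: mat_one_def)

lemma mat_zero_closed [simp]: "mat_zero R \<in> mats R m n"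
  by (rule matsI) (auto simp: mat_zero_def)

lemma mat_add_closed [simp]: "\<lbrakk> A \<in> mats R m n; B \<in> mats R m n \<rbrakk> \<Longrightarrow> mat_add R A B \<in> mats R m n"
  by (simp add: mats_def mat_add_def)

lemma mat_mult_assoc:
  assumes "A \<in> mats R m p'" "B \<in> mats R p'' q'" "C \<in> mats R q'' n"
  shows "mat_mult R q (mat_mult R p A B) C = mat_mult R p A (mat_mult R q B C)"
  unfolding mat_mult_def
  by (intro ext finsum_assoc mats_closed[OF assms(1)] mats_closed[OF assms(2)] mats_closed[OF assms(3)])

lemma mat_one_left: "A \<in> mats R m n \<Longrightarrow> mat_mult R m (mat_one R m) A = A"
proof (intro ext)
  fix i j assume A: "A \<in> mats R m n"
  note [simp] = mats_closed[OF A]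
  show "mat_mult R m (mat_one R m) A i j = A i j"
  proof (cases "i < m")
    case True
    then have "mat_mult R m (mat_one R m) A i j = mat_one R m i i \<otimes> A i j"
      unfolding mat_mult_def by (intro finsum_delta) (use A in \<open>auto simp: mat_one_def\<close>)
    then show ?thesis using True A by (simp add: mat_one_def)
  next
    case False
    then show ?thesis
      using mats_outside[OF mat_mult_closed[OF mat_one_closed A]] mats_outside[OF A] by auto
  qed
qed

lemma mat_one_right: "A \<in> mats R m n \<Longrightarrow> mat_mult R n A (mat_one R n) = A"
proof (intro ext)
  fix i j assume A: "A \<in> mats R m n"
  note [simp] = mats_closed[OF A]
  show "mat_mult R n A (mat_one R n) i j = A i j"
  proof (cases "j < n")
    case True
    then have "mat_mult R n A (mat_one R n) i j = A i j \<otimes> mat_one R n j j"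
      unfolding mat_mult_def by (intro finsum_delta) (use A in \<open>auto simp: mat_one_def\<close>)
    then show ?thesis using True A by (simp add: mat_one_def)
  next
    case False
    then show ?thesis
      using mats_outside[OF mat_mult_closed[OF A mat_one_closed]] mats_outside[OF A] by auto
  qed
qed

lemma mat_add_mult_left:
  assumes "A \<in> mats R m k'" "B \<in> mats R m k'" "C \<in> mats R k'' n"
  shows "mat_mult R k (mat_add R A B) C = mat_add R (mat_mult R k A C) (mat_mult R k B C)"
proof (intro ext)
  note [simp] = mats_closed[OF assms(1)] mats_closed[OF assms(2)] mats_closed[OF assms(3)]
  show "mat_mult R k (mat_add R A B) C i j = mat_add R (mat_mult R k A C) (mat_mult R k B C) i j" for i j
    unfolding mat_mult_def mat_add_def
    by (subst finsum_addf[symmetric]) (auto simp: l_distr intro!: finsum_cong')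
qed

lemma mat_add_mult_right:
  assumes "A \<in> mats R m k'" "B \<in> mats R k'' n" "C \<in> mats R k'' n"
  shows "mat_mult R k A (mat_add R B C) = mat_add R (mat_mult R k A B) (mat_mult R k A C)"
proof (intro ext)
  note [simp] = mats_closed[OF assms(1)] mats_closed[OF assms(2)] mats_closed[OF assms(3)]
  show "mat_mult R k A (mat_add R B C) i j = mat_add R (mat_mult R k A B) (mat_mult R k A C) i j" for i j
    unfolding mat_mult_def mat_add_def
    by (subst finsum_addf[symmetric]) (auto simp: r_distr intro!: finsum_cong')
qed

lemma mat_ring_ring: "ring (mat_ring R n)"
proof (rule ringI)
  show "abelian_group (mat_ring R n)"
  proof (rule abelian_groupI)
    fix A assume A: "A \<in> carrier (mat_ring R n)"
    then have [simp]: "A i j \<in> carrier R" for i j by (simp add: mats_closed)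
    have "(\<lambda>i j. \<ominus> A i j) \<in> mats R n n"
      using A by (simp add: mats_def)
    moreover have "mat_add R (\<lambda>i j. \<ominus> A i j) A = mat_zero R"
      by (simp add: mat_add_def mat_zero_def l_neg)
    ultimately show "\<exists>B\<in>carrier (mat_ring R n). B \<oplus>\<^bsub>mat_ring R n\<^esub> A = \<zero>\<^bsub>mat_ring R n\<^esub>"
      by auto
  next
    fix A B C
    assume "A \<in> carrier (mat_ring R n)" "B \<in> carrier (mat_ring R n)" "C \<in> carrier (mat_ring R n)"
    then have [simp]: "A i j \<in> carrier R" "B i j \<in> carrier R" "C i j \<in> carrier R" for i j
      by (simp_all add: mats_closed)
    show "A \<oplus>\<^bsub>mat_ring R n\<^esub> B \<oplus>\<^bsub>mat_ring R n\<^esub> C = A \<oplus>\<^bsub>mat_ring R n\<^esub> (B \<oplus>\<^bsub>mat_ring R n\<^esub> C)"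
      by (simp add: mat_add_def a_assoc)
  next
    fix A B assume "A \<in> carrier (mat_ring R n)" "B \<in> carrier (mat_ring R n)"
    then have [simp]: "A i j \<in> carrier R" "B i j \<in> carrier R" for i j by (simp_all add: mats_closed)
    show "A \<oplus>\<^bsub>mat_ring R n\<^esub> B = B \<oplus>\<^bsub>mat_ring R n\<^esub> A"
      by (simp add: mat_add_def a_comm)
  next
    fix A assume "A \<in> carrier (mat_ring R n)"
    then have [simp]: "A i j \<in> carrier R" for i j by (simp add: mats_closed)
    show "\<zero>\<^bsub>mat_ring R n\<^esub> \<oplus>\<^bsub>mat_ring R n\<^esub> A = A"
      by (simp add: mat_add_def mat_zero_def)
  qed simp_all
  show "monoid (mat_ring R n)"
  proof (rule monoidI)
    fix A B C
    assume "A \<in> carrier (mat_ring R n)" "B \<in> carrier (mat_ring R n)" "C \<in> carrier (mat_ring R n)"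
    then show "A \<otimes>\<^bsub>mat_ring R n\<^esub> B \<otimes>\<^bsub>mat_ring R n\<^esub> C = A \<otimes>\<^bsub>mat_ring R n\<^esub> (B \<otimes>\<^bsub>mat_ring R n\<^esub> C)"
      using mat_mult_assoc[of A n n B n n C n n n] by simp
  qed (simp_all add: mat_one_left mat_one_right)
next
  fix A B C
  assume "A \<in> carrier (mat_ring R n)" "B \<in> carrier (mat_ring R n)" "C \<in> carrier (mat_ring R n)"
  then have *: "A \<in> mats R n n" "B \<in> mats R n n" "C \<in> mats R n n" by simp_all
  show "(A \<oplus>\<^bsub>mat_ring R n\<^esub> B) \<otimes>\<^bsub>mat_ring R n\<^esub> C =
      A \<otimes>\<^bsub>mat_ring R n\<^esub> C \<oplus>\<^bsub>mat_ring R n\<^esub> B \<otimes>\<^bsub>mat_ring R n\<^esub> C"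
    using mat_add_mult_left[OF *] by simp
  show "C \<otimes>\<^bsub>mat_ring R n\<^esub> (A \<oplus>\<^bsub>mat_ring R n\<^esub> B) =
      C \<otimes>\<^bsub>mat_ring R n\<^esub> A \<oplus>\<^bsub>mat_ring R n\<^esub> C \<otimes>\<^bsub>mat_ring R n\<^esub> B"
    using mat_add_mult_right[OF *(3,1,2)] by simp
qed

lemma mat_ring_minus:
  assumes A: "A \<in> mats R n n" and B: "B \<in> mats R n n"
  shows "(A \<ominus>\<^bsub>mat_ring R n\<^esub> B) i j = A i j \<ominus> B i j"
proof -
  interpret M: ring "mat_ring R n" by (rule mat_ring_ring)
  have "(\<lambda>i j. \<ominus> B i j) \<in> mats R n n"
    using B by (simp add: mats_def)
  moreover have "mat_add R (\<lambda>i j. \<ominus> B i j) B = mat_zero R"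
    by (simp add: mat_add_def mat_zero_def l_neg mats_closed[OF B])
  ultimately have "\<ominus>\<^bsub>mat_ring R n\<^esub> B = (\<lambda>i j. \<ominus> B i j)"
    using M.minus_equality[of "\<lambda>i j. \<ominus> B i j" B] B by simp
  then show ?thesis by (simp add: M.minus_eq mat_add_def minus_eq)
qed

end

definition mat_filtration ::
    "('a, 'b) ring_scheme \<Rightarrow> nat \<Rightarrow> (nat \<Rightarrow> 'a set) \<Rightarrow> nat \<Rightarrow> (nat \<Rightarrow> nat \<Rightarrow> 'a) set" where
  "mat_filtration R n F k = {A \<in> mats R n n. \<forall>i j. A i j \<in> F k}"

text \<open>Limits are taken entry by entry; outside the block they have to be set to zero.\<close>

lemma (in complete_filtered_ring) mat_ring_complete_filtered:
  "complete_filtered_ring (mat_ring A n) (mat_filtration A n F)"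
proof -
  interpret M: ring "mat_ring A n" by (rule mat_ring_ring)
  let ?F = "mat_filtration A n F"
  note minus = mat_ring_minus[of _ n]
  show ?thesis
  proof unfold_locales
    show "?F 0 = carrier (mat_ring A n)"
      by (auto simp: mat_filtration_def F_0 intro: mats_closed)
    show "\<zero>\<^bsub>mat_ring A n\<^esub> \<in> ?F k" for k
      by (simp add: mat_filtration_def) (simp add: mat_zero_def F_zero)
    show "U \<ominus>\<^bsub>mat_ring A n\<^esub> V \<in> ?F k" if "U \<in> ?F k" "V \<in> ?F k" for U V k
      using that M.minus_closed[of U V] by (simp add: mat_filtration_def minus F_diff)
    show "?F (Suc k) \<subseteq> ?F k" for k
      using F_Suc by (auto simp: mat_filtration_def)
    show "U \<otimes>\<^bsub>mat_ring A n\<^esub> V \<in> ?F (i + j)" if "U \<in> ?F i" "V \<in> ?F j" for U V i j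
      using that M.m_closed[of U V] by (auto simp: mat_filtration_def mat_mult_def intro!: F_finsum F_mult)
    show "U = \<zero>\<^bsub>mat_ring A n\<^esub>" if "\<And>k. U \<in> ?F k" for U
    proof -
      have "U i j = \<zero>" for i j
        by (rule F_separated) (use that in \<open>simp add: mat_filtration_def\<close>)
      then show ?thesis by (simp add: mat_zero_def fun_eq_iff)
    qed
    fix f assume f: "\<And>k. f k \<in> carrier (mat_ring A n)"
      and ff: "\<And>k. f (Suc k) \<ominus>\<^bsub>mat_ring A n\<^esub> f k \<in> ?F k"
    have fA: "f k i j \<in> carrier A" for k i j using f[of k] by (simp add: mats_closed)
    have "f (Suc k) i j \<ominus> f k i j \<in> F k" for k i j
      using ff[of k] f[of k] f[of "Suc k"] by (simp add: mat_filtration_def minus)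
    then have "\<exists>s\<in>carrier A. \<forall>k. s \<ominus> f k i j \<in> F k" for i j
      using F_complete[of "\<lambda>k. f k i j"] fA by blast
    then obtain s where s: "\<And>i j. s i j \<in> carrier A" "\<And>i j k. s i j \<ominus> f k i j \<in> F k" by metis
    define t where "t = (\<lambda>i j. if i < n \<and> j < n then s i j else \<zero>)"
    have t: "t \<in> mats A n n"
      by (rule matsI) (auto simp: t_def s)
    have "t i j \<ominus> f k i j \<in> F k" for i j k
      using s(2)[of i j k] mats_outside[of "f k" A n n i j] f[of k]
      by (auto simp: t_def F_diff_self not_less)
    then have "t \<ominus>\<^bsub>mat_ring A n\<^esub> f k \<in> ?F k" for k
      using M.minus_closed[of t "f k"] t f[of k] by (simp add: mat_filtration_def minus)
    then show "\<exists>s\<in>carrier (mat_ring A n). \<forall>k. s \<ominus>\<^bsub>mat_ring A n\<^esub> f k \<in> ?F k"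
      using t by auto
  qed
qed

section \<open>The ring of skew power series\<close>

text \<open>In the ring of power series the powers of the radical enter through the laws of a filtration;
unfolding successive powers into products of ideals would obscure them.\<close>

declare ideal_power.simps(2) [simp del]

text \<open>The two filtration conditions say that \<open>\<sigma>\<close> has degree zero and \<open>\<delta>\<close> has degree one. They make
every infinite sum of coefficients below converge at a linear rate.\<close>

locale skew_series =
  complete_filtered_ring R "ideal_power R (jacobson_radical R)" for R (structure) +
  fixes \<sigma> \<delta> :: "'a \<Rightarrow> 'a"
  assumes \<sigma>_hom: "\<sigma> \<in> ring_hom R R"
    and \<delta>_add: "\<lbrakk> a \<in> carrier R; b \<in> carrier R \<rbrakk> \<Longrightarrow> \<delta> (a \<oplus> b) = \<delta> a \<oplus> \<delta> b"
    and \<delta>_mult: "\<lbrakk> a \<in> carrier R; b \<in> carrier R \<rbrakk> \<Longrightarrow> \<delta> (a \<otimes> b) = \<sigma> a \<otimes> \<delta> b \<oplus> \<delta> a \<otimes> b"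
    and \<sigma>_F: "a \<in> ideal_power R (jacobson_radical R) k \<Longrightarrow>
      \<sigma> a \<in> ideal_power R (jacobson_radical R) k"
    and \<delta>_F: "a \<in> ideal_power R (jacobson_radical R) k \<Longrightarrow>
      \<delta> a \<in> ideal_power R (jacobson_radical R) (Suc k)"
begin

abbreviation J :: "'a set" where "J \<equiv> jacobson_radical R"
abbreviation F :: "nat \<Rightarrow> 'a set" where "F \<equiv> ideal_power R J"
abbreviation S :: "(nat \<Rightarrow> 'a) ring" where "S \<equiv> skew_power_series R \<sigma> \<delta>"

lemma \<sigma>_closed [simp]: "a \<in> carrier R \<Longrightarrow> \<sigma> a \<in> carrier R"
  using ring_hom_closed[OF \<sigma>_hom] .
lemma \<sigma>_add: "\<lbrakk> a \<in> carrier R; b \<in> carrier R \<rbrakk> \<Longrightarrow> \<sigma> (a \<oplus> b) = \<sigma> a \<oplus> \<sigma> b"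
  using ring_hom_add[OF \<sigma>_hom] .
lemma \<sigma>_mult: "\<lbrakk> a \<in> carrier R; b \<in> carrier R \<rbrakk> \<Longrightarrow> \<sigma> (a \<otimes> b) = \<sigma> a \<otimes> \<sigma> b"
  using ring_hom_mult[OF \<sigma>_hom] .
lemma \<sigma>_one [simp]: "\<sigma> \<one> = \<one>"
  using ring_hom_one[OF \<sigma>_hom] .
lemma \<sigma>_zero [simp]: "\<sigma> \<zero> = \<zero>"
  using ring_hom_zero[OF \<sigma>_hom ring_axioms ring_axioms] .
lemma \<delta>_closed [simp]: "a \<in> carrier R \<Longrightarrow> \<delta> a \<in> carrier R"
  using \<delta>_F[of a 0] F_carrier[of "\<delta> a" 1] by simp
lemma \<delta>_zero [simp]: "\<delta> \<zero> = \<zero>"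
  using \<delta>_add[of \<zero> \<zero>] \<delta>_closed[of \<zero>] by simp
lemma \<delta>_one [simp]: "\<delta> \<one> = \<zero>"
  using \<delta>_mult[of \<one> \<one>] \<delta>_closed[of \<one>] by simp

lemma \<sigma>_minus: "\<lbrakk> a \<in> carrier R; b \<in> carrier R \<rbrakk> \<Longrightarrow> \<sigma> (a \<ominus> b) = \<sigma> a \<ominus> \<sigma> b"
  using \<sigma>_add[of "a \<ominus> b" b] by (simp add: minus_eq a_assoc l_neg r_neg)
lemma \<delta>_minus: "\<lbrakk> a \<in> carrier R; b \<in> carrier R \<rbrakk> \<Longrightarrow> \<delta> (a \<ominus> b) = \<delta> a \<ominus> \<delta> b"
  using \<delta>_add[of "a \<ominus> b" b] by (simp add: minus_eq a_assoc l_neg r_neg)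

text \<open>A series whose \<open>i\<close>-th term lies in \<open>J\<^sup>i\<close> has a unique sum, which its partial sums approximate
at the rate of the filtration.\<close>

lemma adic_suminf_approx:
  assumes f: "\<And>i. f i \<in> F i"
  shows "adic_suminf R J f \<in> carrier R" "adic_suminf R J f \<ominus> (\<Oplus>i\<in>{..<N}. f i) \<in> F N"
proof -
  have fR [simp]: "f i \<in> carrier R" for i using F_carrier[OF f] .
  define s where "s = (\<lambda>k. \<Oplus>i\<in>{..<k}. f i)"
  have sR [simp]: "s k \<in> carrier R" for k unfolding s_def by (rule finsum_closed) auto
  have "s (Suc k) \<ominus> s k \<in> F k" for k
  proof -
    have "s (Suc k) = f k \<oplus> s k" unfolding s_def by (rule finsum_lessThan_Suc) simp
    then have "s (Suc k) \<ominus> s k = f k" by (simp add: minus_eq a_assoc r_neg)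
    then show ?thesis using f by simp
  qed
  then obtain t where t: "t \<in> carrier R" "\<And>k. t \<ominus> s k \<in> F k"
    using F_complete[of s] sR by blast
  have ts: "adic_sums R J f t"
    unfolding adic_sums_def
  proof (intro conjI allI exI impI)
    fix k n :: nat assume "k \<le> n"
    then have "t \<ominus> s (Suc n) \<in> F k" using subsetD[OF F_antimono[of k "Suc n"] t(2)] by simp
    then have "s (Suc n) \<ominus> t \<in> F k" using t(1) by (rule F_diff_sym) simp_all
    then show "(\<Oplus>i\<in>{..n}. f i) \<ominus> t \<in> F k" by (simp add: s_def lessThan_Suc_atMost)
  qed (rule t(1))
  have "u = t" if u: "adic_sums R J f u" for u
  proof (rule F_eqI)
    show uR: "u \<in> carrier R" using u by (simp add: adic_sums_def)
    fix k
    obtain N where N: "\<And>n. n \<ge> N \<Longrightarrow> (\<Oplus>i\<in>{..n}. f i) \<ominus> u \<in> F k"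
      using u unfolding adic_sums_def by blast
    obtain N' where N': "\<And>n. n \<ge> N' \<Longrightarrow> (\<Oplus>i\<in>{..n}. f i) \<ominus> t \<in> F k"
      using ts unfolding adic_sums_def by blast
    have c: "(\<Oplus>i\<in>{..max N N'}. f i) \<in> carrier R" by (rule finsum_closed) auto
    have "u \<ominus> (\<Oplus>i\<in>{..max N N'}. f i) \<in> F k"
      by (rule F_diff_sym[OF N c uR]) simp
    then show "u \<ominus> t \<in> F k" by (rule F_diff_trans[OF _ N' uR c t(1)]) simp
  qed (rule t(1))
  then have "adic_suminf R J f = t"
    unfolding adic_suminf_def using ts by (rule the_equality[rotated])
  then show "adic_suminf R J f \<in> carrier R" "adic_suminf R J f \<ominus> (\<Oplus>i\<in>{..<N}. f i) \<in> F N"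
    using t by (simp_all add: s_def)
qed

lemma finite_words: "finite {w. count_list w VarY = k \<and> count_list w VarZ = l}"
proof -
  have len: "length w = count_list w VarY + count_list w VarZ" for w
  proof (induction w)
    case (Cons v w)
    then show ?case by (cases v) simp_all
  qed simp
  have univ: "(UNIV :: var set) = {VarY, VarZ}" using var.exhaust by auto
  have "finite {w :: var list. set w \<subseteq> UNIV \<and> length w = k + l}"
    by (rule finite_lists_length_eq) (simp add: univ)
  then show ?thesis by (rule rev_finite_subset) (auto simp: len)
qed

text \<open>Each factor \<open>\<delta>\<close> gains one power of \<open>J\<close>.\<close>

lemma monomial_map_F: "r \<in> carrier R \<Longrightarrow> monomial_map \<delta> \<sigma> w r \<in> F (count_list w VarY)"
proof (induction w)
  case (Cons v w)
  then show ?case by (cases v) (simp_all add: \<sigma>_F \<delta>_F)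
qed simp

lemma monomial_map_closed: "r \<in> carrier R \<Longrightarrow> monomial_map \<delta> \<sigma> w r \<in> carrier R"
  by (rule F_carrier[OF monomial_map_F])

lemma M_sum_F: "r \<in> carrier R \<Longrightarrow> M_sum R \<delta> \<sigma> k l r \<in> F k"
  unfolding M_sum_def by (rule F_finsum[OF finite_words]) (use monomial_map_F in force)

lemma M_sum_closed: "r \<in> carrier R \<Longrightarrow> M_sum R \<delta> \<sigma> k l r \<in> carrier R"
  by (rule F_carrier[OF M_sum_F])

lemma sum_cons:
  assumes "finite W" "r \<in> carrier R" "\<phi> = (case v of VarY \<Rightarrow> \<delta> | VarZ \<Rightarrow> \<sigma>)"
  shows "(\<Oplus>w\<in>(#) v ` W. monomial_map \<delta> \<sigma> w r) = \<phi> (\<Oplus>w\<in>W. monomial_map \<delta> \<sigma> w r)"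
proof -
  have "(\<Oplus>w\<in>(#) v ` W. monomial_map \<delta> \<sigma> w r) = (\<Oplus>w\<in>W. monomial_map \<delta> \<sigma> (v # w) r)"
    by (rule finsum_reindex) (use assms monomial_map_closed in \<open>auto simp del: monomial_map.simps\<close>)
  also have "\<dots> = \<phi> (\<Oplus>w\<in>W. monomial_map \<delta> \<sigma> w r)"
    unfolding assms(3) using assms(1,2)
    by (subst additive_finsum) (auto simp: monomial_map_closed \<sigma>_add \<delta>_add split: var.splits)
  finally show ?thesis .
qed

text \<open>The coefficient of \<open>x\<^sup>n\<close> in \<open>x\<^sup>j r\<close>. The extension by zero to \<open>n > j\<close> makes the recursion in
\<open>x_power_coeff_rec\<close> uniform.\<close>

definition x_power_coeff :: "nat \<Rightarrow> nat \<Rightarrow> 'a \<Rightarrow> 'a" where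
  "x_power_coeff j n r = (if n \<le> j then M_sum R \<delta> \<sigma> (j - n) n r else \<zero>)"

lemma x_power_coeff_closed [simp]: "r \<in> carrier R \<Longrightarrow> x_power_coeff j n r \<in> carrier R"
  by (simp add: x_power_coeff_def M_sum_closed)

text \<open>Words are split according to their first letter.\<close>

lemma words_rec:
  "{w. count_list w VarY = 0 \<and> count_list w VarZ = 0} = {[]}" (is ?none)
  "{w. count_list w VarY = Suc k \<and> count_list w VarZ = 0} =
    (#) VarY ` {w. count_list w VarY = k \<and> count_list w VarZ = 0}" (is ?Y)
  "{w. count_list w VarY = 0 \<and> count_list w VarZ = Suc l} =
    (#) VarZ ` {w. count_list w VarY = 0 \<and> count_list w VarZ = l}" (is ?Z)
  "{w. count_list w VarY = Suc k \<and> count_list w VarZ = Suc l} =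
    (#) VarY ` {w. count_list w VarY = k \<and> count_list w VarZ = Suc l} \<union>
    (#) VarZ ` {w. count_list w VarY = Suc k \<and> count_list w VarZ = l}" (is ?YZ)
proof -
  have split: "(w \<in> A \<longleftrightarrow> w \<in> B) \<longleftrightarrow>
      (w = [] \<longrightarrow> ([] \<in> A \<longleftrightarrow> [] \<in> B)) \<and>
      (\<forall>w'. w = VarY # w' \<longrightarrow> (VarY # w' \<in> A \<longleftrightarrow> VarY # w' \<in> B)) \<and>
      (\<forall>w'. w = VarZ # w' \<longrightarrow> (VarZ # w' \<in> A \<longleftrightarrow> VarZ # w' \<in> B))" for w A B
    by (metis (full_types) neq_Nil_conv var.exhaust)
  show ?none by (rule Set.set_eqI, subst split) auto
  show ?Y by (rule Set.set_eqI, subst split) auto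
  show ?Z by (rule Set.set_eqI, subst split) auto
  show ?YZ by (rule Set.set_eqI, subst split) auto
qed

lemma x_power_coeff_rec:
  assumes r: "r \<in> carrier R"
  shows "x_power_coeff 0 0 r = r" "x_power_coeff 0 (Suc n) r = \<zero>"
    "x_power_coeff (Suc j) 0 r = \<delta> (x_power_coeff j 0 r)"
    "x_power_coeff (Suc j) (Suc n) r = \<delta> (x_power_coeff j (Suc n) r) \<oplus> \<sigma> (x_power_coeff j n r)"
proof -
  show "x_power_coeff 0 0 r = r" using r by (simp add: x_power_coeff_def M_sum_def words_rec)
  show "x_power_coeff 0 (Suc n) r = \<zero>" by (simp add: x_power_coeff_def)
  have Y: "M_sum R \<delta> \<sigma> (Suc k) 0 r = \<delta> (M_sum R \<delta> \<sigma> k 0 r)" for k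
    unfolding M_sum_def words_rec by (rule sum_cons) (simp_all add: finite_words r)
  have Z: "M_sum R \<delta> \<sigma> 0 (Suc l) r = \<sigma> (M_sum R \<delta> \<sigma> 0 l r)" for l
    unfolding M_sum_def words_rec by (rule sum_cons) (simp_all add: finite_words r)
  have YZ: "M_sum R \<delta> \<sigma> (Suc k) (Suc l) r =
      \<delta> (M_sum R \<delta> \<sigma> k (Suc l) r) \<oplus> \<sigma> (M_sum R \<delta> \<sigma> (Suc k) l r)" for k l
    unfolding M_sum_def words_rec(4)
  proof (subst finsum_Un_disjoint)
    show "(\<Oplus>w\<in>(#) VarY ` {w. count_list w VarY = k \<and> count_list w VarZ = Suc l}. monomial_map \<delta> \<sigma> w r) \<oplus>
        (\<Oplus>w\<in>(#) VarZ ` {w. count_list w VarY = Suc k \<and> count_list w VarZ = l}. monomial_map \<delta> \<sigma> w r) =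
        \<delta> (\<Oplus>w\<in>{w. count_list w VarY = k \<and> count_list w VarZ = Suc l}. monomial_map \<delta> \<sigma> w r) \<oplus>
        \<sigma> (\<Oplus>w\<in>{w. count_list w VarY = Suc k \<and> count_list w VarZ = l}. monomial_map \<delta> \<sigma> w r)"
      by (intro arg_cong2[where f = "add R"] sum_cons finite_words r) simp_all
  qed (use monomial_map_closed[OF r] finite_words in auto)
  show "x_power_coeff (Suc j) 0 r = \<delta> (x_power_coeff j 0 r)"
    by (simp add: x_power_coeff_def Y)
  show "x_power_coeff (Suc j) (Suc n) r = \<delta> (x_power_coeff j (Suc n) r) \<oplus> \<sigma> (x_power_coeff j n r)"
  proof (cases "n < j")
    case True
    then have "j - n = Suc (j - Suc n)" by simp
    then show ?thesis using True by (simp add: x_power_coeff_def YZ)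
  next
    case False
    then show ?thesis using r by (auto simp: x_power_coeff_def Z M_sum_closed)
  qed
qed

text \<open>The series \<open>\<Sum> \<sigma>(b\<^sub>l) x\<^sup>l\<^sup>+\<^sup>1\<close>.\<close>

definition shift :: "(nat \<Rightarrow> 'a) \<Rightarrow> nat \<Rightarrow> 'a" where
  "shift b m = (case m of 0 \<Rightarrow> \<zero> | Suc l \<Rightarrow> \<sigma> (b l))"

text \<open>Left multiplication by \<open>x\<close>, according to the rule \<open>x r = \<sigma>(r) x + \<delta>(r)\<close>.\<close>

definition x_mult :: "(nat \<Rightarrow> 'a) \<Rightarrow> nat \<Rightarrow> 'a" where
  "x_mult b m = shift b m \<oplus> \<delta> (b m)"

abbreviation x_pow :: "nat \<Rightarrow> (nat \<Rightarrow> 'a) \<Rightarrow> nat \<Rightarrow> 'a" where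
  "x_pow j \<equiv> x_mult ^^ j"

definition scale :: "'a \<Rightarrow> (nat \<Rightarrow> 'a) \<Rightarrow> nat \<Rightarrow> 'a" where
  "scale r b m = r \<otimes> b m"

text \<open>The contribution of the first \<open>N\<close> terms of \<open>a\<close> to the product \<open>a b\<close>.\<close>

definition partial_mult :: "nat \<Rightarrow> (nat \<Rightarrow> 'a) \<Rightarrow> (nat \<Rightarrow> 'a) \<Rightarrow> nat \<Rightarrow> 'a" where
  "partial_mult N a b m = (\<Oplus>j\<in>{..<N}. a j \<otimes> x_pow j b m)"

text \<open>Congruence modulo the \<open>N\<close>-th term of the filtration in which \<open>x\<close> has degree one.\<close>

definition cong_mod :: "nat \<Rightarrow> (nat \<Rightarrow> 'a) \<Rightarrow> (nat \<Rightarrow> 'a) \<Rightarrow> bool" where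
  "cong_mod N a b \<longleftrightarrow> (\<forall>m. a m \<ominus> b m \<in> F (N - m))"

abbreviation series :: "(nat \<Rightarrow> 'a) \<Rightarrow> bool" where
  "series a \<equiv> (\<forall>m. a m \<in> carrier R)"

lemma shift_closed [simp]: "series b \<Longrightarrow> shift b m \<in> carrier R"
  by (simp add: shift_def split: nat.split)

lemma x_mult_closed [simp]: "series b \<Longrightarrow> x_mult b m \<in> carrier R"
  by (simp add: x_mult_def)

lemma x_pow_closed [simp]: "series b \<Longrightarrow> x_pow j b m \<in> carrier R"
  by (induction j arbitrary: m) simp_all

lemma scale_closed [simp]: "\<lbrakk> r \<in> carrier R; series b \<rbrakk> \<Longrightarrow> scale r b m \<in> carrier R"
  by (simp add: scale_def)

lemma partial_mult_closed [simp]: "\<lbrakk> series a; series b \<rbrakk> \<Longrightarrow> partial_mult N a b m \<in> carrier R"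
  unfolding partial_mult_def by (rule finsum_closed) auto

lemma x_mult_add:
  "\<lbrakk> series a; series b \<rbrakk> \<Longrightarrow> x_mult (\<lambda>m. a m \<oplus> b m) m = x_mult a m \<oplus> x_mult b m"
  by (cases m) (simp_all add: x_mult_def shift_def \<sigma>_add \<delta>_add a_ac)

lemma x_pow_add:
  "\<lbrakk> series a; series b \<rbrakk> \<Longrightarrow> x_pow j (\<lambda>m. a m \<oplus> b m) m = x_pow j a m \<oplus> x_pow j b m"
proof (induction j arbitrary: m)
  case (Suc j)
  then have "x_pow j (\<lambda>m. a m \<oplus> b m) = (\<lambda>m. x_pow j a m \<oplus> x_pow j b m)" by blast
  then show ?case using Suc.prems x_mult_add[of "x_pow j a" "x_pow j b"] by simp
qed simp

lemma x_mult_scale: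
  assumes "r \<in> carrier R" "series b"
  shows "x_mult (scale r b) m = scale (\<sigma> r) (x_mult b) m \<oplus> scale (\<delta> r) b m"
  using assms
  by (cases m) (simp_all add: x_mult_def shift_def scale_def \<sigma>_mult \<delta>_mult r_distr a_ac)

text \<open>The summand \<open>\<sigma>(b\<^sub>m\<^sub>-\<^sub>1)\<close> gains a degree because the exponent of \<open>x\<close> grows, the summand
\<open>\<delta>(b\<^sub>m)\<close> because \<open>\<delta>\<close> has degree one.\<close>

lemma x_mult_filtration:
  assumes "\<And>m. b m \<in> F (k - m)"
  shows "x_mult b m \<in> F (Suc k - m)"
proof -
  have "shift b m \<in> F (Suc k - m)"
  proof (cases m)
    case 0
    then show ?thesis using F_zero by (simp add: shift_def)
  next
    case (Suc l)
    then show ?thesis using \<sigma>_F[OF assms[of l]] by (simp add: shift_def)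
  qed
  moreover have "\<delta> (b m) \<in> F (Suc k - m)"
    by (rule F_weaken[OF \<delta>_F[OF assms[of m]]]) simp
  ultimately show ?thesis unfolding x_mult_def by (rule F_add)
qed

lemma x_pow_filtration:
  assumes "\<And>m. b m \<in> F (k - m)"
  shows "x_pow j b m \<in> F (j + k - m)"
proof (induction j arbitrary: m)
  case (Suc j)
  show ?case using x_mult_filtration[of "x_pow j b" "j + k" m] Suc.IH by simp
qed (use assms in simp)

lemma x_pow_F: "series b \<Longrightarrow> x_pow j b m \<in> F (j - m)"
  using x_pow_filtration[of b 0 j m] by (simp add: F_0)

lemma x_pow_one: "x_pow j (\<lambda>m. if m = 0 then \<one> else \<zero>) = (\<lambda>m. if m = j then \<one> else \<zero>)"
proof (induction j)
  case (Suc j)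
  show ?case unfolding funpow.simps o_apply Suc.IH
    by (rule ext) (simp add: x_mult_def shift_def split: nat.split)
qed simp

text \<open>This connects the iterates of the operator \<open>x_mult\<close> with the sums of monomials by which the product
of \<open>S\<close> is defined.\<close>

lemma x_pow_coeff:
  assumes b: "series b"
  shows "x_pow j b m = (\<Oplus>n\<in>{..m}. x_power_coeff j n (b (m - n)))"
proof (induction j arbitrary: m)
  case 0
  have "(\<Oplus>n\<in>{..m}. x_power_coeff 0 n (b (m - n))) = x_power_coeff 0 0 (b (m - 0))"
  proof (rule finsum_delta)
    fix n :: nat assume "n \<noteq> 0"
    then show "x_power_coeff 0 n (b (m - n)) = \<zero>" using b by (cases n) (simp_all add: x_power_coeff_rec)
  qed (use b in auto)
  then show ?case using b by (simp add: x_power_coeff_rec)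
next
  case (Suc j)
  have \<delta>sum: "\<delta> (x_pow j b m) = (\<Oplus>n\<in>{..m}. \<delta> (x_power_coeff j n (b (m - n))))"
    unfolding Suc.IH using b by (intro additive_finsum) (auto simp: \<delta>_add)
  have step: "x_pow (Suc j) b m = shift (x_pow j b) m \<oplus> \<delta> (x_pow j b m)"
    unfolding funpow.simps o_apply by (rule x_mult_def)
  show ?case
  proof (cases m)
    case 0
    then show ?thesis unfolding step \<delta>sum using b by (simp add: shift_def x_power_coeff_rec)
  next
    case (Suc l)
    have \<sigma>sum: "\<sigma> (x_pow j b l) = (\<Oplus>n\<in>{..l}. \<sigma> (x_power_coeff j n (b (l - n))))"
      unfolding Suc.IH using b by (intro additive_finsum) (auto simp: \<sigma>_add)
    have \<delta>sum': "\<delta> (x_pow j b m) = (\<Oplus>n\<in>{..l}. \<delta> (x_power_coeff j (Suc n) (b (l - n)))) \<oplus>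
        \<delta> (x_power_coeff j 0 (b m))"
      unfolding \<delta>sum unfolding Suc by (subst finsum_Suc2) (use b in auto)
    have "(\<Oplus>n\<in>{..m}. x_power_coeff (Suc j) n (b (m - n))) =
        (\<Oplus>n\<in>{..l}. x_power_coeff (Suc j) (Suc n) (b (l - n))) \<oplus> x_power_coeff (Suc j) 0 (b m)"
      unfolding Suc by (subst finsum_Suc2) (use b in auto)
    also have "(\<Oplus>n\<in>{..l}. x_power_coeff (Suc j) (Suc n) (b (l - n))) =
        (\<Oplus>n\<in>{..l}. \<delta> (x_power_coeff j (Suc n) (b (l - n))) \<oplus> \<sigma> (x_power_coeff j n (b (l - n))))"
      using b by (intro finsum_cong') (auto simp: x_power_coeff_rec)
    also have "\<dots> = (\<Oplus>n\<in>{..l}. \<delta> (x_power_coeff j (Suc n) (b (l - n)))) \<oplus> \<sigma> (x_pow j b l)"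
      unfolding \<sigma>sum using b by (intro finsum_addf) auto
    finally have eq: "(\<Oplus>n\<in>{..m}. x_power_coeff (Suc j) n (b (m - n))) =
        (\<Oplus>n\<in>{..l}. \<delta> (x_power_coeff j (Suc n) (b (l - n)))) \<oplus> \<sigma> (x_pow j b l) \<oplus>
        x_power_coeff (Suc j) 0 (b m)" .
    have c: "(\<Oplus>n\<in>{..l}. \<delta> (x_power_coeff j (Suc n) (b (l - n)))) \<in> carrier R"
      by (rule finsum_closed) (use b in auto)
    have "x_pow (Suc j) b m = \<sigma> (x_pow j b l) \<oplus> \<delta> (x_pow j b m)"
      unfolding step by (simp add: shift_def Suc)
    also have "\<dots> = (\<Oplus>n\<in>{..m}. x_power_coeff (Suc j) n (b (m - n)))"
      unfolding \<delta>sum' eq using b c by (simp add: x_power_coeff_rec a_ac)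
    finally show ?thesis .
  qed
qed

lemma S_simps:
  "carrier S = UNIV \<rightarrow> carrier R" "monoid.one S = (\<lambda>m. if m = 0 then \<one> else \<zero>)"
  "ring.zero S = (\<lambda>m. \<zero>)" "a \<oplus>\<^bsub>S\<^esub> b = (\<lambda>m. a m \<oplus> b m)"
  by (simp_all add: skew_power_series_def)

lemma S_carrier: "a \<in> carrier S \<longleftrightarrow> series a"
  by (auto simp: S_simps)

text \<open>The reindexing \<open>j = n + i\<close> in the definition of the product.\<close>

lemma finsum_x_power_coeff:
  assumes "series a" "r \<in> carrier R"
  shows "(\<Oplus>j\<in>{..<N}. a j \<otimes> x_power_coeff j n r) =
    (\<Oplus>i\<in>{..<N - n}. a (n + i) \<otimes> M_sum R \<delta> \<sigma> i n r)"
proof (induction N)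
  case (Suc N)
  show ?case
  proof (cases "n \<le> N")
    case True
    then have "{..<Suc N - n} = {..<Suc (N - n)}" by auto
    then show ?thesis using assms Suc True
      by (simp add: finsum_lessThan_Suc M_sum_closed) (simp add: x_power_coeff_def)
  next
    case False
    then show ?thesis using assms Suc by (simp add: finsum_lessThan_Suc) (simp add: x_power_coeff_def)
  qed
qed simp

text \<open>The inner series over \<open>j \<ge> n\<close>, cut off at \<open>j = N\<close>, has an error in \<open>J\<^sup>N\<^sup>-\<^sup>n\<close>, and only \<open>n \<le> m\<close>
contribute to the coefficient of \<open>x\<^sup>m\<close>.\<close>

lemma mult_approx:
  assumes a: "series a" and b: "series b"
  shows "series (a \<otimes>\<^bsub>S\<^esub> b)" "cong_mod N (a \<otimes>\<^bsub>S\<^esub> b) (partial_mult N a b)"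
proof -
  define s where "s = (\<lambda>m n. adic_suminf R J (\<lambda>i. a (n + i) \<otimes> M_sum R \<delta> \<sigma> i n (b (m - n))))"
  have term_F: "a (n + i) \<otimes> M_sum R \<delta> \<sigma> i n (b (m - n)) \<in> F i" for m n i
    using a b by (intro F_mult_left M_sum_F) auto
  have sR [simp]: "s m n \<in> carrier R" for m n
    unfolding s_def by (rule adic_suminf_approx(1)[OF term_F])
  have s: "s m n \<ominus> (\<Oplus>j\<in>{..<N}. a j \<otimes> x_power_coeff j n (b (m - n))) \<in> F (N - n)" for m n
  proof -
    have "s m n \<ominus> (\<Oplus>i\<in>{..<N - n}. a (n + i) \<otimes> M_sum R \<delta> \<sigma> i n (b (m - n))) \<in> F (N - n)"
      unfolding s_def by (rule adic_suminf_approx(2)[OF term_F])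
    then show ?thesis using a b by (simp add: finsum_x_power_coeff)
  qed
  have ab: "(a \<otimes>\<^bsub>S\<^esub> b) m = (\<Oplus>n\<in>{..m}. s m n)" for m
    by (simp add: skew_power_series_def s_def)
  show "series (a \<otimes>\<^bsub>S\<^esub> b)" unfolding ab by (auto intro!: finsum_closed)
  show "cong_mod N (a \<otimes>\<^bsub>S\<^esub> b) (partial_mult N a b)"
    unfolding cong_mod_def
  proof
    fix m
    have "partial_mult N a b m =
        (\<Oplus>j\<in>{..<N}. \<Oplus>n\<in>{..m}. a j \<otimes> x_power_coeff j n (b (m - n)))"
      unfolding partial_mult_def x_pow_coeff[OF b] using a b
      by (intro finsum_cong') (auto intro!: finsum_rdistr finsum_closed)
    also have "\<dots> = (\<Oplus>n\<in>{..m}. \<Oplus>j\<in>{..<N}. a j \<otimes> x_power_coeff j n (b (m - n)))"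
      by (rule finsum_swap) (use a b in auto)
    finally have p: "partial_mult N a b m = \<dots>" .
    show "(a \<otimes>\<^bsub>S\<^esub> b) m \<ominus> partial_mult N a b m \<in> F (N - m)"
      unfolding ab p
    proof (rule F_finsum_diff)
      fix n assume "n \<in> {..m}"
      then have "F (N - n) \<subseteq> F (N - m)" by (intro F_antimono) auto
      then show "s m n \<ominus> (\<Oplus>j\<in>{..<N}. a j \<otimes> x_power_coeff j n (b (m - n))) \<in> F (N - m)"
        using s[of m n] by blast
      show "(\<Oplus>j\<in>{..<N}. a j \<otimes> x_power_coeff j n (b (m - n))) \<in> carrier R"
        by (rule finsum_closed) (use a b in auto)
    qed simp_all
  qed
qed

lemma cong_mod_trans:
  "\<lbrakk> cong_mod N a b; cong_mod N b c; series a; series b; series c \<rbrakk> \<Longrightarrow> cong_mod N a c"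
  unfolding cong_mod_def using F_diff_trans by blast

lemma cong_mod_sym: "\<lbrakk> cong_mod N a b; series a; series b \<rbrakk> \<Longrightarrow> cong_mod N b a"
  unfolding cong_mod_def using F_diff_sym by blast

lemma cong_mod_eqI:
  assumes "series a" "series b" "\<And>N. cong_mod N a b"
  shows "a = b"
proof
  fix m
  show "a m = b m"
  proof (rule F_eqI)
    \<comment> \<open>The coefficient of \<open>x\<^sup>m\<close> sees only the degree \<open>N - m\<close>, hence the choice \<open>N = k + m\<close>.\<close>
    show "a m \<ominus> b m \<in> F k" for k using assms(3)[of "k + m"] unfolding cong_mod_def by (metis add_diff_cancel_right')
  qed (use assms in auto)
qed

text \<open>Products are recognised by their finite approximations, since the filtration is separated.\<close>

lemma mult_eqI:
  assumes "series a" "series b" "series c" "\<And>N. cong_mod N c (partial_mult N a b)"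
  shows "c = a \<otimes>\<^bsub>S\<^esub> b"
proof (rule cong_mod_eqI)
  show "cong_mod N c (a \<otimes>\<^bsub>S\<^esub> b)" for N
    by (rule cong_mod_trans[OF assms(4) cong_mod_sym]) (use assms mult_approx in auto)
qed (use assms mult_approx in auto)

lemma x_mult_cong:
  assumes "cong_mod N a b" "series a" "series b"
  shows "cong_mod N (x_mult a) (x_mult b)"
  unfolding cong_mod_def
proof
  fix m
  have "shift a m \<ominus> shift b m \<in> F (N - m)"
  proof (cases m)
    case 0
    then show ?thesis using F_diff_self by (simp add: shift_def)
  next
    case (Suc l)
    have "\<sigma> (a l \<ominus> b l) \<in> F (N - l)" using assms(1) by (intro \<sigma>_F) (simp add: cong_mod_def)
    moreover have "F (N - l) \<subseteq> F (N - m)" by (rule F_antimono) (simp add: Suc)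
    ultimately show ?thesis using assms by (auto simp: Suc shift_def \<sigma>_minus)
  qed
  moreover have "\<delta> (a m \<ominus> b m) \<in> F (Suc (N - m))"
    using assms(1) by (intro \<delta>_F) (simp add: cong_mod_def)
  then have "\<delta> (a m) \<ominus> \<delta> (b m) \<in> F (N - m)"
    using F_Suc assms by (auto simp: \<delta>_minus)
  ultimately show "x_mult a m \<ominus> x_mult b m \<in> F (N - m)"
    unfolding x_mult_def by (rule F_add_diff) (use assms in auto)
qed

lemma partial_mult_filtration:
  assumes "\<And>m. a m \<in> F (i - m)" "\<And>m. b m \<in> F (k - m)"
  shows "partial_mult N a b m \<in> F (i + k - m)"
  unfolding partial_mult_def
proof (rule F_finsum)
  fix j
  show "a j \<otimes> x_pow j b m \<in> F (i + k - m)"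
    by (rule F_weaken[OF F_mult[OF assms(1) x_pow_filtration[OF assms(2)]]]) simp
qed simp

lemma partial_mult_cong_left:
  assumes "cong_mod N a a'" "series a" "series a'" "series b"
  shows "cong_mod N (partial_mult M a b) (partial_mult M a' b)"
  unfolding cong_mod_def partial_mult_def
proof (intro allI F_finsum_diff)
  fix m j
  have "a j \<otimes> x_pow j b m \<ominus> a' j \<otimes> x_pow j b m = (a j \<ominus> a' j) \<otimes> x_pow j b m"
    using assms by (simp add: minus_eq l_distr l_minus)
  also have "\<dots> \<in> F (N - m)"
    by (rule F_weaken[OF F_mult[OF _ x_pow_F[OF assms(4)], of "a j \<ominus> a' j" "N - j"]])
      (use assms(1) in \<open>auto simp: cong_mod_def\<close>)
  finally show "a j \<otimes> x_pow j b m \<ominus> a' j \<otimes> x_pow j b m \<in> F (N - m)" .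
qed (use assms in auto)

lemma mult_cong_left:
  assumes "cong_mod N a a'" "series a" "series a'" "series b"
  shows "cong_mod N (a \<otimes>\<^bsub>S\<^esub> b) (a' \<otimes>\<^bsub>S\<^esub> b)"
proof -
  have "cong_mod N (a \<otimes>\<^bsub>S\<^esub> b) (partial_mult N a' b)"
    by (rule cong_mod_trans[OF mult_approx(2) partial_mult_cong_left[OF assms]])
      (use assms mult_approx(1) in auto)
  then show ?thesis
    by (rule cong_mod_trans[OF _ cong_mod_sym[OF mult_approx(2)]]) (use assms mult_approx(1) in auto)
qed

lemma mult_add_left:
  assumes "series a" "series a'" "series b"
  shows "(\<lambda>m. a m \<oplus> a' m) \<otimes>\<^bsub>S\<^esub> b = (\<lambda>m. (a \<otimes>\<^bsub>S\<^esub> b) m \<oplus> (a' \<otimes>\<^bsub>S\<^esub> b) m)"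
proof (rule mult_eqI[symmetric])
  note cl = mult_approx(1)[OF assms(1,3)] mult_approx(1)[OF assms(2,3)]
  show "cong_mod N (\<lambda>m. (a \<otimes>\<^bsub>S\<^esub> b) m \<oplus> (a' \<otimes>\<^bsub>S\<^esub> b) m) (partial_mult N (\<lambda>m. a m \<oplus> a' m) b)" for N
    unfolding cong_mod_def
  proof
    fix m
    have "partial_mult N (\<lambda>m. a m \<oplus> a' m) b m = partial_mult N a b m \<oplus> partial_mult N a' b m"
      unfolding partial_mult_def using assms
      by (subst finsum_addf[symmetric]) (auto simp: l_distr intro!: finsum_cong')
    then show "(a \<otimes>\<^bsub>S\<^esub> b) m \<oplus> (a' \<otimes>\<^bsub>S\<^esub> b) m \<ominus> partial_mult N (\<lambda>m. a m \<oplus> a' m) b m \<in> F (N - m)"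
      using mult_approx(2)[OF assms(1,3), of N] mult_approx(2)[OF assms(2,3), of N] cl assms
      by (simp add: cong_mod_def F_add_diff)
  qed
  show "series (\<lambda>m. (a \<otimes>\<^bsub>S\<^esub> b) m \<oplus> (a' \<otimes>\<^bsub>S\<^esub> b) m)" using cl by simp
qed (use assms in auto)

lemma mult_add_right:
  assumes "series a" "series b" "series b'"
  shows "a \<otimes>\<^bsub>S\<^esub> (\<lambda>m. b m \<oplus> b' m) = (\<lambda>m. (a \<otimes>\<^bsub>S\<^esub> b) m \<oplus> (a \<otimes>\<^bsub>S\<^esub> b') m)"
proof (rule mult_eqI[symmetric])
  note cl = mult_approx(1)[OF assms(1,2)] mult_approx(1)[OF assms(1,3)]
  show "cong_mod N (\<lambda>m. (a \<otimes>\<^bsub>S\<^esub> b) m \<oplus> (a \<otimes>\<^bsub>S\<^esub> b') m) (partial_mult N a (\<lambda>m. b m \<oplus> b' m))" for N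
    unfolding cong_mod_def
  proof
    fix m
    have "partial_mult N a (\<lambda>m. b m \<oplus> b' m) m = partial_mult N a b m \<oplus> partial_mult N a b' m"
      unfolding partial_mult_def using assms
      by (subst finsum_addf[symmetric]) (auto simp: r_distr x_pow_add intro!: finsum_cong')
    then show "(a \<otimes>\<^bsub>S\<^esub> b) m \<oplus> (a \<otimes>\<^bsub>S\<^esub> b') m \<ominus> partial_mult N a (\<lambda>m. b m \<oplus> b' m) m \<in> F (N - m)"
      using mult_approx(2)[OF assms(1,2), of N] mult_approx(2)[OF assms(1,3), of N] cl assms
      by (simp add: cong_mod_def F_add_diff)
  qed
  show "series (\<lambda>m. (a \<otimes>\<^bsub>S\<^esub> b) m \<oplus> (a \<otimes>\<^bsub>S\<^esub> b') m)" using cl by simp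
qed (use assms in auto)

lemma mult_scale:
  assumes "r \<in> carrier R" "series a" "series b"
  shows "scale r a \<otimes>\<^bsub>S\<^esub> b = scale r (a \<otimes>\<^bsub>S\<^esub> b)"
proof (rule mult_eqI[symmetric])
  note cl = mult_approx(1)[OF assms(2,3)]
  show "cong_mod N (scale r (a \<otimes>\<^bsub>S\<^esub> b)) (partial_mult N (scale r a) b)" for N
    unfolding cong_mod_def
  proof
    fix m
    have "partial_mult N (scale r a) b m = r \<otimes> partial_mult N a b m"
      unfolding partial_mult_def scale_def using assms
      by (subst finsum_rdistr) (auto simp: m_assoc intro!: finsum_cong')
    then have "scale r (a \<otimes>\<^bsub>S\<^esub> b) m \<ominus> partial_mult N (scale r a) b m =
        r \<otimes> ((a \<otimes>\<^bsub>S\<^esub> b) m \<ominus> partial_mult N a b m)"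
      using assms cl by (simp add: scale_def minus_eq r_distr r_minus)
    also have "\<dots> \<in> F (N - m)"
      using mult_approx(2)[OF assms(2,3), of N] assms(1)
      by (intro F_mult_left) (auto simp: cong_mod_def)
    finally show "scale r (a \<otimes>\<^bsub>S\<^esub> b) m \<ominus> partial_mult N (scale r a) b m \<in> F (N - m)" .
  qed
qed (use assms mult_approx(1) in auto)

text \<open>Multiplying the first \<open>N\<close> terms of \<open>a\<close> by \<open>x\<close> gives the first \<open>N\<close> terms of \<open>x a\<close>, except that the
leading term \<open>\<sigma>(a\<^sub>N\<^sub>-\<^sub>1) x\<^sup>N\<close> is pushed beyond the cutoff.\<close>

lemma x_mult_partial_mult:
  assumes "series a" "series b"
  shows "x_mult (partial_mult N a b) m =
    partial_mult N (x_mult a) b m \<oplus> shift a N \<otimes> x_pow N b m"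
proof (induction N arbitrary: m)
  case 0
  show ?case by (cases m) (use assms in \<open>simp_all add: partial_mult_def x_mult_def shift_def\<close>)
next
  case (Suc N)
  have rec: "partial_mult (Suc N) c b = (\<lambda>m. scale (c N) (x_pow N b) m \<oplus> partial_mult N c b m)"
    if "series c" for c
    unfolding partial_mult_def scale_def using that assms(2)
    by (intro ext finsum_lessThan_Suc) simp
  have "x_mult (partial_mult (Suc N) a b) m =
      x_mult (scale (a N) (x_pow N b)) m \<oplus> x_mult (partial_mult N a b) m"
    unfolding rec[OF assms(1)] by (rule x_mult_add) (use assms in auto)
  also have "\<dots> = (\<sigma> (a N) \<otimes> x_pow (Suc N) b m \<oplus> \<delta> (a N) \<otimes> x_pow N b m) \<oplus>
      (partial_mult N (x_mult a) b m \<oplus> shift a N \<otimes> x_pow N b m)"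
    unfolding Suc.IH using assms by (subst x_mult_scale) (auto simp: scale_def)
  also have "\<dots> = ((shift a N \<oplus> \<delta> (a N)) \<otimes> x_pow N b m \<oplus> partial_mult N (x_mult a) b m) \<oplus>
      \<sigma> (a N) \<otimes> x_pow (Suc N) b m"
    using assms x_pow_closed[OF assms(2), of "Suc N" m] x_mult_closed[OF assms(1)]
    by (simp only: l_distr shift_closed \<delta>_closed x_pow_closed m_closed partial_mult_closed
        a_closed \<sigma>_closed a_ac simp_thms)
  also have "\<dots> = partial_mult (Suc N) (x_mult a) b m \<oplus> shift a (Suc N) \<otimes> x_pow (Suc N) b m"
    using assms by (simp add: rec) (simp add: scale_def x_mult_def[of a N] shift_def[of a "Suc N"])
  finally show ?case .
qed

text \<open>The term pushed beyond the cutoff lies in the \<open>N\<close>-th term of the filtration.\<close>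

lemma x_mult_mult:
  assumes "series a" "series b"
  shows "x_mult (a \<otimes>\<^bsub>S\<^esub> b) = x_mult a \<otimes>\<^bsub>S\<^esub> b"
proof (rule mult_eqI)
  note cl = mult_approx(1)[OF assms]
  show "cong_mod N (x_mult (a \<otimes>\<^bsub>S\<^esub> b)) (partial_mult N (x_mult a) b)" for N
  proof (rule cong_mod_trans)
    show "cong_mod N (x_mult (a \<otimes>\<^bsub>S\<^esub> b)) (x_mult (partial_mult N a b))"
      by (rule x_mult_cong[OF mult_approx(2)]) (use assms cl in auto)
    show "cong_mod N (x_mult (partial_mult N a b)) (partial_mult N (x_mult a) b)"
      unfolding cong_mod_def x_mult_partial_mult[OF assms]
    proof
      fix m
      have "shift a N \<otimes> x_pow N b m \<in> F (N - m)"
        using assms by (intro F_mult_left x_pow_F) auto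
      then show "partial_mult N (x_mult a) b m \<oplus> shift a N \<otimes> x_pow N b m \<ominus>
          partial_mult N (x_mult a) b m \<in> F (N - m)"
        using assms by (simp add: minus_eq a_ac r_neg r_neg1 r_neg2)
    qed
  qed (use assms cl in auto)
qed (use assms mult_approx(1) in auto)

lemma x_pow_mult:
  "\<lbrakk> series a; series b \<rbrakk> \<Longrightarrow> x_pow j (a \<otimes>\<^bsub>S\<^esub> b) = x_pow j a \<otimes>\<^bsub>S\<^esub> b"
  by (induction j) (simp_all add: x_mult_mult)

lemma mult_finsum_left:
  assumes "\<And>j. series (f j)" "series b"
  shows "(\<lambda>m. \<Oplus>j\<in>{..<N::nat}. f j m) \<otimes>\<^bsub>S\<^esub> b = (\<lambda>m. \<Oplus>j\<in>{..<N}. (f j \<otimes>\<^bsub>S\<^esub> b) m)"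
proof (induction N)
  case 0
  have "(\<lambda>m. \<zero>) = (\<lambda>m. \<zero>) \<otimes>\<^bsub>S\<^esub> b"
    by (rule mult_eqI) (use assms in \<open>simp_all add: cong_mod_def partial_mult_def F_diff_self\<close>)
  then show ?case by simp
next
  case (Suc N)
  have "(\<lambda>m. \<Oplus>j\<in>{..<Suc N}. f j m) \<otimes>\<^bsub>S\<^esub> b = (\<lambda>m. f N m \<oplus> (\<Oplus>j\<in>{..<N}. f j m)) \<otimes>\<^bsub>S\<^esub> b"
    using assms by (simp add: finsum_lessThan_Suc)
  also have "\<dots> = (\<lambda>m. (f N \<otimes>\<^bsub>S\<^esub> b) m \<oplus> (\<Oplus>j\<in>{..<N}. (f j \<otimes>\<^bsub>S\<^esub> b) m))"
    unfolding fun_cong[OF Suc, symmetric] by (rule mult_add_left) (use assms in \<open>auto intro!: finsum_closed\<close>)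
  also have "\<dots> = (\<lambda>m. \<Oplus>j\<in>{..<Suc N}. (f j \<otimes>\<^bsub>S\<^esub> b) m)"
    using assms mult_approx(1) by (simp add: finsum_lessThan_Suc)
  finally show ?case .
qed

text \<open>Modulo the \<open>N\<close>-th term of the filtration, \<open>a (b c)\<close> is the sum of the
\<open>a\<^sub>j x\<^sup>j (b c) = (a\<^sub>j x\<^sup>j b) c\<close> with \<open>j < N\<close>, which is the product of \<open>c\<close> with an approximation of
\<open>a b\<close>.\<close>

lemma mult_assoc:
  assumes "series a" "series b" "series c"
  shows "(a \<otimes>\<^bsub>S\<^esub> b) \<otimes>\<^bsub>S\<^esub> c = a \<otimes>\<^bsub>S\<^esub> (b \<otimes>\<^bsub>S\<^esub> c)"
proof (rule mult_eqI)
  note cl = mult_approx(1)[OF assms(1,2)] mult_approx(1)[OF assms(2,3)]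
  show "series (a \<otimes>\<^bsub>S\<^esub> b \<otimes>\<^bsub>S\<^esub> c)" using mult_approx(1)[OF cl(1) assms(3)] .
  have "partial_mult N a b \<otimes>\<^bsub>S\<^esub> c = partial_mult N a (b \<otimes>\<^bsub>S\<^esub> c)" for N
  proof -
    have "partial_mult N a b \<otimes>\<^bsub>S\<^esub> c = (\<lambda>m. \<Oplus>j\<in>{..<N}. scale (a j) (x_pow j b) m) \<otimes>\<^bsub>S\<^esub> c"
      unfolding partial_mult_def scale_def ..
    also have "\<dots> = (\<lambda>m. \<Oplus>j\<in>{..<N}. (scale (a j) (x_pow j b) \<otimes>\<^bsub>S\<^esub> c) m)"
      by (rule mult_finsum_left) (use assms in auto)
    also have "\<dots> = (\<lambda>m. \<Oplus>j\<in>{..<N}. scale (a j) (x_pow j (b \<otimes>\<^bsub>S\<^esub> c)) m)"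
      using assms by (simp add: mult_scale x_pow_mult)
    finally show ?thesis unfolding partial_mult_def scale_def .
  qed
  then show "cong_mod N (a \<otimes>\<^bsub>S\<^esub> b \<otimes>\<^bsub>S\<^esub> c) (partial_mult N a (b \<otimes>\<^bsub>S\<^esub> c))" for N
    using mult_cong_left[OF mult_approx(2)[OF assms(1,2)] cl(1) _ assms(3), of N] assms by simp
qed (use assms mult_approx(1) in auto)

definition const_series :: "'a \<Rightarrow> nat \<Rightarrow> 'a" where
  "const_series r m = (if m = 0 then r else \<zero>)"

lemma const_series_mult:
  assumes "r \<in> carrier R" "series b"
  shows "const_series r \<otimes>\<^bsub>S\<^esub> b = scale r b"
proof (rule mult_eqI[symmetric])
  show "cong_mod N (scale r b) (partial_mult N (const_series r) b)" for N
    unfolding cong_mod_def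
  proof
    fix m
    show "scale r b m \<ominus> partial_mult N (const_series r) b m \<in> F (N - m)"
    proof (cases N)
      case 0
      then show ?thesis using assms by (simp add: partial_mult_def)
    next
      case (Suc n)
      have "partial_mult N (const_series r) b m = const_series r 0 \<otimes> x_pow 0 b m"
        unfolding partial_mult_def by (rule finsum_delta) (use assms Suc in \<open>auto simp: const_series_def\<close>)
      then show ?thesis using assms by (simp add: F_diff_self scale_def const_series_def)
    qed
  qed
qed (use assms in \<open>auto simp: const_series_def\<close>)

lemma mult_one_right:
  assumes "series a"
  shows "a \<otimes>\<^bsub>S\<^esub> \<one>\<^bsub>S\<^esub> = a"
proof (rule mult_eqI[symmetric])
  show "cong_mod N a (partial_mult N a \<one>\<^bsub>S\<^esub>)" for N
    unfolding cong_mod_def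
  proof
    fix m
    show "a m \<ominus> partial_mult N a \<one>\<^bsub>S\<^esub> m \<in> F (N - m)"
    proof (cases "m < N")
      case False
      then have "partial_mult N a \<one>\<^bsub>S\<^esub> m \<in> carrier R"
        using assms by (intro partial_mult_closed) (auto simp: S_simps)
      then show ?thesis using False assms by simp
    next
      case True
      have "partial_mult N a \<one>\<^bsub>S\<^esub> m = a m \<otimes> x_pow m \<one>\<^bsub>S\<^esub> m"
        unfolding partial_mult_def by (rule finsum_delta) (use assms True in \<open>auto simp: S_simps x_pow_one\<close>)
      then show ?thesis using assms by (simp add: S_simps x_pow_one F_diff_self)
    qed
  qed
qed (use assms in \<open>auto simp: S_simps\<close>)

lemma S_ring: "ring S"
proof (rule ringI)
  show "abelian_group S"
  proof (rule abelian_groupI)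
    fix a assume "a \<in> carrier S"
    then have "(\<lambda>m. \<ominus> a m) \<in> carrier S" "(\<lambda>m. \<ominus> a m) \<oplus>\<^bsub>S\<^esub> a = \<zero>\<^bsub>S\<^esub>"
      unfolding S_carrier by (simp_all add: S_simps l_neg)
    then show "\<exists>b\<in>carrier S. b \<oplus>\<^bsub>S\<^esub> a = \<zero>\<^bsub>S\<^esub>" by blast
  qed (unfold S_carrier, simp_all add: S_simps a_ac)
  show "monoid S"
  proof (rule monoidI)
    have one: "\<one>\<^bsub>S\<^esub> = const_series \<one>" by (simp add: S_simps const_series_def fun_eq_iff)
    show "\<one>\<^bsub>S\<^esub> \<otimes>\<^bsub>S\<^esub> a = a" if "a \<in> carrier S" for a
      using that unfolding S_carrier one by (simp add: const_series_mult) (simp add: scale_def fun_eq_iff)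
  qed (unfold S_carrier, simp_all add: mult_approx(1) mult_assoc mult_one_right, simp add: S_simps)
qed (unfold S_carrier S_simps(4), simp_all add: mult_add_left mult_add_right)

lemma S_minus:
  assumes "series a" "series b"
  shows "(a \<ominus>\<^bsub>S\<^esub> b) m = a m \<ominus> b m"
proof -
  interpret S: ring S by (rule S_ring)
  have "\<ominus>\<^bsub>S\<^esub> b = (\<lambda>m. \<ominus> b m)"
    using assms by (intro S.minus_equality) (unfold S_carrier, simp_all add: S_simps l_neg)
  then show ?thesis by (simp add: S.minus_eq S_simps minus_eq)
qed

definition S_filtration :: "nat \<Rightarrow> (nat \<Rightarrow> 'a) set" where
  "S_filtration k = {a. \<forall>m. a m \<in> F (k - m)}"

text \<open>The \<open>m\<close>-th coefficients of a sequence converge only from index \<open>m\<close> on at the required rate, so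
their limits are taken along the sequence shifted by \<open>m\<close>.\<close>

lemma S_complete_filtered: "complete_filtered_ring S S_filtration"
proof -
  interpret S: ring S by (rule S_ring)
  have ser: "series a" if "a \<in> S_filtration k" for a k
    using that F_carrier unfolding S_filtration_def by blast
  show ?thesis
  proof unfold_locales
    show "S_filtration 0 = carrier S" by (auto simp: S_filtration_def S_simps)
    show "\<zero>\<^bsub>S\<^esub> \<in> S_filtration k" for k by (simp add: S_filtration_def S_simps F_zero)
    show "a \<ominus>\<^bsub>S\<^esub> b \<in> S_filtration k" if "a \<in> S_filtration k" "b \<in> S_filtration k" for a b k
      using that S_minus[OF ser ser, OF that] by (simp add: S_filtration_def F_diff)
    show "S_filtration (Suc k) \<subseteq> S_filtration k" for k
    proof
      fix a assume a: "a \<in> S_filtration (Suc k)"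
      have "F (Suc k - m) \<subseteq> F (k - m)" for m by (rule F_antimono) simp
      then show "a \<in> S_filtration k" using a unfolding S_filtration_def by blast
    qed
    show "a \<otimes>\<^bsub>S\<^esub> b \<in> S_filtration (i + j)" if a: "a \<in> S_filtration i" and b: "b \<in> S_filtration j"
      for a b i j
      unfolding S_filtration_def
    proof (intro CollectI allI)
      fix m
      let ?p = "partial_mult (i + j) a b m"
      have p: "?p \<in> F (i + j - m)"
        using a b unfolding S_filtration_def by (intro partial_mult_filtration) auto
      have "(a \<otimes>\<^bsub>S\<^esub> b) m \<ominus> ?p \<in> F (i + j - m)"
        using mult_approx(2)[OF ser[OF a] ser[OF b], of "i + j"] by (simp add: cong_mod_def)
      from F_add[OF this p] show "(a \<otimes>\<^bsub>S\<^esub> b) m \<in> F (i + j - m)"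
        using mult_approx(1)[OF ser[OF a] ser[OF b]] F_carrier[OF p]
        by (simp add: minus_eq a_assoc l_neg)
    qed
    show "a = \<zero>\<^bsub>S\<^esub>" if a: "\<And>k. a \<in> S_filtration k" for a
    proof (rule cong_mod_eqI)
      show "cong_mod N a \<zero>\<^bsub>S\<^esub>" for N
        using a[of N] ser[OF a[of 0]] by (simp add: cong_mod_def S_simps S_filtration_def minus_eq)
    qed (use ser[OF a] in \<open>simp_all add: S_simps\<close>)
    fix f assume f: "\<And>k. f k \<in> carrier S" and ff: "\<And>k. f (Suc k) \<ominus>\<^bsub>S\<^esub> f k \<in> S_filtration k"
    have fR [simp]: "f k m \<in> carrier R" for k m using f[of k] unfolding S_carrier by blast
    have ff': "f (Suc k) m \<ominus> f k m \<in> F (k - m)" for k m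
      using ff[of k] S_minus[of "f (Suc k)" "f k"] by (simp add: S_filtration_def)
    have "f (Suc k + m) m \<ominus> f (k + m) m \<in> F k" for k m
      using ff'[of "k + m" m] by simp
    then have "\<exists>s\<in>carrier R. \<forall>k. s \<ominus> f (k + m) m \<in> F k" for m
      using F_complete[of "\<lambda>k. f (k + m) m"] by simp
    then obtain s where s: "\<And>m. s m \<in> carrier R" "\<And>m k. s m \<ominus> f (k + m) m \<in> F k" by metis
    have "s m \<ominus> f k m \<in> F (k - m)" for m k
    proof (cases "m \<le> k")
      case True
      then show ?thesis using s(2)[of m "k - m"] by simp
    next
      case False
      then show ?thesis using s(1) by simp
    qed
    then have "s \<ominus>\<^bsub>S\<^esub> f k \<in> S_filtration k" for k
      using S_minus[of s "f k"] s(1) by (simp add: S_filtration_def)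
    then show "\<exists>s\<in>carrier S. \<forall>k. s \<ominus>\<^bsub>S\<^esub> f k \<in> S_filtration k"
      using s(1) S_carrier by blast
  qed
qed

lemma const_series_hom: "const_series \<in> ring_hom R S"
proof (rule ring_hom_memI)
  show "const_series r \<in> carrier S" if "r \<in> carrier R" for r
    using that by (auto simp: S_simps const_series_def)
  show "const_series \<one> = \<one>\<^bsub>S\<^esub>" by (auto simp: S_simps const_series_def)
  fix r r' assume r: "r \<in> carrier R" "r' \<in> carrier R"
  show "const_series (r \<otimes> r') = const_series r \<otimes>\<^bsub>S\<^esub> const_series r'"
    using r by (subst const_series_mult) (auto simp: const_series_def scale_def)
  show "const_series (r \<oplus> r') = const_series r \<oplus>\<^bsub>S\<^esub> const_series r'"
    using r by (auto simp: S_simps const_series_def)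
qed

lemma const_series_filtration: "const_series r \<in> S_filtration k \<longleftrightarrow> r \<in> F k"
  using F_zero by (auto simp: S_filtration_def const_series_def)

text \<open>The first term of the filtration consists of the series with constant coefficient in \<open>J\<close>.\<close>

lemma const_series_approx:
  "series a \<Longrightarrow> const_series (a 0) \<ominus>\<^bsub>S\<^esub> a \<in> S_filtration 1"
  using S_minus[of "const_series (a 0)" a]
  by (auto simp: S_filtration_def const_series_def F_diff_self split: nat_diff_split)

end

text \<open>On a product \<open>x y\<close> with \<open>x \<in> J\<^sup>k\<close> and \<open>y \<in> J\<close> one has \<open>\<delta>(x y) = \<sigma>(x) \<delta>(y) + \<delta>(x) y\<close>, where
\<open>\<sigma>(x) \<delta>(y) \<in> J\<^sup>k J\<^sup>2\<close> and, inductively, \<open>\<delta>(x) y \<in> J\<^sup>k\<^sup>+\<^sup>1 J\<close>.\<close>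

lemma skew_seriesI:
  fixes R :: "('a, 'b) ring_scheme" (structure)
  assumes R: "ring R" and complete: "adically_complete R (jacobson_radical R)"
    and \<sigma>: "\<sigma> \<in> ring_hom R R" and \<sigma>J: "\<sigma> ` jacobson_radical R \<subseteq> jacobson_radical R"
    and \<delta>: "sigma_derivation R \<sigma> \<delta>"
    and \<delta>R: "\<delta> ` carrier R \<subseteq> jacobson_radical R"
    and \<delta>J: "\<delta> ` jacobson_radical R \<subseteq> ideal_power R (jacobson_radical R) 2"
  shows "skew_series R \<sigma> \<delta>"
proof -
  interpret ring R by (rule R)
  let ?J = "jacobson_radical R" and ?F = "ideal_power R (jacobson_radical R)"
  interpret complete_filtered_ring R ?F
    by (rule ideal_power_complete_filtered[OF jacobson_radical_ideal complete])
  have F_Suc_eq: "?F (Suc k) = ideal_prod R (?F k) ?J" for k by (rule ideal_power.simps(2))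
  have J: "?F 1 = ?J" using ideal_power_1[OF jacobson_radical_ideal] by simp
  have \<delta>_add: "\<delta> (a \<oplus> b) = \<delta> a \<oplus> \<delta> b" and \<delta>_mult: "\<delta> (a \<otimes> b) = \<sigma> a \<otimes> \<delta> b \<oplus> \<delta> a \<otimes> b"
    if "a \<in> carrier R" "b \<in> carrier R" for a b
    using \<delta> that unfolding sigma_derivation_def by blast+
  have \<sigma>F: "\<sigma> a \<in> ?F k" if "a \<in> ?F k" for a k
    using that
  proof (induction k arbitrary: a)
    case 0
    then show ?case using ring_hom_closed[OF \<sigma>] by simp
  next
    case (Suc k)
    from Suc.prems have "a \<in> ideal_prod R (?F k) ?J" by (simp only: F_Suc_eq)
    then have "a \<in> carrier R \<and> \<sigma> a \<in> ?F (Suc k)"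
    proof (induction a rule: ideal_prod.induct)
      case (prod x y)
      then have "x \<in> carrier R" "y \<in> carrier R" using F_carrier J by blast+
      moreover have "\<sigma> x \<otimes> \<sigma> y \<in> ?F (Suc k)"
        unfolding F_Suc_eq using prod Suc.IH \<sigma>J by (intro ideal_prod.prod) auto
      ultimately show ?case using ring_hom_mult[OF \<sigma>] by simp
    next
      case (sum x y)
      then show ?case using F_add[of "\<sigma> x" "Suc k" "\<sigma> y"] ring_hom_add[OF \<sigma>, of x y]
        by simp
    qed
    then show ?case ..
  qed
  have \<delta>F: "\<delta> a \<in> ?F (Suc k)" if "a \<in> ?F k" for a k
    using that
  proof (induction k arbitrary: a)
    case 0
    then have "\<delta> a \<in> ?F 1" unfolding J using \<delta>R by auto
    then show ?case by simp
  next
    case (Suc k)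
    from Suc.prems have "a \<in> ideal_prod R (?F k) ?J" by (simp only: F_Suc_eq)
    then have "a \<in> carrier R \<and> \<delta> a \<in> ?F (Suc (Suc k))"
    proof (induction a rule: ideal_prod.induct)
      case (prod x y)
      then have xy: "x \<in> carrier R" "y \<in> carrier R" using F_carrier J by blast+
      have y: "y \<in> ?F 1" unfolding J by (rule prod)
      have \<delta>y: "\<delta> y \<in> ?F 2" using \<delta>J prod by blast
      have "\<sigma> x \<otimes> \<delta> y \<in> ?F (Suc (Suc k))"
        using F_mult[OF \<sigma>F[OF prod(1)] \<delta>y] by (simp only: add_2_eq_Suc')
      moreover have "\<delta> x \<otimes> y \<in> ?F (Suc (Suc k))"
        using F_mult[OF Suc.IH[OF prod(1)] y] by (simp only: Suc_eq_plus1)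
      ultimately show ?case using xy F_add \<delta>_mult by simp
    next
      case (sum x y)
      then show ?case using F_add[of "\<delta> x" "Suc (Suc k)" "\<delta> y"] \<delta>_add[of x y]
        by simp
    qed
    then show ?case ..
  qed
  show ?thesis
    by unfold_locales (use \<sigma> \<delta>_add \<delta>_mult \<sigma>F \<delta>F in \<open>simp_all\<close>)
qed

section \<open>Modules and matrices\<close>

definition unit_vec :: "('a, 'c) ring_scheme \<Rightarrow> nat \<Rightarrow> nat \<Rightarrow> nat \<Rightarrow> 'a" where
  "unit_vec R n i = (\<lambda>j\<in>{..<n}. if j = i then \<one>\<^bsub>R\<^esub> else \<zero>\<^bsub>R\<^esub>)"

text \<open>Homomorphisms of left modules act on row vectors by right multiplication. The elements of a free
module are undefined outside the index set, hence the restriction.\<close>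

definition vec_mat ::
    "('a, 'c) ring_scheme \<Rightarrow> nat \<Rightarrow> nat \<Rightarrow> (nat \<Rightarrow> 'a) \<Rightarrow> (nat \<Rightarrow> nat \<Rightarrow> 'a) \<Rightarrow> nat \<Rightarrow> 'a" where
  "vec_mat R m n u A = (\<lambda>j\<in>{..<n}. \<Oplus>\<^bsub>R\<^esub>i\<in>{..<m}. u i \<otimes>\<^bsub>R\<^esub> A i j)"

text \<open>The matrix of a homomorphism: its rows are the images of the unit vectors.\<close>

definition hom_mat ::
    "('a, 'c) ring_scheme \<Rightarrow> nat \<Rightarrow> nat \<Rightarrow> ((nat \<Rightarrow> 'a) \<Rightarrow> nat \<Rightarrow> 'a) \<Rightarrow> nat \<Rightarrow> nat \<Rightarrow> 'a" where
  "hom_mat R m n \<phi> = (\<lambda>i j. if i < m \<and> j < n then \<phi> (unit_vec R m i) j else \<zero>\<^bsub>R\<^esub>)"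

lemma free_rank_simps:
  "carrier (free_lmod_rank R n) = {..<n} \<rightarrow>\<^sub>E carrier R"
  "\<zero>\<^bsub>free_lmod_rank R n\<^esub> = (\<lambda>i\<in>{..<n}. \<zero>\<^bsub>R\<^esub>)"
  "u \<oplus>\<^bsub>free_lmod_rank R n\<^esub> v = (\<lambda>i\<in>{..<n}. u i \<oplus>\<^bsub>R\<^esub> v i)"
  "a \<odot>\<^bsub>free_lmod_rank R n\<^esub> u = (\<lambda>i\<in>{..<n}. a \<otimes>\<^bsub>R\<^esub> u i)"
  by (simp_all add: free_lmod_def)

lemma free_rank_eqI:
  assumes "u \<in> carrier (free_lmod_rank R n)" "v \<in> carrier (free_lmod_rank R n)"
    "\<And>i. i < n \<Longrightarrow> u i = v i"
  shows "u = v"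
  using assms by (auto simp: free_rank_simps intro: PiE_ext)

lemma free_rank_nth: "\<lbrakk> u \<in> carrier (free_lmod_rank R n); i < n \<rbrakk> \<Longrightarrow> u i \<in> carrier R"
  by (auto simp: free_rank_simps)

lemma lmod_homI:
  assumes "\<And>x. x \<in> carrier M \<Longrightarrow> h x \<in> carrier N"
    "\<And>x y. \<lbrakk> x \<in> carrier M; y \<in> carrier M \<rbrakk> \<Longrightarrow> h (x \<oplus>\<^bsub>M\<^esub> y) = h x \<oplus>\<^bsub>N\<^esub> h y"
    "\<And>a x. \<lbrakk> a \<in> carrier R; x \<in> carrier M \<rbrakk> \<Longrightarrow> h (a \<odot>\<^bsub>M\<^esub> x) = a \<odot>\<^bsub>N\<^esub> h x"
  shows "h \<in> lmod_hom R M N"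
  using assms by (auto simp: lmod_hom_def)

lemma lmod_homD:
  assumes "h \<in> lmod_hom R M N"
  shows "x \<in> carrier M \<Longrightarrow> h x \<in> carrier N"
    "\<lbrakk> x \<in> carrier M; y \<in> carrier M \<rbrakk> \<Longrightarrow> h (x \<oplus>\<^bsub>M\<^esub> y) = h x \<oplus>\<^bsub>N\<^esub> h y"
    "\<lbrakk> a \<in> carrier R; x \<in> carrier M \<rbrakk> \<Longrightarrow> h (a \<odot>\<^bsub>M\<^esub> x) = a \<odot>\<^bsub>N\<^esub> h x"
  using assms unfolding lmod_hom_def by blast+

lemma lmod_hom_comp:
  assumes f: "f \<in> lmod_hom R L M" and g: "g \<in> lmod_hom R M N"
  shows "(\<lambda>x. g (f x)) \<in> lmod_hom R L N"
  by (rule lmod_homI) (simp_all add: lmod_homD[OF f] lmod_homD[OF g])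

lemma lmod_hom_inv_into:
  assumes M: "left_module R M" and h: "h \<in> lmod_hom R M N"
    and bij: "bij_betw h (carrier M) (carrier N)"
  shows "inv_into (carrier M) h \<in> lmod_hom R N M"
proof -
  interpret M: left_module R M by fact
  let ?k = "inv_into (carrier M) h"
  have k: "?k x \<in> carrier M" "h (?k x) = x" if "x \<in> carrier N" for x
    using bij that by (auto simp: bij_betw_def inv_into_into f_inv_into_f)
  have kh: "?k (h x) = x" if "x \<in> carrier M" for x
    using bij that by (simp add: bij_betw_def)
  show ?thesis
  proof (rule lmod_homI)
    fix x y assume "x \<in> carrier N" "y \<in> carrier N"
    then show "?k (x \<oplus>\<^bsub>N\<^esub> y) = ?k x \<oplus>\<^bsub>M\<^esub> ?k y"
      using lmod_homD(2)[OF h, of "?k x" "?k y"] kh[of "?k x \<oplus>\<^bsub>M\<^esub> ?k y"] k by simp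
  next
    fix a x assume "a \<in> carrier R" "x \<in> carrier N"
    then show "?k (a \<odot>\<^bsub>N\<^esub> x) = a \<odot>\<^bsub>M\<^esub> ?k x"
      using lmod_homD(3)[OF h, of a "?k x"] kh[of "a \<odot>\<^bsub>M\<^esub> ?k x"] k by simp
  qed (rule k)
qed

context ring
begin

abbreviation Fr :: "nat \<Rightarrow> ('a, nat \<Rightarrow> 'a) module" where
  "Fr n \<equiv> free_lmod_rank R n"

lemma Fr_left_module: "left_module R (Fr n)"
  by (rule free_lmod_left_module) (rule ring_axioms)

lemma unit_vec_closed [simp]: "unit_vec R n i \<in> carrier (Fr n)"
  by (auto simp: free_rank_simps unit_vec_def)

text \<open>The coordinates of \<open>u\<close> are filled in one after the other. This replaces sums inside arbitrary
modules by single additions.\<close>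

lemma Fr_induct [consumes 1, case_names zero step]:
  assumes u: "u \<in> carrier (Fr m)"
    and zero: "P \<zero>\<^bsub>Fr m\<^esub>"
    and step: "\<And>v a i. \<lbrakk> v \<in> carrier (Fr m); a \<in> carrier R; i < m; P v \<rbrakk> \<Longrightarrow>
      P (v \<oplus>\<^bsub>Fr m\<^esub> a \<odot>\<^bsub>Fr m\<^esub> unit_vec R m i)"
  shows "P u"
proof -
  \<comment> \<open>The first \<open>k\<close> coordinates of \<open>u\<close>.\<close>
  define v where "v = (\<lambda>k. \<lambda>i\<in>{..<m}. if i < k then u i else \<zero>)"
  have uc: "u i \<in> carrier R" if "i < m" for i by (rule free_rank_nth[OF u that])
  have vc: "v k \<in> carrier (Fr m)" for k by (auto simp: v_def free_rank_simps uc)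
  have "P (v k)" if "k \<le> m" for k
    using that
  proof (induction k)
    case 0
    have "v 0 = \<zero>\<^bsub>Fr m\<^esub>" by (simp add: v_def free_rank_simps)
    then show ?case using zero by simp
  next
    case (Suc k)
    interpret F: left_module R "Fr m" by (rule Fr_left_module)
    have k: "k < m" using Suc.prems by simp
    have "v (Suc k) = v k \<oplus>\<^bsub>Fr m\<^esub> u k \<odot>\<^bsub>Fr m\<^esub> unit_vec R m k"
    proof (rule free_rank_eqI[OF vc F.M.a_closed[OF vc F.smult_closed[OF uc[OF k] unit_vec_closed]]])
      fix i assume "i < m"
      then show "v (Suc k) i = (v k \<oplus>\<^bsub>Fr m\<^esub> u k \<odot>\<^bsub>Fr m\<^esub> unit_vec R m k) i"
        using uc[of i] uc[OF k] by (auto simp: v_def free_rank_simps unit_vec_def less_Suc_eq)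
    qed
    then show ?case using step[OF vc uc[OF k] k Suc.IH] Suc.prems by simp
  qed
  moreover have "v m = u"
    by (rule free_rank_eqI[OF vc u]) (simp add: v_def)
  ultimately show ?thesis by force
qed

lemma Fr_hom_eqI:
  assumes N: "left_module R N"
    and \<phi>: "\<phi> \<in> lmod_hom R (Fr m) N" and \<psi>: "\<psi> \<in> lmod_hom R (Fr m) N"
    and eq: "\<And>i. i < m \<Longrightarrow> \<phi> (unit_vec R m i) = \<psi> (unit_vec R m i)"
    and u: "u \<in> carrier (Fr m)"
  shows "\<phi> u = \<psi> u"
  using u
proof (induction rule: Fr_induct)
  case zero
  show ?case
    by (simp add: lmod_hom_zero[OF Fr_left_module N \<phi>] lmod_hom_zero[OF Fr_left_module N \<psi>])
next
  case (step v a i)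
  interpret F: left_module R "Fr m" by (rule Fr_left_module)
  show ?case using step by (simp add: lmod_homD[OF \<phi>] lmod_homD[OF \<psi>] eq)
qed

lemma vec_mat_closed:
  assumes "u \<in> carrier (Fr m)" "A \<in> mats R m n"
  shows "vec_mat R m n u A \<in> carrier (Fr n)"
  using free_rank_nth[OF assms(1)] mats_closed[OF assms(2)]
  by (auto simp: vec_mat_def free_rank_simps intro!: finsum_closed)

lemma vec_mat_hom:
  assumes A: "A \<in> mats R m n"
  shows "(\<lambda>u. vec_mat R m n u A) \<in> lmod_hom R (Fr m) (Fr n)"
proof (rule lmod_homI)
  note [simp] = mats_closed[OF A]
  show "vec_mat R m n u A \<in> carrier (Fr n)" if "u \<in> carrier (Fr m)" for u
    by (rule vec_mat_closed[OF that A])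
  fix u v assume u: "u \<in> carrier (Fr m)" and v: "v \<in> carrier (Fr m)"
  have "(\<Oplus>i\<in>{..<m}. (u i \<oplus> v i) \<otimes> A i j) = (\<Oplus>i\<in>{..<m}. u i \<otimes> A i j) \<oplus> (\<Oplus>i\<in>{..<m}. v i \<otimes> A i j)" for j
    using free_rank_nth[OF u] free_rank_nth[OF v]
    by (intro finsum_addI) (auto simp: l_distr)
  moreover have "(\<Oplus>i\<in>{..<m}. (\<lambda>i\<in>{..<m}. u i \<oplus> v i) i \<otimes> A i j) =
      (\<Oplus>i\<in>{..<m}. (u i \<oplus> v i) \<otimes> A i j)" for j
    using free_rank_nth[OF u] free_rank_nth[OF v] by (intro finsum_cong') auto
  ultimately show "vec_mat R m n (u \<oplus>\<^bsub>Fr m\<^esub> v) A = vec_mat R m n u A \<oplus>\<^bsub>Fr n\<^esub> vec_mat R m n v A"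
    by (auto simp: vec_mat_def free_rank_simps fun_eq_iff)
next
  note [simp] = mats_closed[OF A]
  fix a u assume a: "a \<in> carrier R" and u: "u \<in> carrier (Fr m)"
  have "(\<Oplus>i\<in>{..<m}. (\<lambda>i\<in>{..<m}. a \<otimes> u i) i \<otimes> A i j) = a \<otimes> (\<Oplus>i\<in>{..<m}. u i \<otimes> A i j)" for j
    using free_rank_nth[OF u] a by (subst finsum_rdistr) (auto simp: m_assoc intro!: finsum_cong')
  then show "vec_mat R m n (a \<odot>\<^bsub>Fr m\<^esub> u) A = a \<odot>\<^bsub>Fr n\<^esub> vec_mat R m n u A"
    by (auto simp: vec_mat_def free_rank_simps fun_eq_iff)
qed

lemma unit_vec_mat:
  assumes A: "A \<in> mats R m n" and i: "i < m" and j: "j < n"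
  shows "vec_mat R m n (unit_vec R m i) A j = A i j"
proof -
  have "(\<Oplus>l\<in>{..<m}. unit_vec R m i l \<otimes> A l j) = unit_vec R m i i \<otimes> A i j"
    by (rule finsum_delta) (use i mats_closed[OF A] in \<open>auto simp: unit_vec_def\<close>)
  then show ?thesis using i j mats_closed[OF A] by (simp add: vec_mat_def unit_vec_def)
qed

lemma mat_eqI:
  assumes A: "A \<in> mats R m n" and B: "B \<in> mats R m n"
    and eq: "\<And>u. u \<in> carrier (Fr m) \<Longrightarrow> vec_mat R m n u A = vec_mat R m n u B"
  shows "A = B"
proof (intro ext)
  fix i j
  show "A i j = B i j"
  proof (cases "i < m \<and> j < n")
    case True
    then show ?thesis
      using unit_vec_mat[OF A, of i j] unit_vec_mat[OF B, of i j] eq[of "unit_vec R m i"] by simp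
  next
    case False
    then show ?thesis using mats_outside[OF A, of i j] mats_outside[OF B, of i j] by auto
  qed
qed

lemma hom_mat_closed:
  assumes "\<phi> \<in> lmod_hom R (Fr m) (Fr n)"
  shows "hom_mat R m n \<phi> \<in> mats R m n"
  using free_rank_nth[OF lmod_homD(1)[OF assms unit_vec_closed]]
  by (intro matsI) (auto simp: hom_mat_def)

lemma hom_mat:
  assumes \<phi>: "\<phi> \<in> lmod_hom R (Fr m) (Fr n)" and u: "u \<in> carrier (Fr m)"
  shows "vec_mat R m n u (hom_mat R m n \<phi>) = \<phi> u"
proof (rule Fr_hom_eqI[OF Fr_left_module vec_mat_hom[OF hom_mat_closed[OF \<phi>]] \<phi> _ u])
  fix i assume i: "i < m"
  show "vec_mat R m n (unit_vec R m i) (hom_mat R m n \<phi>) = \<phi> (unit_vec R m i)"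
    by (rule free_rank_eqI[OF vec_mat_closed[OF unit_vec_closed hom_mat_closed[OF \<phi>]]
          lmod_homD(1)[OF \<phi> unit_vec_closed]])
      (simp add: unit_vec_mat[OF hom_mat_closed[OF \<phi>] i], simp add: hom_mat_def i)
qed

lemma vec_mat_one: "u \<in> carrier (Fr n) \<Longrightarrow> vec_mat R n n u (mat_one R n) = u"
proof (rule free_rank_eqI[OF vec_mat_closed[OF _ mat_one_closed]])
  fix j assume u: "u \<in> carrier (Fr n)" and j: "j < n"
  have "(\<Oplus>i\<in>{..<n}. u i \<otimes> mat_one R n i j) = u j \<otimes> mat_one R n j j"
    by (rule finsum_delta) (use j free_rank_nth[OF u] in \<open>auto simp: mat_one_def\<close>)
  then show "vec_mat R n n u (mat_one R n) j = u j"
    using j free_rank_nth[OF u j] by (simp add: vec_mat_def mat_one_def)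
qed

lemma vec_mat_zero: "u \<in> carrier (Fr m) \<Longrightarrow> vec_mat R m n u (mat_zero R) = \<zero>\<^bsub>Fr n\<^esub>"
  using free_rank_nth[of u R m]
  by (auto simp: vec_mat_def mat_zero_def free_rank_simps fun_eq_iff intro!: add.finprod_one_eqI)

lemma vec_mat_add:
  assumes u: "u \<in> carrier (Fr m)" and A: "A \<in> mats R m n" and B: "B \<in> mats R m n"
  shows "vec_mat R m n u (mat_add R A B) = vec_mat R m n u A \<oplus>\<^bsub>Fr n\<^esub> vec_mat R m n u B"
proof -
  note [simp] = mats_closed[OF A] mats_closed[OF B]
  have "(\<Oplus>i\<in>{..<m}. u i \<otimes> (A i j \<oplus> B i j)) = (\<Oplus>i\<in>{..<m}. u i \<otimes> A i j) \<oplus> (\<Oplus>i\<in>{..<m}. u i \<otimes> B i j)" for j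
    using free_rank_nth[OF u]
    by (intro finsum_addI) (auto simp: r_distr)
  then show ?thesis by (auto simp: vec_mat_def mat_add_def free_rank_simps fun_eq_iff)
qed

lemma vec_mat_mult:
  assumes u: "u \<in> carrier (Fr m)" and A: "A \<in> mats R m k" and B: "B \<in> mats R k n"
  shows "vec_mat R m n u (mat_mult R k A B) = vec_mat R k n (vec_mat R m k u A) B"
proof (rule Fr_hom_eqI[OF Fr_left_module vec_mat_hom[OF mat_mult_closed[OF A B]]
      lmod_hom_comp[OF vec_mat_hom[OF A] vec_mat_hom[OF B]] _ u])
  fix i assume i: "i < m"
  show "vec_mat R m n (unit_vec R m i) (mat_mult R k A B) =
      vec_mat R k n (vec_mat R m k (unit_vec R m i) A) B"
  proof (rule free_rank_eqI[OF vec_mat_closed[OF unit_vec_closed mat_mult_closed[OF A B]]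
        vec_mat_closed[OF vec_mat_closed[OF unit_vec_closed A] B]])
    fix j assume j: "j < n"
    have "vec_mat R k n (vec_mat R m k (unit_vec R m i) A) B j = mat_mult R k A B i j"
      using j mats_closed[OF A] mats_closed[OF B]
      by (auto simp: vec_mat_def[of R k] mat_mult_def unit_vec_mat[OF A i] intro!: finsum_cong')
    then show "vec_mat R m n (unit_vec R m i) (mat_mult R k A B) j =
        vec_mat R k n (vec_mat R m k (unit_vec R m i) A) B j"
      by (simp add: unit_vec_mat[OF mat_mult_closed[OF A B] i j])
  qed
qed

text \<open>The identity of \<open>P\<close> is lifted along the surjection from a free module that the generators define.\<close>

lemma fin_gen_projective_retract:
  assumes "fin_gen_lmod R P" "projective_lmod R P"
  shows "\<exists>n. \<exists>g\<in>lmod_hom R (Fr n) P. \<exists>h\<in>lmod_hom R P (Fr n). \<forall>x\<in>carrier P. g (h x) = x"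
proof -
  interpret P: left_module R P using assms(1) by (simp add: fin_gen_lmod_def)
  obtain A where A: "finite A" "A \<subseteq> carrier P"
    and gen: "\<And>x. x \<in> carrier P \<Longrightarrow> \<exists>c\<in>A \<rightarrow> carrier R. x = (\<Oplus>\<^bsub>P\<^esub>a\<in>A. c a \<odot>\<^bsub>P\<^esub> a)"
    using assms(1) unfolding fin_gen_lmod_def by blast
  obtain b where b: "bij_betw b {..<card A} A"
    using bij_betw_from_nat_into_finite[OF A(1)] by blast
  have bA: "b i \<in> A" if "i < card A" for i using bij_betwE[OF b] that by blast
  have bP: "b \<in> {..<card A} \<rightarrow> carrier P" using bA A(2) by blast
  let ?g = "free_lmod_map R {..<card A} P b"
  have g: "?g \<in> lmod_hom R (Fr (card A)) P" by (rule free_lmod_map_hom[OF P.left_module_axioms bP])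
  have surj: "?g ` carrier (Fr (card A)) = carrier P"
  proof
    show "?g ` carrier (Fr (card A)) \<subseteq> carrier P" using lmod_homD(1)[OF g] by blast
    show "carrier P \<subseteq> ?g ` carrier (Fr (card A))"
    proof
      fix x assume "x \<in> carrier P"
      then obtain c where c: "c \<in> A \<rightarrow> carrier R" and x: "x = (\<Oplus>\<^bsub>P\<^esub>a\<in>A. c a \<odot>\<^bsub>P\<^esub> a)"
        using gen by blast
      let ?u = "\<lambda>i\<in>{..<card A}. c (b i)"
      have u: "?u \<in> {..<card A} \<rightarrow> carrier R" using c bA by auto
      have uF: "?u \<in> carrier (Fr (card A))" using c bA by (auto simp: free_rank_simps)
      have cl: "(\<lambda>a. c a \<odot>\<^bsub>P\<^esub> a) \<in> A \<rightarrow> carrier P" using c A(2) by blast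
      have "x = (\<Oplus>\<^bsub>P\<^esub>a\<in>b ` {..<card A}. c a \<odot>\<^bsub>P\<^esub> a)"
        unfolding bij_betw_imp_surj_on[OF b] by (rule x)
      also have "\<dots> = (\<Oplus>\<^bsub>P\<^esub>i\<in>{..<card A}. c (b i) \<odot>\<^bsub>P\<^esub> b i)"
        by (rule P.M.finsum_reindex)
          (use cl bij_betw_imp_surj_on[OF b] bij_betw_imp_inj_on[OF b] in auto)
      also have "\<dots> = (\<Oplus>\<^bsub>P\<^esub>i\<in>{..<card A}. ?u i \<odot>\<^bsub>P\<^esub> b i)"
      proof (rule P.M.finsum_cong'[OF refl])
        show "(\<lambda>i. ?u i \<odot>\<^bsub>P\<^esub> b i) \<in> {..<card A} \<rightarrow> carrier P"
          using u bP by blast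
      qed simp
      also have "\<dots> = ?g ?u"
        by (rule free_lmod_map_superset[OF P.left_module_axioms bP u, symmetric]) auto
      finally show "x \<in> ?g ` carrier (Fr (card A))" using uF by blast
    qed
  qed
  have id: "(\<lambda>x. x) \<in> lmod_hom R P P" by (rule lmod_homI) simp_all
  have "\<exists>h\<in>lmod_hom R P (Fr (card A)). \<forall>x\<in>carrier P. ?g (h x) = x"
    by (rule projective_lmod_lift[OF assms(2) Fr_left_module P.left_module_axioms g id surj])
  then show ?thesis by (intro exI[of _ "card A"] bexI[of _ ?g] g)
qed

text \<open>Different unit vectors may have the same image, so coefficients cannot be read off from the
coordinates. Instead the linear combinations of the images contain zero and are closed under adding
multiples of the images.\<close>

lemma fin_gen_free_image:
  assumes P: "left_module R P" and g: "g \<in> lmod_hom R (Fr n) P"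
    and surj: "\<And>x. x \<in> carrier P \<Longrightarrow> \<exists>u\<in>carrier (Fr n). g u = x"
  shows "fin_gen_lmod R P"
proof -
  interpret P: left_module R P by (rule P)
  define A where "A = (\<lambda>i. g (unit_vec R n i)) ` {..<n}"
  have A: "finite A" "A \<subseteq> carrier P" using lmod_homD(1)[OF g] by (auto simp: A_def)
  have cl: "(\<lambda>a. c a \<odot>\<^bsub>P\<^esub> a) \<in> A \<rightarrow> carrier P" if "c \<in> A \<rightarrow> carrier R" for c
    using that A(2) by blast
  have "\<exists>c\<in>A \<rightarrow> carrier R. g u = (\<Oplus>\<^bsub>P\<^esub>a\<in>A. c a \<odot>\<^bsub>P\<^esub> a)" if u: "u \<in> carrier (Fr n)" for u
    using u
  proof (induction rule: Fr_induct)
    case zero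
    have "(\<Oplus>\<^bsub>P\<^esub>a\<in>A. \<zero> \<odot>\<^bsub>P\<^esub> a) = \<zero>\<^bsub>P\<^esub>"
      by (rule P.M.add.finprod_one_eqI) (use A(2) P.smult_l_null in blast)
    then show ?case using lmod_hom_zero[OF Fr_left_module P g] by force
  next
    case (step v a i)
    interpret F: left_module R "Fr n" by (rule Fr_left_module)
    obtain c where c: "c \<in> A \<rightarrow> carrier R" and v: "g v = (\<Oplus>\<^bsub>P\<^esub>a\<in>A. c a \<odot>\<^bsub>P\<^esub> a)"
      using step by blast
    define y where "y = g (unit_vec R n i)"
    have yA: "y \<in> A" using step(3) by (auto simp: A_def y_def)
    have yP: "y \<in> carrier P" using yA A(2) by blast
    let ?d = "\<lambda>x. if x = y then a else \<zero>"
    have d: "?d \<in> A \<rightarrow> carrier R" using step(2) by auto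
    have "(\<Oplus>\<^bsub>P\<^esub>x\<in>A. ?d x \<odot>\<^bsub>P\<^esub> x) = (\<Oplus>\<^bsub>P\<^esub>x\<in>{y}. ?d x \<odot>\<^bsub>P\<^esub> x)"
      by (rule P.M.add.finprod_mono_neutral_cong_right)
        (use A yA yP cl[OF d] step(2) P.smult_l_null in auto)
    then have dy: "(\<Oplus>\<^bsub>P\<^esub>x\<in>A. ?d x \<odot>\<^bsub>P\<^esub> x) = a \<odot>\<^bsub>P\<^esub> y" using yP step(2) by simp
    have "g (v \<oplus>\<^bsub>Fr n\<^esub> a \<odot>\<^bsub>Fr n\<^esub> unit_vec R n i) = g v \<oplus>\<^bsub>P\<^esub> a \<odot>\<^bsub>P\<^esub> y"
      using step by (simp add: lmod_homD[OF g] y_def)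
    also have "\<dots> = (\<Oplus>\<^bsub>P\<^esub>x\<in>A. c x \<odot>\<^bsub>P\<^esub> x \<oplus>\<^bsub>P\<^esub> ?d x \<odot>\<^bsub>P\<^esub> x)"
      unfolding v dy[symmetric] by (rule P.M.finsum_addf[symmetric, OF cl[OF c] cl[OF d]])
    also have "\<dots> = (\<Oplus>\<^bsub>P\<^esub>x\<in>A. (c x \<oplus> ?d x) \<odot>\<^bsub>P\<^esub> x)"
    proof (rule P.M.finsum_cong'[OF refl])
      show "(\<lambda>x. (c x \<oplus> ?d x) \<odot>\<^bsub>P\<^esub> x) \<in> A \<rightarrow> carrier P"
        by (rule cl) (use c d in auto)
      show "c x \<odot>\<^bsub>P\<^esub> x \<oplus>\<^bsub>P\<^esub> ?d x \<odot>\<^bsub>P\<^esub> x = (c x \<oplus> ?d x) \<odot>\<^bsub>P\<^esub> x" if "x \<in> A" for x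
        by (rule P.smult_l_distr[symmetric]) (use that c d A(2) step(2) in auto)
    qed
    finally show ?case using c d by (intro bexI[of _ "\<lambda>x. c x \<oplus> ?d x"]) auto
  qed
  then have "\<forall>x\<in>carrier P. \<exists>c\<in>A \<rightarrow> carrier R. x = (\<Oplus>\<^bsub>P\<^esub>a\<in>A. c a \<odot>\<^bsub>P\<^esub> a)"
    using surj by metis
  then show ?thesis unfolding fin_gen_lmod_def using A P by blast
qed

lemma free_map_unit_vec:
  assumes N: "left_module R N" and c: "c \<in> {..<n} \<rightarrow> carrier N" and i: "i < n"
  shows "free_lmod_map R {..<n} N c (unit_vec R n i) = c i"
proof -
  interpret N: left_module R N by (rule N)
  have ci: "c i \<in> carrier N" using c i by blast
  have "free_lmod_map R {..<n} N c (unit_vec R n i) = (\<Oplus>\<^bsub>N\<^esub>j\<in>{i}. unit_vec R n i j \<odot>\<^bsub>N\<^esub> c j)"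
    by (rule free_lmod_map_superset[OF N c]) (use i in \<open>auto simp: unit_vec_def\<close>)
  then show ?thesis using i ci by (simp add: unit_vec_def)
qed

lemma projective_free_retract:
  fixes P :: "('a, 'm) module"
  assumes P: "left_module R P" and g: "g \<in> lmod_hom R (Fr n) P" and h: "h \<in> lmod_hom R P (Fr n)"
    and gh: "\<And>x. x \<in> carrier P \<Longrightarrow> g (h x) = x"
  shows "projective_lmod R P"
  unfolding projective_lmod_def
proof (intro conjI allI impI ballI P)
  fix N :: "('a, 'm \<Rightarrow> 'a) module" and N' :: "('a, 'm) module" and p f
  assume NN': "left_module R N \<and> left_module R N'" and p: "p \<in> lmod_hom R N N'"
    and f: "f \<in> lmod_hom R P N'" and surj: "p ` carrier N = carrier N'"
  then have N: "left_module R N" and N': "left_module R N'" by simp_all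
  have fg: "(\<lambda>u. f (g u)) \<in> lmod_hom R (Fr n) N'" by (rule lmod_hom_comp[OF g f])
  have "\<exists>y\<in>carrier N. p y = f (g (unit_vec R n i))" for i
  proof -
    have "f (g (unit_vec R n i)) \<in> p ` carrier N"
      unfolding surj by (rule lmod_homD(1)[OF fg unit_vec_closed])
    then show ?thesis by auto
  qed
  then obtain c where c: "\<And>i. c i \<in> carrier N" "\<And>i. p (c i) = f (g (unit_vec R n i))" by metis
  have cN: "c \<in> {..<n} \<rightarrow> carrier N" using c by blast
  let ?q = "free_lmod_map R {..<n} N c"
  have q: "?q \<in> lmod_hom R (Fr n) N" by (rule free_lmod_map_hom[OF N cN])
  have "p (?q u) = f (g u)" if "u \<in> carrier (Fr n)" for u
    by (rule Fr_hom_eqI[OF N' lmod_hom_comp[OF q p] fg _ that])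
      (simp add: free_map_unit_vec[OF N cN] c)
  then have "\<forall>x\<in>carrier P. p (?q (h x)) = f x"
    using lmod_homD(1)[OF h] gh by simp
  then show "\<exists>k\<in>lmod_hom R P N. \<forall>x\<in>carrier P. p (k x) = f x"
    by (rule bexI[OF _ lmod_hom_comp[OF h q]])
qed

end

section \<open>Stably free modules and idempotent matrices\<close>

text \<open>The row space \<open>R\<^sup>n f\<close> of an idempotent matrix, described as the set of vectors fixed by \<open>f\<close>. Each
vector is wrapped in a singleton, which places the module in the type of elements over which the
property PSF of \<open>R\<close> ranges.\<close>

definition row_module ::
    "('a, 'c) ring_scheme \<Rightarrow> nat \<Rightarrow> (nat \<Rightarrow> nat \<Rightarrow> 'a) \<Rightarrow> ('a, (nat \<Rightarrow> 'a) set) module" where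
  "row_module R n f =
    \<lparr> carrier = {{u} | u. u \<in> carrier (free_lmod_rank R n) \<and> vec_mat R n n u f = u},
      monoid.mult = undefined, one = undefined,
      ring.zero = {\<zero>\<^bsub>free_lmod_rank R n\<^esub>},
      ring.add = (\<lambda>U V. {the_elem U \<oplus>\<^bsub>free_lmod_rank R n\<^esub> the_elem V}),
      smult = (\<lambda>a U. {a \<odot>\<^bsub>free_lmod_rank R n\<^esub> the_elem U}) \<rparr>"

text \<open>For idempotent \<open>f\<close> these are the identities satisfied by the matrices of an isomorphism
\<open>w \<mapsto> (w A, w B)\<close> from \<open>R\<^sup>r\<close> to \<open>R\<^sup>s \<oplus> R\<^sup>n f\<close> and of its inverse \<open>(v, u) \<mapsto> v C + u D\<close>, where \<open>D\<close> is
extended to all of \<open>R\<^sup>n\<close> by \<open>u \<mapsto> u f D\<close>. Being polynomial in the entries, they can be transported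
along ring homomorphisms.\<close>

definition stably_free_mat :: "('a, 'c) ring_scheme \<Rightarrow> nat \<Rightarrow> (nat \<Rightarrow> nat \<Rightarrow> 'a) \<Rightarrow> bool" where
  "stably_free_mat R n f \<longleftrightarrow>
    (\<exists>r s. \<exists>A\<in>mats R r s. \<exists>B\<in>mats R r n. \<exists>C\<in>mats R s r. \<exists>D\<in>mats R n r.
       mat_add R (mat_mult R s A C) (mat_mult R n B D) = mat_one R r \<and>
       mat_mult R r C A = mat_one R s \<and> mat_mult R r C B = mat_zero R \<and>
       mat_mult R r D A = mat_zero R \<and> mat_mult R r D B = f)"

lemma row_module_simps:
  "\<zero>\<^bsub>row_module R n f\<^esub> = {\<zero>\<^bsub>free_lmod_rank R n\<^esub>}"
  "{u} \<oplus>\<^bsub>row_module R n f\<^esub> {v} = {u \<oplus>\<^bsub>free_lmod_rank R n\<^esub> v}"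
  "a \<odot>\<^bsub>row_module R n f\<^esub> {u} = {a \<odot>\<^bsub>free_lmod_rank R n\<^esub> u}"
  "{u} \<in> carrier (row_module R n f) \<longleftrightarrow>
    u \<in> carrier (free_lmod_rank R n) \<and> vec_mat R n n u f = u"
  by (simp_all add: row_module_def)

lemma row_moduleE:
  assumes "U \<in> carrier (row_module R n f)"
  obtains u where "U = {u}" "u \<in> carrier (free_lmod_rank R n)" "vec_mat R n n u f = u"
  using assms by (auto simp: row_module_def)

context ring
begin

lemma row_module_left_module:
  assumes f: "f \<in> mats R n n"
  shows "left_module R (row_module R n f)"
proof -
  interpret F: left_module R "Fr n" by (rule Fr_left_module)
  let ?Q = "row_module R n f"
  note hom = vec_mat_hom[OF f]
  have neg: "\<ominus> \<one> \<odot>\<^bsub>Fr n\<^esub> u \<oplus>\<^bsub>Fr n\<^esub> u = \<zero>\<^bsub>Fr n\<^esub>" if u: "u \<in> carrier (Fr n)" for u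
    using F.smult_l_distr[of "\<ominus> \<one>" \<one> u] u by (simp add: l_neg F.smult_l_null)
  have "abelian_group ?Q"
  proof (rule abelian_groupI)
    fix U V assume "U \<in> carrier ?Q" "V \<in> carrier ?Q"
    then show "U \<oplus>\<^bsub>?Q\<^esub> V \<in> carrier ?Q" "U \<oplus>\<^bsub>?Q\<^esub> V = V \<oplus>\<^bsub>?Q\<^esub> U"
      by (auto elim!: row_moduleE simp: row_module_simps lmod_homD[OF hom] F.M.a_comm)
  next
    show "\<zero>\<^bsub>?Q\<^esub> \<in> carrier ?Q"
      using lmod_hom_zero[OF Fr_left_module Fr_left_module hom] by (simp add: row_module_simps)
  next
    fix U V W assume "U \<in> carrier ?Q" "V \<in> carrier ?Q" "W \<in> carrier ?Q"
    then show "U \<oplus>\<^bsub>?Q\<^esub> V \<oplus>\<^bsub>?Q\<^esub> W = U \<oplus>\<^bsub>?Q\<^esub> (V \<oplus>\<^bsub>?Q\<^esub> W)"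
      by (auto elim!: row_moduleE simp: row_module_simps F.M.a_assoc)
  next
    fix U assume U: "U \<in> carrier ?Q"
    then show "\<zero>\<^bsub>?Q\<^esub> \<oplus>\<^bsub>?Q\<^esub> U = U"
      by (auto elim!: row_moduleE simp: row_module_simps)
    obtain u where u: "U = {u}" "u \<in> carrier (Fr n)" "vec_mat R n n u f = u"
      using U by (rule row_moduleE)
    then have "{\<ominus> \<one> \<odot>\<^bsub>Fr n\<^esub> u} \<in> carrier ?Q"
      by (simp add: row_module_simps lmod_homD[OF hom])
    moreover have "{\<ominus> \<one> \<odot>\<^bsub>Fr n\<^esub> u} \<oplus>\<^bsub>?Q\<^esub> U = \<zero>\<^bsub>?Q\<^esub>"
      using u by (simp add: row_module_simps neg)
    ultimately show "\<exists>V\<in>carrier ?Q. V \<oplus>\<^bsub>?Q\<^esub> U = \<zero>\<^bsub>?Q\<^esub>" by blast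
  qed
  then show ?thesis
  proof (intro left_module.intro left_module_axioms.intro ring_axioms)
    fix a U assume "a \<in> carrier R" "U \<in> carrier ?Q"
    then show "a \<odot>\<^bsub>?Q\<^esub> U \<in> carrier ?Q"
      by (auto elim!: row_moduleE simp: row_module_simps lmod_homD[OF hom])
  next
    fix a b U assume "a \<in> carrier R" "b \<in> carrier R" "U \<in> carrier ?Q"
    then show "(a \<oplus> b) \<odot>\<^bsub>?Q\<^esub> U = a \<odot>\<^bsub>?Q\<^esub> U \<oplus>\<^bsub>?Q\<^esub> b \<odot>\<^bsub>?Q\<^esub> U"
      "(a \<otimes> b) \<odot>\<^bsub>?Q\<^esub> U = a \<odot>\<^bsub>?Q\<^esub> (b \<odot>\<^bsub>?Q\<^esub> U)"
      by (auto elim!: row_moduleE simp: row_module_simps F.smult_l_distr F.smult_assoc1)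
  next
    fix a U V assume "a \<in> carrier R" "U \<in> carrier ?Q" "V \<in> carrier ?Q"
    then show "a \<odot>\<^bsub>?Q\<^esub> (U \<oplus>\<^bsub>?Q\<^esub> V) = a \<odot>\<^bsub>?Q\<^esub> U \<oplus>\<^bsub>?Q\<^esub> a \<odot>\<^bsub>?Q\<^esub> V"
      by (auto elim!: row_moduleE simp: row_module_simps F.smult_r_distr)
  next
    fix U assume "U \<in> carrier ?Q"
    then show "\<one> \<odot>\<^bsub>?Q\<^esub> U = U" by (auto elim!: row_moduleE simp: row_module_simps)
  qed
qed

text \<open>The row space of \<open>f\<close> is a retract of \<open>R\<^sup>n\<close>, so PSF applies to it, and the four matrices are those of
the components of the resulting isomorphism and its inverse.\<close>

lemma psf_idempotent:
  assumes f: "f \<in> mats R n n" and ff: "mat_mult R n f f = f"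
    and psf: "psf TYPE((nat \<Rightarrow> 'a) set) R"
  shows "stably_free_mat R n f"
proof -
  let ?Q = "row_module R n f"
  have Q: "left_module R ?Q" by (rule row_module_left_module[OF f])
  interpret Q: left_module R ?Q by (rule Q)
  note hom = vec_mat_hom[OF f]
  have idem: "vec_mat R n n (vec_mat R n n u f) f = vec_mat R n n u f" if "u \<in> carrier (Fr n)" for u
    using vec_mat_mult[OF that f f] by (simp add: ff)
  define \<pi> where "\<pi> = (\<lambda>u. {vec_mat R n n u f})"
  have \<pi>: "\<pi> \<in> lmod_hom R (Fr n) ?Q"
    by (rule lmod_homI) (simp_all add: \<pi>_def row_module_simps idem vec_mat_closed f lmod_homD[OF hom])
  have el: "the_elem \<in> lmod_hom R ?Q (Fr n)"
    by (rule lmod_homI) (auto elim!: row_moduleE simp: row_module_simps)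
  have \<pi>el: "\<pi> (the_elem U) = U" if "U \<in> carrier ?Q" for U
    using that by (auto elim!: row_moduleE simp: \<pi>_def)
  have el\<pi>: "the_elem (\<pi> u) = vec_mat R n n u f" for u by (simp add: \<pi>_def)
  have "fin_gen_lmod R ?Q"
    by (rule fin_gen_free_image[OF Q \<pi>]) (use \<pi>el lmod_homD(1)[OF el] in blast)
  moreover have "projective_lmod R ?Q" by (rule projective_free_retract[OF Q \<pi> el \<pi>el])
  ultimately have "stably_free_lmod R ?Q" using psf unfolding psf_def by blast
  then obtain r s \<theta> where \<theta>: "\<theta> \<in> lmod_hom R (Fr r) (lmod_dsum (Fr s) ?Q)"
    and bij: "bij_betw \<theta> (carrier (Fr r)) (carrier (lmod_dsum (Fr s) ?Q))"
    unfolding stably_free_lmod_def lmod_isomorphic_def by blast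
  let ?D = "lmod_dsum (Fr s) ?Q"
  define \<psi> where "\<psi> = inv_into (carrier (Fr r)) \<theta>"
  have \<psi>: "\<psi> \<in> lmod_hom R ?D (Fr r)"
    unfolding \<psi>_def by (rule lmod_hom_inv_into[OF Fr_left_module \<theta> bij])
  have \<theta>\<psi>: "\<theta> (\<psi> x) = x" if "x \<in> carrier ?D" for x
    using bij that unfolding \<psi>_def by (simp add: bij_betw_def f_inv_into_f)
  have \<psi>\<theta>: "\<psi> (\<theta> x) = x" if "x \<in> carrier (Fr r)" for x
    using bij that unfolding \<psi>_def by (simp add: bij_betw_def)
  interpret Fs: left_module R "Fr s" by (rule Fr_left_module)
  interpret Fr: left_module R "Fr r" by (rule Fr_left_module)
  have fst: "fst \<in> lmod_hom R ?D (Fr s)" and snd: "snd \<in> lmod_hom R ?D ?Q"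
    by (rule lmod_homI; auto simp: lmod_dsum_def)+
  have inl: "(\<lambda>v. (v, \<zero>\<^bsub>?Q\<^esub>)) \<in> lmod_hom R (Fr s) ?D"
    by (rule lmod_homI) (auto simp: lmod_dsum_def Q.smult_r_null)
  have inr: "(\<lambda>U. (\<zero>\<^bsub>Fr s\<^esub>, U)) \<in> lmod_hom R ?Q ?D"
    by (rule lmod_homI) (auto simp: lmod_dsum_def Fs.smult_r_null)
  define a where "a = (\<lambda>w. fst (\<theta> w))"
  define b where "b = (\<lambda>w. the_elem (snd (\<theta> w)))"
  define c where "c = (\<lambda>v. \<psi> (v, \<zero>\<^bsub>?Q\<^esub>))"
  define d where "d = (\<lambda>u. \<psi> (\<zero>\<^bsub>Fr s\<^esub>, \<pi> u))"
  have a: "a \<in> lmod_hom R (Fr r) (Fr s)" unfolding a_def by (rule lmod_hom_comp[OF \<theta> fst])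
  have b: "b \<in> lmod_hom R (Fr r) (Fr n)"
    unfolding b_def by (rule lmod_hom_comp[OF lmod_hom_comp[OF \<theta> snd] el])
  have c: "c \<in> lmod_hom R (Fr s) (Fr r)" unfolding c_def by (rule lmod_hom_comp[OF inl \<psi>])
  have d: "d \<in> lmod_hom R (Fr n) (Fr r)"
    unfolding d_def by (rule lmod_hom_comp[OF lmod_hom_comp[OF \<pi> inr] \<psi>])
  have ac_bd: "c (a w) \<oplus>\<^bsub>Fr r\<^esub> d (b w) = w" if w: "w \<in> carrier (Fr r)" for w
  proof -
    have \<theta>w: "fst (\<theta> w) \<in> carrier (Fr s)" "snd (\<theta> w) \<in> carrier ?Q"
      using lmod_homD(1)[OF \<theta> w] by (auto simp: lmod_dsum_def)
    have "c (a w) \<oplus>\<^bsub>Fr r\<^esub> d (b w) =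
        \<psi> (fst (\<theta> w), \<zero>\<^bsub>?Q\<^esub>) \<oplus>\<^bsub>Fr r\<^esub> \<psi> (\<zero>\<^bsub>Fr s\<^esub>, snd (\<theta> w))"
      using \<theta>w by (simp add: a_def b_def c_def d_def \<pi>el)
    also have "\<dots> = \<psi> ((fst (\<theta> w), \<zero>\<^bsub>?Q\<^esub>) \<oplus>\<^bsub>?D\<^esub> (\<zero>\<^bsub>Fr s\<^esub>, snd (\<theta> w)))"
      using \<theta>w lmod_homD(1)[OF inl] lmod_homD(1)[OF inr] by (intro lmod_homD(2)[OF \<psi>, symmetric])
    also have "(fst (\<theta> w), \<zero>\<^bsub>?Q\<^esub>) \<oplus>\<^bsub>?D\<^esub> (\<zero>\<^bsub>Fr s\<^esub>, snd (\<theta> w)) = \<theta> w"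
      using \<theta>w by (simp add: lmod_dsum_def)
    finally show ?thesis using \<psi>\<theta>[OF w] by simp
  qed
  have ca: "a (c v) = v" and cb: "b (c v) = \<zero>\<^bsub>Fr n\<^esub>" if "v \<in> carrier (Fr s)" for v
    using \<theta>\<psi>[OF lmod_homD(1)[OF inl that]] by (simp_all add: a_def b_def c_def row_module_simps)
  have da: "a (d u) = \<zero>\<^bsub>Fr s\<^esub>" and db: "b (d u) = vec_mat R n n u f" if "u \<in> carrier (Fr n)" for u
    using \<theta>\<psi>[OF lmod_homD(1)[OF lmod_hom_comp[OF \<pi> inr] that]]
    by (simp_all add: a_def b_def d_def el\<pi>)
  define A where "A = hom_mat R r s a"
  define B where "B = hom_mat R r n b"
  define C where "C = hom_mat R s r c"
  define D where "D = hom_mat R n r d"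
  have A: "A \<in> mats R r s" and B: "B \<in> mats R r n" and C: "C \<in> mats R s r" and D: "D \<in> mats R n r"
    unfolding A_def B_def C_def D_def by (rule hom_mat_closed[OF a] hom_mat_closed[OF b]
        hom_mat_closed[OF c] hom_mat_closed[OF d])+
  have comp: "vec_mat R k m u (mat_mult R l (hom_mat R k l p) (hom_mat R l m q)) = q (p u)"
    if "p \<in> lmod_hom R (Fr k) (Fr l)" "q \<in> lmod_hom R (Fr l) (Fr m)" "u \<in> carrier (Fr k)"
    for k l m p q u
    using that by (simp add: vec_mat_mult hom_mat_closed hom_mat lmod_homD(1)[OF that(1)])
  have "mat_add R (mat_mult R s A C) (mat_mult R n B D) = mat_one R r"
  proof (rule mat_eqI)
    fix w assume w: "w \<in> carrier (Fr r)"
    show "vec_mat R r r w (mat_add R (mat_mult R s A C) (mat_mult R n B D)) =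
        vec_mat R r r w (mat_one R r)"
      unfolding vec_mat_add[OF w mat_mult_closed[OF A C] mat_mult_closed[OF B D]] vec_mat_one[OF w]
      unfolding A_def B_def C_def D_def comp[OF a c w] comp[OF b d w] by (rule ac_bd[OF w])
  qed (intro mat_add_closed mat_mult_closed[OF A C] mat_mult_closed[OF B D] mat_one_closed)+
  moreover have "mat_mult R r C A = mat_one R s"
  proof (rule mat_eqI)
    fix v assume v: "v \<in> carrier (Fr s)"
    show "vec_mat R s s v (mat_mult R r C A) = vec_mat R s s v (mat_one R s)"
      unfolding A_def C_def comp[OF c a v] vec_mat_one[OF v] by (rule ca[OF v])
  qed (intro mat_mult_closed[OF C A] mat_one_closed)+
  moreover have "mat_mult R r C B = mat_zero R"
  proof (rule mat_eqI)
    fix v assume v: "v \<in> carrier (Fr s)"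
    show "vec_mat R s n v (mat_mult R r C B) = vec_mat R s n v (mat_zero R)"
      unfolding B_def C_def comp[OF c b v] vec_mat_zero[OF v] by (rule cb[OF v])
  qed (intro mat_mult_closed[OF C B] mat_zero_closed)+
  moreover have "mat_mult R r D A = mat_zero R"
  proof (rule mat_eqI)
    fix v assume v: "v \<in> carrier (Fr n)"
    show "vec_mat R n s v (mat_mult R r D A) = vec_mat R n s v (mat_zero R)"
      unfolding A_def D_def comp[OF d a v] vec_mat_zero[OF v] by (rule da[OF v])
  qed (intro mat_mult_closed[OF D A] mat_zero_closed)+
  moreover have "mat_mult R r D B = f"
  proof (rule mat_eqI)
    fix v assume v: "v \<in> carrier (Fr n)"
    show "vec_mat R n n v (mat_mult R r D B) = vec_mat R n n v f"
      unfolding B_def D_def comp[OF d b v] by (rule db[OF v])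
  qed (intro mat_mult_closed[OF D B] f)+
  ultimately show ?thesis
    unfolding stably_free_mat_def using A B C D by blast
qed

text \<open>The retraction identifies \<open>P\<close> with the row space of the idempotent matrix of \<open>h \<circ> g\<close>, and
the isomorphism encoded by the four matrices is transported along this identification.\<close>

lemma stably_free_lmodI:
  fixes P :: "('a, 'm) module"
  assumes P: "left_module R P" and g: "g \<in> lmod_hom R (Fr n) P" and h: "h \<in> lmod_hom R P (Fr n)"
    and gh: "\<And>x. x \<in> carrier P \<Longrightarrow> g (h x) = x"
    and sf: "stably_free_mat R n (hom_mat R n n (\<lambda>u. h (g u)))"
  shows "stably_free_lmod R P"
proof -
  interpret P: left_module R P by (rule P)
  obtain r s A B C D where A: "A \<in> mats R r s" and B: "B \<in> mats R r n"
    and C: "C \<in> mats R s r" and D: "D \<in> mats R n r"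
    and one: "mat_add R (mat_mult R s A C) (mat_mult R n B D) = mat_one R r"
    and CA: "mat_mult R r C A = mat_one R s" and CB: "mat_mult R r C B = mat_zero R"
    and DA: "mat_mult R r D A = mat_zero R"
    and DB: "mat_mult R r D B = hom_mat R n n (\<lambda>u. h (g u))"
    using sf unfolding stably_free_mat_def by blast
  interpret Fr: left_module R "Fr r" by (rule Fr_left_module)
  interpret Fs: left_module R "Fr s" by (rule Fr_left_module)
  interpret Fn: left_module R "Fr n" by (rule Fr_left_module)
  let ?a = "\<lambda>w. vec_mat R r s w A" and ?b = "\<lambda>w. vec_mat R r n w B"
    and ?c = "\<lambda>v. vec_mat R s r v C" and ?d = "\<lambda>u. vec_mat R n r u D"
  note a = vec_mat_hom[OF A] and b = vec_mat_hom[OF B] and c = vec_mat_hom[OF C]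
    and d = vec_mat_hom[OF D]
  have hg: "(\<lambda>u. h (g u)) \<in> lmod_hom R (Fr n) (Fr n)" by (rule lmod_hom_comp[OF g h])
  have ac_bd: "?c (?a w) \<oplus>\<^bsub>Fr r\<^esub> ?d (?b w) = w" if w: "w \<in> carrier (Fr r)" for w
    using vec_mat_add[OF w mat_mult_closed[OF A C, of s] mat_mult_closed[OF B D, of n]]
      vec_mat_one[OF w]
    by (simp add: vec_mat_mult[OF w A C] vec_mat_mult[OF w B D] one)
  have ca: "?a (?c v) = v" and cb: "?b (?c v) = \<zero>\<^bsub>Fr n\<^esub>" if v: "v \<in> carrier (Fr s)" for v
    using vec_mat_mult[OF v C A] vec_mat_mult[OF v C B] vec_mat_one[OF v] vec_mat_zero[OF v, of n]
    by (simp_all add: CA CB)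
  have da: "?a (?d u) = \<zero>\<^bsub>Fr s\<^esub>" and db: "?b (?d u) = h (g u)" if u: "u \<in> carrier (Fr n)" for u
    using vec_mat_mult[OF u D A] vec_mat_mult[OF u D B] vec_mat_zero[OF u, of s] hom_mat[OF hg u]
    by (simp_all add: DA DB)
  have bh: "h (g (?b w)) = ?b w" if w: "w \<in> carrier (Fr r)" for w
  proof -
    let ?w = "?c (?a w)" and ?w' = "?d (?b w)"
    have cl: "?a w \<in> carrier (Fr s)" "?b w \<in> carrier (Fr n)" "?w \<in> carrier (Fr r)" "?w' \<in> carrier (Fr r)"
      using lmod_homD(1)[OF a] lmod_homD(1)[OF b] lmod_homD(1)[OF c] lmod_homD(1)[OF d] w by simp_all
    have "?b w = ?b (?w \<oplus>\<^bsub>Fr r\<^esub> ?w')" using ac_bd[OF w] by simp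
    also have "\<dots> = ?b ?w \<oplus>\<^bsub>Fr n\<^esub> ?b ?w'" by (rule lmod_homD(2)[OF b cl(3,4)])
    also have "\<dots> = h (g (?b w))"
      unfolding cb[OF cl(1)] db[OF cl(2)]
      by (rule Fn.M.l_zero[OF lmod_homD(1)[OF hg cl(2)]])
    finally show ?thesis by simp
  qed
  define \<Theta> where "\<Theta> = (\<lambda>w. (?a w, g (?b w)))"
  define \<Psi> where "\<Psi> = (\<lambda>(v, x). ?c v \<oplus>\<^bsub>Fr r\<^esub> ?d (h x))"
  let ?D = "lmod_dsum (Fr s) P"
  have gb: "(\<lambda>w. g (?b w)) \<in> lmod_hom R (Fr r) P" by (rule lmod_hom_comp[OF b g])
  have "\<Theta> \<in> lmod_hom R (Fr r) ?D"
    by (rule lmod_homI) (simp_all add: \<Theta>_def lmod_dsum_def lmod_homD[OF a] lmod_homD[OF gb])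
  moreover have "bij_betw \<Theta> (carrier (Fr r)) (carrier ?D)"
  proof (rule bij_betw_byWitness[where f' = \<Psi>])
    show "\<forall>w\<in>carrier (Fr r). \<Psi> (\<Theta> w) = w"
      by (simp add: \<Psi>_def \<Theta>_def bh ac_bd)
    show "\<Theta> ` carrier (Fr r) \<subseteq> carrier ?D"
      using lmod_homD(1)[OF a] lmod_homD(1)[OF gb] by (auto simp: \<Theta>_def lmod_dsum_def)
    have cl: "?c v \<in> carrier (Fr r)" "?d (h x) \<in> carrier (Fr r)" "h x \<in> carrier (Fr n)"
      if "v \<in> carrier (Fr s)" "x \<in> carrier P" for v x
      using lmod_homD(1)[OF c] lmod_homD(1)[OF d] lmod_homD(1)[OF h] that by simp_all
    show "\<Psi> ` carrier ?D \<subseteq> carrier (Fr r)"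
      using cl by (auto simp: \<Psi>_def lmod_dsum_def)
    have "\<Theta> (\<Psi> (v, x)) = (v, x)" if v: "v \<in> carrier (Fr s)" and x: "x \<in> carrier P" for v x
    proof -
      have hx: "h x \<in> carrier (Fr n)" using cl(3)[OF v x] .
      have "?a (\<Psi> (v, x)) = v"
        using lmod_homD(2)[OF a cl(1,2)[OF v x]] v by (simp add: \<Psi>_def ca da[OF hx])
      moreover have "?b (\<Psi> (v, x)) = h x"
        using lmod_homD(2)[OF b cl(1,2)[OF v x]] hx by (simp add: \<Psi>_def cb[OF v] db[OF hx] gh[OF x])
      ultimately show ?thesis by (simp add: \<Theta>_def gh[OF x])
    qed
    then show "\<forall>y\<in>carrier ?D. \<Theta> (\<Psi> y) = y" by (auto simp: lmod_dsum_def)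
  qed
  ultimately show ?thesis
    unfolding stably_free_lmod_def lmod_isomorphic_def using P by blast
qed

text \<open>If \<open>e u = u f\<close>, multiplication by \<open>u\<close> identifies the row spaces of \<open>e\<close> and \<open>f\<close>; on matrices
this means replacing \<open>B\<close> by \<open>B u\<^sup>-\<^sup>1\<close> and \<open>D\<close> by \<open>u D\<close>.\<close>

lemma stably_free_mat_conjugate:
  assumes e: "e \<in> mats R n n" and sf: "stably_free_mat R n f" and f: "f \<in> mats R n n"
    and u: "u \<in> Units (mat_ring R n)" and eq: "mat_mult R n e u = mat_mult R n u f"
  shows "stably_free_mat R n e"
proof -
  interpret M: ring "mat_ring R n" by (rule mat_ring_ring)
  let ?v = "inv\<^bsub>mat_ring R n\<^esub> u"
  have U: "u \<in> mats R n n" and V: "?v \<in> mats R n n"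
    and uv: "mat_mult R n u ?v = mat_one R n" and vu: "mat_mult R n ?v u = mat_one R n"
    using M.Units_closed[OF u] M.Units_inv_closed[OF u] M.Units_r_inv[OF u] M.Units_l_inv[OF u]
    by simp_all
  obtain r s A B C D where A: "A \<in> mats R r s" and B: "B \<in> mats R r n"
    and C: "C \<in> mats R s r" and D: "D \<in> mats R n r"
    and one: "mat_add R (mat_mult R s A C) (mat_mult R n B D) = mat_one R r"
    and CA: "mat_mult R r C A = mat_one R s" and CB: "mat_mult R r C B = mat_zero R"
    and DA: "mat_mult R r D A = mat_zero R" and DB: "mat_mult R r D B = f"
    using sf unfolding stably_free_mat_def by blast
  define B' where "B' = mat_mult R n B ?v"
  define D' where "D' = mat_mult R n u D"
  have B': "B' \<in> mats R r n" and D': "D' \<in> mats R n r"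
    unfolding B'_def D'_def by (rule mat_mult_closed[OF B V] mat_mult_closed[OF U D])+
  have "mat_mult R n B' D' = mat_mult R n B (mat_mult R n ?v (mat_mult R n u D))"
    unfolding B'_def D'_def by (rule mat_mult_assoc[OF B V mat_mult_closed[OF U D]])
  also have "mat_mult R n ?v (mat_mult R n u D) = D"
    unfolding mat_mult_assoc[OF V U D, symmetric] vu by (rule mat_one_left[OF D])
  finally have BD: "mat_mult R n B' D' = mat_mult R n B D" .
  have zero_left: "mat_mult R k L (mat_zero R) = mat_zero R" if "L \<in> mats R m k" for L m k
    using mats_closed[OF that] by (simp add: mat_mult_def mat_zero_def)
  have zero_right: "mat_mult R k (mat_zero R) L = mat_zero R" if "L \<in> mats R k m" for L m k
    using mats_closed[OF that] by (simp add: mat_mult_def mat_zero_def)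
  have "mat_mult R r C B' = mat_zero R"
    unfolding B'_def mat_mult_assoc[OF C B V, symmetric] CB by (rule zero_right[OF V])
  moreover have "mat_mult R r D' A = mat_zero R"
    unfolding D'_def mat_mult_assoc[OF U D A] DA by (rule zero_left[OF U])
  moreover have "mat_mult R r D' B' = e"
  proof -
    have "mat_mult R r D' B' = mat_mult R n u (mat_mult R r D (mat_mult R n B ?v))"
      unfolding D'_def B'_def by (rule mat_mult_assoc[OF U D mat_mult_closed[OF B V]])
    also have "\<dots> = mat_mult R n (mat_mult R n u f) ?v"
      unfolding mat_mult_assoc[OF D B V, symmetric] DB mat_mult_assoc[OF U f V] ..
    also have "\<dots> = mat_mult R n e (mat_mult R n u ?v)"
      unfolding eq[symmetric] by (rule mat_mult_assoc[OF e U V])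
    also have "\<dots> = e" unfolding uv by (rule mat_one_right[OF e])
    finally show ?thesis .
  qed
  ultimately show ?thesis
    unfolding stably_free_mat_def using A B' C D' one CA BD by metis
qed

end

definition map_mat :: "('a \<Rightarrow> 'e) \<Rightarrow> (nat \<Rightarrow> nat \<Rightarrow> 'a) \<Rightarrow> nat \<Rightarrow> nat \<Rightarrow> 'e" where
  "map_mat h A = (\<lambda>i j. h (A i j))"

context ring_hom_ring
begin

lemma map_mat_closed: "A \<in> mats R m n \<Longrightarrow> map_mat h A \<in> mats S m n"
  by (simp add: map_mat_def mats_def)

lemma map_mat_mult:
  assumes "A \<in> mats R m k'" "B \<in> mats R k'' n"
  shows "mat_mult S k (map_mat h A) (map_mat h B) = map_mat h (mat_mult R k A B)"
  using mats_closed[OF assms(1)] mats_closed[OF assms(2)]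
  by (simp add: map_mat_def mat_mult_def fun_eq_iff Pi_def comp_def)

end

lemma stably_free_mat_hom:
  assumes R: "ring R" and S: "ring S" and \<iota>: "\<iota> \<in> ring_hom R S" and sf: "stably_free_mat R n f"
  shows "stably_free_mat S n (map_mat \<iota> f)"
proof -
  interpret ring_hom_ring R S \<iota> by (rule ring_hom_ringI2[OF R S \<iota>])
  obtain r s A B C D where A: "A \<in> mats R r s" and B: "B \<in> mats R r n"
    and C: "C \<in> mats R s r" and D: "D \<in> mats R n r"
    and one: "mat_add R (mat_mult R s A C) (mat_mult R n B D) = mat_one R r"
    and CA: "mat_mult R r C A = mat_one R s" and CB: "mat_mult R r C B = mat_zero R"
    and DA: "mat_mult R r D A = mat_zero R" and DB: "mat_mult R r D B = f"
    using sf unfolding stably_free_mat_def by blast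
  let ?m = "map_mat \<iota>"
  have m_add: "mat_add S (?m K) (?m L) = ?m (mat_add R K L)"
    if "K \<in> mats R p q" "L \<in> mats R p q" for K L p q
    using mats_closed[OF that(1)] mats_closed[OF that(2)] by (simp add: map_mat_def mat_add_def)
  have m_one: "mat_one S k = ?m (mat_one R k)" for k by (simp add: map_mat_def mat_one_def fun_eq_iff)
  have m_zero: "mat_zero S = ?m (mat_zero R)" by (simp add: map_mat_def mat_zero_def)
  have "mat_add S (mat_mult S s (?m A) (?m C)) (mat_mult S n (?m B) (?m D)) = mat_one S r"
    unfolding map_mat_mult[OF A C] map_mat_mult[OF B D] m_one one[symmetric]
    by (rule m_add[OF R.mat_mult_closed[OF A C] R.mat_mult_closed[OF B D]])
  moreover have "mat_mult S r (?m C) (?m A) = mat_one S s" "mat_mult S r (?m C) (?m B) = mat_zero S"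
    "mat_mult S r (?m D) (?m A) = mat_zero S" "mat_mult S r (?m D) (?m B) = ?m f"
    unfolding map_mat_mult[OF C A] map_mat_mult[OF C B] map_mat_mult[OF D A] map_mat_mult[OF D B] CA CB DA DB m_one m_zero
    by (rule refl)+
  ultimately have "stably_free_mat S n (?m f)"
    unfolding stably_free_mat_def using map_mat_closed[OF A] map_mat_closed[OF B] map_mat_closed[OF C] map_mat_closed[OF D]
    by blast
  then show ?thesis .
qed

section \<open>Idempotent matrices over skew power series\<close>

text \<open>The constant coefficients of \<open>e\<close> form an idempotent modulo \<open>J\<close>. It is lifted in the matrix ring over
\<open>R\<close>, and the lift is then compared with \<open>e\<close> in the matrix ring over \<open>S\<close>. Taking constant
coefficients is multiplicative only modulo \<open>J\<close>, so the computation is carried out over \<open>S\<close> with the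
embedded matrix of constant coefficients.\<close>

lemma (in skew_series) idempotent_conjugate_const:
  assumes e: "e \<in> mats S n n" and ee: "mat_mult S n e e = e"
  shows "\<exists>f\<in>mats R n n. mat_mult R n f f = f \<and>
    (\<exists>u\<in>Units (mat_ring S n). mat_mult S n e u = mat_mult S n u (map_mat const_series f))"
proof -
  let ?MR = "mat_ring R n" and ?MS = "mat_ring S n"
  let ?FR = "mat_filtration R n F" and ?FS = "mat_filtration S n S_filtration"
  interpret S: complete_filtered_ring S S_filtration by (rule S_complete_filtered)
  interpret MR: complete_filtered_ring ?MR ?FR by (rule mat_ring_complete_filtered)
  interpret MS: complete_filtered_ring ?MS ?FS by (rule S.mat_ring_complete_filtered)
  let ?m = "map_mat const_series"
  interpret c: ring_hom_ring R S const_series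
    by (rule ring_hom_ringI2[OF ring_axioms S_ring const_series_hom])
  note m_closed = c.map_mat_closed and m_mult = c.map_mat_mult
  have m_minus: "?m (A \<ominus>\<^bsub>?MR\<^esub> B) = ?m A \<ominus>\<^bsub>?MS\<^esub> ?m B"
    if A: "A \<in> mats R n n" and B: "B \<in> mats R n n" for A B
  proof (rule ext, rule ext)
    fix i j
    have "?m (A \<ominus>\<^bsub>?MR\<^esub> B) i j = const_series (A i j) \<ominus>\<^bsub>S\<^esub> const_series (B i j)"
      using mats_closed[OF A] mats_closed[OF B]
      by (simp add: map_mat_def mat_ring_minus[OF A B] minus_eq S.minus_eq)
    then show "?m (A \<ominus>\<^bsub>?MR\<^esub> B) i j = (?m A \<ominus>\<^bsub>?MS\<^esub> ?m B) i j"
      by (simp add: S.mat_ring_minus[OF m_closed[OF A] m_closed[OF B]]) (simp add: map_mat_def)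
  qed
  have m_filtration: "?m A \<in> ?FS k \<longleftrightarrow> A \<in> ?FR k" if "A \<in> mats R n n" for A k
    using that m_closed[OF that]
    by (simp add: mat_filtration_def map_mat_def const_series_filtration)
  have ser: "series (e i j)" for i j using mats_closed[OF e] S_carrier by blast
  define e0 where "e0 = (\<lambda>i j. e i j 0)"
  have e0: "e0 \<in> mats R n n"
    by (rule matsI) (use ser mats_outside[OF e] in \<open>auto simp: e0_def S_simps\<close>)
  have e0e: "?m e0 \<ominus>\<^bsub>?MS\<^esub> e \<in> ?FS 1"
    using MS.minus_closed[of "?m e0" e] m_closed[OF e0] e const_series_approx[OF ser]
    by (simp add: mat_filtration_def S.mat_ring_minus) (simp add: map_mat_def e0_def)
  have "?m e0 \<otimes>\<^bsub>?MS\<^esub> ?m e0 \<ominus>\<^bsub>?MS\<^esub> e \<otimes>\<^bsub>?MS\<^esub> e \<in> ?FS 1"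
    by (rule MS.F_mult_diff[OF e0e e0e]) (use e m_closed[OF e0] in simp_all)
  then have "?m e0 \<otimes>\<^bsub>?MS\<^esub> ?m e0 \<ominus>\<^bsub>?MS\<^esub> e \<in> ?FS 1" by (simp add: ee)
  moreover have "e \<ominus>\<^bsub>?MS\<^esub> ?m e0 \<in> ?FS 1"
    by (rule MS.F_diff_sym[OF e0e]) (use e m_closed[OF e0] in simp_all)
  ultimately have "?m e0 \<otimes>\<^bsub>?MS\<^esub> ?m e0 \<ominus>\<^bsub>?MS\<^esub> ?m e0 \<in> ?FS 1"
    by (rule MS.F_diff_trans)
      (use e m_closed[OF e0] MS.m_closed[of "?m e0" "?m e0"] in simp_all)
  then have "?m (mat_mult R n e0 e0 \<ominus>\<^bsub>?MR\<^esub> e0) \<in> ?FS 1"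
    by (simp add: m_mult[OF e0 e0] m_minus[OF mat_mult_closed[OF e0 e0] e0])
  then have "e0 \<otimes>\<^bsub>?MR\<^esub> e0 \<ominus>\<^bsub>?MR\<^esub> e0 \<in> ?FR 1"
    using m_filtration[of "mat_mult R n e0 e0 \<ominus>\<^bsub>?MR\<^esub> e0" 1]
      MR.minus_closed[of "mat_mult R n e0 e0" e0] mat_mult_closed[OF e0 e0] e0 by simp
  then obtain f where f: "f \<in> mats R n n" and ff: "mat_mult R n f f = f"
    and fe0: "f \<ominus>\<^bsub>?MR\<^esub> e0 \<in> ?FR 1"
    using MR.idempotent_lift[of e0] e0 by auto
  have "?m (f \<ominus>\<^bsub>?MR\<^esub> e0) \<in> ?FS 1"
    using m_filtration[of "f \<ominus>\<^bsub>?MR\<^esub> e0" 1] MR.minus_closed[of f e0] f e0 fe0 by simp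
  then have "?m f \<ominus>\<^bsub>?MS\<^esub> ?m e0 \<in> ?FS 1" by (simp add: m_minus[OF f e0])
  then have "?m f \<ominus>\<^bsub>?MS\<^esub> e \<in> ?FS 1"
    by (rule MS.F_diff_trans[OF _ e0e]) (use e m_closed[OF f] m_closed[OF e0] in simp_all)
  then have "e \<ominus>\<^bsub>?MS\<^esub> ?m f \<in> ?FS 1"
    by (rule MS.F_diff_sym) (use e m_closed[OF f] in simp_all)
  then have "\<exists>u\<in>Units ?MS. e \<otimes>\<^bsub>?MS\<^esub> u = u \<otimes>\<^bsub>?MS\<^esub> ?m f"
    by (intro MS.idempotents_conjugate) (use e ee m_closed[OF f] m_mult[OF f f] ff in simp_all)
  then show ?thesis using f ff by auto
qed

theorem mainTheorem1:
  fixes R :: "('a, 'b) ring_scheme" and \<sigma> \<delta> :: "'a \<Rightarrow> 'a"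
  assumes "ring R"
    and "adically_complete R (jacobson_radical R)"
    and "\<sigma> \<in> ring_iso R R"
    and "\<sigma> ` jacobson_radical R \<subseteq> jacobson_radical R"
    and "sigma_derivation R \<sigma> \<delta>"
    and "sigma_nilpotent R (jacobson_radical R) \<sigma> \<delta>"
    and "\<delta> ` carrier R \<subseteq> jacobson_radical R"
    and "\<delta> ` jacobson_radical R \<subseteq> ideal_power R (jacobson_radical R) 2"
    and "left_noetherian R"
    and "left_regular TYPE((nat \<Rightarrow> 'a) set) R"
    and "psf TYPE((nat \<Rightarrow> 'a) set) R"
  shows "psf TYPE('m) (skew_power_series R \<sigma> \<delta>)"
proof -
  interpret skew_series R \<sigma> \<delta>
    using assms(1-5,7,8) by (intro skew_seriesI) (auto simp: ring_iso_def)
  interpret S: ring S by (rule S_ring)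
  show ?thesis
    unfolding psf_def
  proof (intro conjI allI impI S_ring)
    fix P :: "(nat \<Rightarrow> 'a, 'm) module"
    assume P: "fin_gen_lmod S P \<and> projective_lmod S P"
    then have left: "left_module S P" by (simp add: fin_gen_lmod_def)
    obtain n g h where g: "g \<in> lmod_hom S (S.Fr n) P" and h: "h \<in> lmod_hom S P (S.Fr n)"
      and gh: "\<And>x. x \<in> carrier P \<Longrightarrow> g (h x) = x"
      using S.fin_gen_projective_retract[of P] P by blast
    have hg: "(\<lambda>u. h (g u)) \<in> lmod_hom S (S.Fr n) (S.Fr n)" by (rule lmod_hom_comp[OF g h])
    define e where "e = hom_mat S n n (\<lambda>u. h (g u))"
    have e: "e \<in> mats S n n" unfolding e_def by (rule S.hom_mat_closed[OF hg])
    have "mat_mult S n e e = e"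
    proof (rule S.mat_eqI[OF S.mat_mult_closed[OF e e] e])
      fix u assume u: "u \<in> carrier (S.Fr n)"
      show "vec_mat S n n u (mat_mult S n e e) = vec_mat S n n u e"
        unfolding S.vec_mat_mult[OF u e e] unfolding e_def S.hom_mat[OF hg u]
          S.hom_mat[OF hg lmod_homD(1)[OF hg u]] gh[OF lmod_homD(1)[OF g u]] ..
    qed
    then obtain f u where f: "f \<in> mats R n n" "mat_mult R n f f = f"
      and u: "u \<in> Units (mat_ring S n)"
      and eu: "mat_mult S n e u = mat_mult S n u (map_mat const_series f)"
      using idempotent_conjugate_const[OF e] by blast
    have "stably_free_mat R n f" by (rule psf_idempotent[OF f assms(11)])
    then have "stably_free_mat S n (map_mat const_series f)"
      by (rule stably_free_mat_hom[OF ring_axioms S_ring const_series_hom])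
    moreover have "(map_mat const_series f) \<in> mats S n n"
      using f(1) by (auto simp: map_mat_def mats_def S_simps const_series_def)
    ultimately have "stably_free_mat S n e"
      using S.stably_free_mat_conjugate[OF e _ _ u eu] by blast
    then have sf: "stably_free_mat S n (hom_mat S n n (\<lambda>u. h (g u)))" by (simp only: e_def)
    show "stably_free_lmod S P"
      by (rule S.stably_free_lmodI[OF left g h _ sf]) (rule gh)
  qed
qed

end
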